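(* Let $0\le\varepsilon_0\le\varepsilon_1\le 1$ and $s\in\mathbb{N}$. Suppose an $s$-accurate $n^{\varepsilon_0}$-look-ahead for the column indices of future column updates and the row indices of future row queries is given. Then there exists a dynamic algorithm maintaining the inverse of an $n\times n$ matrix $A$ over a field (which stays invertible) that supports column updates to $A$ and row queries to $A^{-1}$ in $O(n^{\omega(1,\varepsilon_1,\varepsilon_0)-\varepsilon_0}+n^{\omega(1,1,\varepsilon_1)-\varepsilon_1})$ field operations each. The pre-processing requires $O(n^\omega)$ field operations.
   Context: $s$-accurate $l$-look-ahead: for a dynamic inverse problem with column updates and row queries, a family of sets $F_i^{(t)}\subseteq[n]$ ($t\ge 0$, $0\le i\le l$), where $F_i^{(t)}$ is known at round $t$ and contains all column indices of updates and row indices of queries occurring in rounds $t,t+1,\dots,t+i$, satisfying $|F_i^{(t)}|\le s\cdot i$ for all $i,t$, and $F_{i_2}^{(t_2)}\subseteq F_{i_1}^{(t_1)}$ whenever $t_1\le t_2\le t_2+i_2\le t_1+i_1$. Column values need not be known in advance. $\omega(a,b,c)$ is the exponent of multiplying an $n^a\times n^b$ by an $n^b\times n^c$ matrix in $O(n^{\omega(a,b,c)})$ operations; $\omega=\omega(1,1,1)$. *)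

theory Defs
  imports Complex_Main "HOL-Library.Poly_Mapping" "Jordan_Normal_Form.Determinant"
begin

text \<open>
  Algorithms are straight-line programs over a field (arithmetic circuits with registers); only
  field operations are counted. The first register of an instruction is its target.
  Constants and copies are free. All discrete data (indices, look-ahead sets) is free as well: the
  program may depend on it arbitrarily, but field elements are accessible through the
  instructions only. There is no branching on field elements; with the convention
  \<open>x / 0 = 0\<close>, the value \<open>x / x\<close> is a zero test, which is counted like any
  other operation. (A machine with free control flow after unit-cost zero tests would be
  inappropriate over finite fields, where it could read off its input and compute for free.)
\<close>

datatype 'a instr =
    Const nat 'a
  | Copy nat nat
  | Add nat nat nat
  | Sub nat nat nat
  | Mul nat nat nat
  | Div nat nat nat

type_synonym 'a prog = "'a instr list"

fun instr_cost :: "'a instr \<Rightarrow> nat" where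
  "instr_cost (Const _ _) = 0"
| "instr_cost (Copy _ _) = 0"
| "instr_cost _ = 1"

definition cost :: "'a prog \<Rightarrow> nat" where
  "cost p = sum_list (map instr_cost p)"

text \<open>
  The ring of values \<open>'r\<close> may differ from the field \<open>'a\<close> of constants;
  \<open>\<iota>\<close> embeds the constants, and \<open>dv\<close> interprets division.
\<close>

fun exec_instr ::
  "('a \<Rightarrow> 'r::comm_ring_1) \<Rightarrow> ('r \<Rightarrow> 'r \<Rightarrow> 'r) \<Rightarrow> 'a instr \<Rightarrow> (nat \<Rightarrow> 'r) \<Rightarrow> (nat \<Rightarrow> 'r)" where
  "exec_instr \<iota> dv (Const r c) m = m(r := \<iota> c)"
| "exec_instr \<iota> dv (Copy r x) m = m(r := m x)"
| "exec_instr \<iota> dv (Add r x y) m = m(r := m x + m y)"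
| "exec_instr \<iota> dv (Sub r x y) m = m(r := m x - m y)"
| "exec_instr \<iota> dv (Mul r x y) m = m(r := m x * m y)"
| "exec_instr \<iota> dv (Div r x y) m = m(r := dv (m x) (m y))"

definition run :: "'a::field prog \<Rightarrow> (nat \<Rightarrow> 'a) \<Rightarrow> (nat \<Rightarrow> 'a)" where
  "run p = fold (exec_instr (\<lambda>c. c) (/)) p"


section \<open>The exponent of rectangular matrix multiplication\<close>

text \<open>
  As usual in algebraic complexity theory, the arithmetic complexity of matrix multiplication over
  \<open>K\<close> is the number of operations for computing the entries of the product of two generic
  matrices, as polynomials in the indeterminates. For finite \<open>K\<close> this is not
  the same as being correct for all matrices over \<open>K\<close>. Programs are division-free; by
  Strassen's theorem on the elimination of divisions this does not change the exponent.
\<close>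

type_synonym 'a multi_poly = "(nat \<Rightarrow>\<^sub>0 nat) \<Rightarrow>\<^sub>0 'a"

definition const_poly :: "'a::field \<Rightarrow> 'a multi_poly" where
  "const_poly c = Poly_Mapping.single 0 c"

definition indet :: "nat \<Rightarrow> 'a::field multi_poly" where
  "indet v = Poly_Mapping.single (Poly_Mapping.single v 1) 1"

definition division_free :: "'a prog \<Rightarrow> bool" where
  "division_free p \<longleftrightarrow> (\<forall>r x y. Div r x y \<notin> set p)"

text \<open>Symbolic execution; only meaningful for division-free programs.\<close>

definition formal_run :: "'a::field prog \<Rightarrow> (nat \<Rightarrow> 'a multi_poly) \<Rightarrow> (nat \<Rightarrow> 'a multi_poly)" where
  "formal_run p = fold (exec_instr const_poly (\<lambda>_ _. 0)) p"

text \<open>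
  Registers \<open>0, \<dots>, l m - 1\<close> contain the generic \<open>l \<times> m\<close> matrix in row-major
  order, followed by the generic \<open>m \<times> k\<close> matrix; the product is to be written in row-major order
  to registers \<open>0, \<dots>, l k - 1\<close>.
\<close>

definition multiplies :: "nat \<Rightarrow> nat \<Rightarrow> nat \<Rightarrow> 'a::field prog \<Rightarrow> bool" where
  "multiplies l m k p \<longleftrightarrow> division_free p \<and>
     (let out = formal_run p (\<lambda>r. if r < l * m + m * k then indet r else 0) in
      \<forall>i<l. \<forall>h<k. out (i * k + h) = (\<Sum>j<m. indet (i * m + j) * indet (l * m + j * k + h)))"

definition npow :: "nat \<Rightarrow> real \<Rightarrow> nat" where
  "npow n a = nat \<lfloor>real n powr a\<rfloor>"

definition mm_achievable :: "'a::field itself \<Rightarrow> real \<Rightarrow> real \<Rightarrow> real \<Rightarrow> real \<Rightarrow> bool" where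
  "mm_achievable _ a b c \<tau> \<longleftrightarrow>
     (\<exists>C. \<forall>n\<ge>1. \<exists>p :: 'a prog.
        multiplies (npow n a) (npow n b) (npow n c) p \<and> real (cost p) \<le> C * real n powr \<tau>)"

text \<open>
  The infimum need not be attained, so that a bound \<open>O(n powr omega K a b c)\<close> is to be read, as usual,
  as \<open>O(n powr (omega K a b c + \<delta>))\<close> for every \<open>\<delta> > 0\<close>.
\<close>

definition omega :: "'a::field itself \<Rightarrow> real \<Rightarrow> real \<Rightarrow> real \<Rightarrow> real" where
  "omega K a b c = Inf {\<tau>. mm_achievable K a b c \<tau>}"


section \<open>Dynamic matrix inverse with look-ahead\<close>

datatype 'v operation = Update nat 'v | Query nat

fun op_index :: "'v operation \<Rightarrow> nat" where
  "op_index (Update j _) = j"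
| "op_index (Query i) = i"

fun apply_op :: "'a vec operation \<Rightarrow> 'a mat \<Rightarrow> 'a mat" where
  "apply_op (Update j v) A = replace_col A v j"
| "apply_op (Query _) A = A"

text \<open>\<open>matrix_at A ops t\<close> is the matrix before round \<open>t\<close>; there is one operation per round.\<close>

fun matrix_at :: "'a mat \<Rightarrow> (nat \<Rightarrow> 'a vec operation) \<Rightarrow> nat \<Rightarrow> 'a mat" where
  "matrix_at A ops 0 = A"
| "matrix_at A ops (Suc t) = apply_op (ops t) (matrix_at A ops t)"

text \<open>
  \<open>F t i\<close> contains the indices of the operations in the rounds \<open>t, \<dots>, t + i\<close>. The size
  bound \<open>s i\<close> is required for \<open>i \<ge> 1\<close> only, since for \<open>i = 0\<close> it would
  exclude any operation in round \<open>t\<close>. For \<open>l \<ge> 1\<close>, \<open>F t 0\<close> has at most \<open>s\<close>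
  elements by monotonicity.
\<close>

definition accurate_lookahead ::
  "nat \<Rightarrow> nat \<Rightarrow> nat \<Rightarrow> (nat \<Rightarrow> 'v operation) \<Rightarrow> (nat \<Rightarrow> nat \<Rightarrow> nat set) \<Rightarrow> bool" where
  "accurate_lookahead n s l ops F \<longleftrightarrow>
     (\<forall>t. \<forall>i\<le>l. F t i \<subseteq> {..<n}) \<and>
     (\<forall>t. \<forall>i\<le>l. \<forall>r\<in>{t..t + i}. op_index (ops r) \<in> F t i) \<and>
     (\<forall>t. \<forall>i\<in>{1..l}. card (F t i) \<le> s * i) \<and>
     (\<forall>t1 t2 i1 i2. i1 \<le> l \<and> i2 \<le> l \<and> t1 \<le> t2 \<and> t2 + i2 \<le> t1 + i1 \<longrightarrow> F t2 i2 \<subseteq> F t1 i1)"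

definition valid_session ::
  "nat \<Rightarrow> nat \<Rightarrow> nat \<Rightarrow> 'a::field mat \<Rightarrow> (nat \<Rightarrow> 'a vec operation) \<Rightarrow> (nat \<Rightarrow> nat \<Rightarrow> nat set) \<Rightarrow> bool" where
  "valid_session n s l A ops F \<longleftrightarrow>
     A \<in> carrier_mat n n \<and>
     (\<forall>t. op_index (ops t) < n) \<and>
     (\<forall>t j v. ops t = Update j v \<longrightarrow> v \<in> carrier_vec n) \<and>
     (\<forall>t. invertible_mat (matrix_at A ops t)) \<and>
     accurate_lookahead n s l ops F"

text \<open>
  In each round the algorithm chooses a program from the discrete data of the rounds up to the
  current one: the look-ahead sets and the operations without the column values. Nothing but the
  matrix dimension is known during pre-processing.
\<close>

type_synonym history = "((nat \<Rightarrow> nat set) \<times> unit operation) list"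

record 'a dyn_alg =
  preproc :: "'a prog"
  respond :: "history \<Rightarrow> 'a prog"

definition history ::
  "(nat \<Rightarrow> nat \<Rightarrow> nat set) \<Rightarrow> (nat \<Rightarrow> 'v operation) \<Rightarrow> nat \<Rightarrow> history" where
  "history F ops t = map (\<lambda>r. (F r, map_operation (\<lambda>_. ()) (ops r))) [0..<Suc t]"

text \<open>
  Pre-processing starts with the matrix in row-major order in registers \<open>0, \<dots>, n\<^sup>2 - 1\<close>.
  A new column is loaded into the registers \<open>0, \<dots>, n - 1\<close>, from which query answers are read, too.
\<close>

definition init_mem :: "nat \<Rightarrow> 'a::field mat \<Rightarrow> (nat \<Rightarrow> 'a)" where
  "init_mem n A = (\<lambda>r. if r < n * n then A $$ (r div n, r mod n) else 0)"

fun load_input :: "nat \<Rightarrow> 'a vec operation \<Rightarrow> (nat \<Rightarrow> 'a) \<Rightarrow> (nat \<Rightarrow> 'a)" where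
  "load_input n (Update j v) m = (\<lambda>r. if r < n then v $ r else m r)"
| "load_input n (Query i) m = m"

text \<open>The registers before round \<open>t\<close>.\<close>

fun mem_at ::
  "nat \<Rightarrow> 'a::field dyn_alg \<Rightarrow> 'a mat \<Rightarrow> (nat \<Rightarrow> 'a vec operation) \<Rightarrow> (nat \<Rightarrow> nat \<Rightarrow> nat set) \<Rightarrow>
   nat \<Rightarrow> (nat \<Rightarrow> 'a)" where
  "mem_at n alg A ops F 0 = run (preproc alg) (init_mem n A)"
| "mem_at n alg A ops F (Suc t) =
     run (respond alg (history F ops t)) (load_input n (ops t) (mem_at n alg A ops F t))"

definition answers_correctly ::
  "nat \<Rightarrow> 'a::field dyn_alg \<Rightarrow> 'a mat \<Rightarrow> (nat \<Rightarrow> 'a vec operation) \<Rightarrow> (nat \<Rightarrow> nat \<Rightarrow> nat set) \<Rightarrow>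
   nat \<Rightarrow> bool" where
  "answers_correctly n alg A ops F t \<longleftrightarrow>
     (\<forall>i B. ops t = Query i \<and> B \<in> carrier_mat n n \<and>
            inverts_mat (matrix_at A ops t) B \<and> inverts_mat B (matrix_at A ops t) \<longrightarrow>
            (\<forall>j<n. mem_at n alg A ops F (Suc t) j = B $$ (i, j)))"

end

theory Submission
  imports Defs
begin

section \<open>Proof of the theorem\<close>

text \<open>
  Write \<open>N\<^sub>t\<close> for the inverse of the matrix \<open>A\<^sub>t\<close> before round \<open>t\<close>. If \<open>A\<^sub>b\<close> differs from
  \<open>A\<^sub>a\<close> in columns from \<open>H\<close> only, then \<open>N\<^sub>a A\<^sub>b\<close> is the identity outside the columns \<open>H\<close>, so that
  the rows \<open>H\<close> of \<open>N\<^sub>b\<close> are obtained from those of \<open>N\<^sub>a\<close> by inverting an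
  \<open>H \<times> H\<close> matrix; any other row of \<open>N\<^sub>b\<close> follows from
  \<open>N\<^sub>b = N\<^sub>a - N\<^sub>a (A\<^sub>b - A\<^sub>a) N\<^sub>b\<close>. Three kinds of tasks use these two steps. Every
  \<open>n powr \<epsilon>\<^sub>1\<close> rounds all of \<open>N\<^sub>t\<close> is recomputed; every \<open>2 ^ K \<approx> n powr \<epsilon>\<^sub>0\<close> rounds
  the rows in the look-ahead set, and those of the columns changed since the last recomputation, are
  brought up to date; and for each \<open>k < K\<close>, every \<open>2 ^ k\<close> rounds the rows needed during the next
  \<open>O(2 ^ k)\<close> rounds are updated from those of level \<open>k + 1\<close>. A task is started as soon as its data
  are available, and is spread evenly over one period, which makes the bounds worst-case.

  The products needed come in all orientations of a given format, so the symmetry of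
  the complexity of matrix multiplication is required. It follows from the theorem of Baur and
  Strassen on partial derivatives: the gradient of \<open>tr (X Y Z)\<close> with respect to \<open>X\<close> is the transpose of \<open>Y Z\<close>.

  Programs are abstracted to sets of functions of the session: \<open>knows D V c W\<close> means that the values
  \<open>W\<close> can be computed from the values \<open>V\<close> with \<open>c\<close> operations, correctly for all sessions in \<open>D\<close>.
\<close>

subsection \<open>Derivability of field elements\<close>

text \<open>Two obstacles shape the proof. First, bounds have to hold in the worst case: the result
  of a task is available only one period after its start, when the matrix has changed again. So
  every task works with data that are about one period old, and the look-ahead of a level has to
  cover the delays of all lower levels. A row that enters the look-ahead is at first known only in
  the last finished recomputation. Correcting it by the formula for \<open>N_b\<close> takes the
  current rows of all columns changed since; this is why these rows are carried along together with
  the look-ahead set. Second, there is no branching, so pivots have to be selected arithmetically.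
  Inversion is a divide and conquer over rows that collects column operations in a factor
  \<open>1 + U V\<close> and exceeds multiplication by a logarithmic factor only. That factor, the
  number of levels and the gap to the infimum in \<open>omega\<close> are all absorbed by
  \<open>\<delta>\<close>.\<close>

inductive derives :: "'e set \<Rightarrow> ('e \<Rightarrow> 'a::field) set \<Rightarrow> nat \<Rightarrow> ('e \<Rightarrow> 'a) set \<Rightarrow> bool"
  for D V where
  base: "derives D V 0 V"
| const: "derives D V c W \<Longrightarrow> derives D V c (insert (\<lambda>_. k) W)"
| cong: "derives D V c W \<Longrightarrow> f \<in> W \<Longrightarrow> (\<And>e. e \<in> D \<Longrightarrow> f' e = f e) \<Longrightarrow> derives D V c (insert f' W)"
| op: "derives D V c W \<Longrightarrow> f \<in> W \<Longrightarrow> g \<in> W \<Longrightarrow> h \<in> {(+), (-), (*), (/)} \<Longrightarrow>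
    derives D V (Suc c) (insert (\<lambda>e. h (f e) (g e)) W)"

text \<open>Monotone in all arguments, whereas \<open>derives\<close> keeps the exact cost and all
  computed values, as splitting and the translation into programs require. The set \<open>D\<close>
  matters in the rule \<open>cong\<close>: functions that agree on \<open>D\<close> count as the
  same value, so identities valid there cost nothing.\<close>

definition knows :: "'e set \<Rightarrow> ('e \<Rightarrow> 'a::field) set \<Rightarrow> nat \<Rightarrow> ('e \<Rightarrow> 'a) set \<Rightarrow> bool" where
  "knows D V c W \<longleftrightarrow> (\<exists>c' W'. derives D V c' W' \<and> c' \<le> c \<and> W \<subseteq> W')"

lemma derives_subset: "derives D V c W \<Longrightarrow> V \<subseteq> W"
  by (induction rule: derives.induct) auto

lemma derives_finite: "derives D V c W \<Longrightarrow> finite V \<Longrightarrow> finite W"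
  by (induction rule: derives.induct) auto

lemma derives_mono:
  assumes "derives D V c W" and "D' \<subseteq> D"
  shows "derives D' (V \<union> X) c (W \<union> X)"
  using assms(1)
proof (induction rule: derives.induct)
  case (cong c W f f')
  then show ?case using assms(2) derives.cong[of D' "V \<union> X" c "W \<union> X" f f'] by auto
qed (auto intro: derives.intros simp del: Un_insert_left simp add: Un_insert_left[of _ _ X])

lemma derives_trans:
  assumes "derives D W d X" and "derives D V c W"
  shows "derives D V (c + d) X"
  using assms
  by (induction rule: derives.induct) (auto intro: derives.intros)

text \<open>A derivation can be interrupted after any number of operations. This is what allows the
  work of a task to be distributed over many rounds.\<close>

lemma derives_split:
  assumes "derives D V c W" and "c = a + b"
  shows "\<exists>U. derives D V a U \<and> derives D U b W"
  using assms
proof (induction arbitrary: a b rule: derives.induct)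
  case base
  then show ?case by (auto intro: derives.base)
next
  case (const c W k)
  from const.IH[OF const.prems] show ?case using derives.const by blast
next
  case (cong c W f f')
  from cong.IH[OF cong.prems] obtain U where "derives D V a U" "derives D U b W" by blast
  then show ?case using derives.cong[of D U b W f f'] cong.hyps by blast
next
  case (op c W f g h)
  show ?case
  proof (cases b)
    case 0
    then show ?thesis using derives.op[OF op.hyps] op.prems by (metis add_0_right derives.base)
  next
    case (Suc b')
    then have "c = a + b'" using op.prems by simp
    from op.IH[OF this] obtain U where "derives D V a U" "derives D U b' W" by blast
    then show ?thesis using derives.op[OF _ op.hyps(2-4)] Suc by blast
  qed
qed

lemma knows_mono:
  assumes "knows D V c W" and "D' \<subseteq> D" and "V \<subseteq> V'" and "c \<le> c'" and "W' \<subseteq> W"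
  shows "knows D' V' c' W'"
proof -
  obtain d U where "derives D V d U" "d \<le> c" "W \<subseteq> U" using assms(1) by (auto simp: knows_def)
  then have "derives D' (V \<union> V') d (U \<union> V')" using derives_mono[OF _ assms(2)] by blast
  then show ?thesis unfolding knows_def using assms \<open>d \<le> c\<close> \<open>W \<subseteq> U\<close>
    by (metis Un_absorb1 le_supI1 le_trans)
qed

lemma knows_refl: "W \<subseteq> V \<Longrightarrow> knows D V c W"
  unfolding knows_def using derives.base by blast

lemma knows_trans:
  assumes "knows D V a W" and "knows D (V \<union> W) b X"
  shows "knows D V (a + b) (V \<union> W \<union> X)"
proof -
  obtain a' W' where 1: "derives D V a' W'" "a' \<le> a" "W \<subseteq> W'" using assms(1) by (auto simp: knows_def)
  have "V \<subseteq> W'" using 1 derives_subset by blast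
  then have "knows D W' b X" using assms(2) 1 by (auto elim: knows_mono)
  then obtain b' X' where 2: "derives D W' b' X'" "b' \<le> b" "X \<subseteq> X'" by (auto simp: knows_def)
  have "derives D V (a' + b') X'" using 1 2 derives_trans by blast
  moreover have "V \<union> W \<union> X \<subseteq> X'" using 1 2 \<open>V \<subseteq> W'\<close> derives_subset by blast
  ultimately show ?thesis unfolding knows_def using 1 2 by (meson add_mono)
qed

lemma knows_trans':
  assumes "knows D V a W" and "knows D (V \<union> W) b X" and "a + b \<le> c" and "Y \<subseteq> V \<union> W \<union> X"
  shows "knows D V c Y"
  using knows_mono[OF knows_trans[OF assms(1,2)] subset_refl subset_refl assms(3,4)] .

lemma knows_Un:
  assumes "knows D V a W" and "knows D V b X"
  shows "knows D V (a + b) (W \<union> X)"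
  by (rule knows_trans'[OF assms(1) knows_mono[OF assms(2)]]) auto

lemma knows_UN:
  assumes "finite I" and "\<And>i. i \<in> I \<Longrightarrow> knows D V (c i) (W i)"
  shows "knows D V (\<Sum>i\<in>I. c i) (\<Union>i\<in>I. W i)"
  using assms
proof (induction I rule: finite_induct)
  case empty
  then show ?case by (auto intro: knows_refl)
next
  case (insert i I)
  then show ?case using knows_Un[of D V "c i" "W i"] by simp
qed

lemma knows_image:
  assumes "finite I" and "\<And>i. i \<in> I \<Longrightarrow> knows D V c {f i}"
  shows "knows D V (card I * c) (f ` I)"
  using knows_UN[OF assms(1), of D V "\<lambda>_. c" "\<lambda>i. {f i}"] assms(2) by (simp add: UNION_singleton_eq_range)

text \<open>One instalment of a task: at most \<open>a\<close> is spent now and at most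
  \<open>b\<close> is left. If the derivation is cheaper than \<open>a\<close>, it is completed at
  once.\<close>

lemma knows_split:
  assumes "knows D V (a + b) W"
  shows "\<exists>U c. derives D V c U \<and> c \<le> a \<and> knows D U b W"
proof -
  obtain c W' where 1: "derives D V c W'" "c \<le> a + b" "W \<subseteq> W'" using assms by (auto simp: knows_def)
  show ?thesis
  proof (cases "c \<le> a")
    case True
    then show ?thesis using 1 knows_refl by blast
  next
    case False
    then have "c = a + (c - a)" by simp
    from derives_split[OF 1(1) this] obtain U where U: "derives D V a U" "derives D U (c - a) W'" by blast
    then have "knows D U b W" unfolding knows_def using 1 False by (metis add.commute le_diff_conv)
    then show ?thesis using U by blast
  qed
qed

lemma knows_const: "knows D V c {\<lambda>_. k}"
  unfolding knows_def using derives.const[OF derives.base] by blast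

lemma knows_cong:
  assumes "f \<in> V" and "\<And>e. e \<in> D \<Longrightarrow> f' e = f e"
  shows "knows D V c {f'}"
  unfolding knows_def using derives.cong[OF derives.base assms] by blast

lemma knows_add: "f \<in> V \<Longrightarrow> g \<in> V \<Longrightarrow> knows D V 1 {\<lambda>e. f e + g e}"
  and knows_sub: "f \<in> V \<Longrightarrow> g \<in> V \<Longrightarrow> knows D V 1 {\<lambda>e. f e - g e}"
  and knows_mul: "f \<in> V \<Longrightarrow> g \<in> V \<Longrightarrow> knows D V 1 {\<lambda>e. f e * g e}"
  and knows_div: "f \<in> V \<Longrightarrow> g \<in> V \<Longrightarrow> knows D V 1 {\<lambda>e. f e / g e}"
  unfolding knows_def
  using derives.op[OF derives.base, of f V g "(+)"] derives.op[OF derives.base, of f V g "(-)"]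
    derives.op[OF derives.base, of f V g "(*)"] derives.op[OF derives.base, of f V g "(/)"]
  by fastforce+

lemma knows_add':
  assumes "knows D V a {f}" and "knows D V b {g}" shows "knows D V (a + b + 1) {\<lambda>e. f e + g e}"
  by (rule knows_trans'[OF knows_Un[OF assms] knows_add[of f _ g]]) auto

lemma knows_sub':
  assumes "knows D V a {f}" and "knows D V b {g}" shows "knows D V (a + b + 1) {\<lambda>e. f e - g e}"
  by (rule knows_trans'[OF knows_Un[OF assms] knows_sub[of f _ g]]) auto

lemma knows_mul':
  assumes "knows D V a {f}" and "knows D V b {g}" shows "knows D V (a + b + 1) {\<lambda>e. f e * g e}"
  by (rule knows_trans'[OF knows_Un[OF assms] knows_mul[of f _ g]]) auto

lemma knows_div':
  assumes "knows D V a {f}" and "knows D V b {g}" shows "knows D V (a + b + 1) {\<lambda>e. f e / g e}"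
  by (rule knows_trans'[OF knows_Un[OF assms] knows_div[of f _ g]]) auto

lemma knows_sum:
  assumes "finite J" and "\<And>j. j \<in> J \<Longrightarrow> knows D V c {f j}"
  shows "knows D V (card J * (c + 1)) {\<lambda>e. \<Sum>j\<in>J. f j e}"
  using assms
proof (induction J rule: finite_induct)
  case empty
  then show ?case by (simp add: knows_const)
next
  case (insert j J)
  have "knows D V (c + card J * (c + 1) + 1) {\<lambda>e. f j e + (\<Sum>j\<in>J. f j e)}"
    by (rule knows_add') (use insert in auto)
  then show ?case using insert by (simp add: algebra_simps)
qed

subsection \<open>Polynomials and their gradients\<close>

definition monom_eval :: "(nat \<Rightarrow> 'r::comm_ring_1) \<Rightarrow> (nat \<Rightarrow>\<^sub>0 nat) \<Rightarrow> 'r" where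
  "monom_eval x m = (\<Prod>v\<in>Poly_Mapping.keys m. x v ^ Poly_Mapping.lookup m v)"

definition peval :: "('a::field \<Rightarrow> 'r::comm_ring_1) \<Rightarrow> (nat \<Rightarrow> 'r) \<Rightarrow> 'a multi_poly \<Rightarrow> 'r" where
  "peval h x f = (\<Sum>m\<in>Poly_Mapping.keys f. h (Poly_Mapping.lookup f m) * monom_eval x m)"

lemma monom_eval_superset:
  assumes "finite K" and "Poly_Mapping.keys m \<subseteq> K"
  shows "monom_eval x m = (\<Prod>v\<in>K. x v ^ Poly_Mapping.lookup m v)"
  unfolding monom_eval_def
  by (rule prod.mono_neutral_left) (use assms in \<open>auto simp: in_keys_iff\<close>)

lemma monom_eval_add: "monom_eval x (m + m') = monom_eval x m * monom_eval x m'"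
proof -
  let ?K = "Poly_Mapping.keys m \<union> Poly_Mapping.keys m'"
  have "monom_eval x (m + m') = (\<Prod>v\<in>?K. x v ^ Poly_Mapping.lookup (m + m') v)"
    by (rule monom_eval_superset) (simp_all add: keys_add)
  also have "\<dots> = monom_eval x m * monom_eval x m'"
    by (simp add: lookup_add power_add prod.distrib monom_eval_superset[of ?K])
  finally show ?thesis .
qed

lemma monom_eval_0 [simp]: "monom_eval x 0 = 1"
  by (simp add: monom_eval_def)

lemma poly_mapping_sum_single:
  "f = (\<Sum>m\<in>Poly_Mapping.keys f. Poly_Mapping.single m (Poly_Mapping.lookup f m))"
proof (rule poly_mapping_eqI)
  fix k
  have "(\<Sum>m\<in>Poly_Mapping.keys f. Poly_Mapping.lookup (Poly_Mapping.single m (Poly_Mapping.lookup f m)) k)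
      = (\<Sum>m\<in>Poly_Mapping.keys f. if m = k then Poly_Mapping.lookup f k else 0)"
    by (rule sum.cong) (auto simp: lookup_single)
  also have "\<dots> = Poly_Mapping.lookup f k"
    by (auto simp: in_keys_iff)
  finally show "Poly_Mapping.lookup f k = Poly_Mapping.lookup
      (\<Sum>m\<in>Poly_Mapping.keys f. Poly_Mapping.single m (Poly_Mapping.lookup f m)) k"
    by (simp add: lookup_sum)
qed

text \<open>Two instances are used: the identity, which gives evaluation in the field, and the
  constant polynomials, which turn the coefficient of degree one into a derivative.\<close>

locale const_hom = comm_ring_hom hom for hom :: "'a::field \<Rightarrow> 'r::comm_ring_1"
begin

lemma peval_superset:
  assumes "finite K" and "Poly_Mapping.keys f \<subseteq> K"
  shows "peval hom x f = (\<Sum>m\<in>K. hom (Poly_Mapping.lookup f m) * monom_eval x m)"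
  unfolding peval_def
  by (rule sum.mono_neutral_left) (use assms in \<open>auto simp: in_keys_iff\<close>)

lemma peval_add: "peval hom x (f + g) = peval hom x f + peval hom x g"
proof -
  let ?K = "Poly_Mapping.keys f \<union> Poly_Mapping.keys g"
  have "peval hom x (f + g) = (\<Sum>m\<in>?K. hom (Poly_Mapping.lookup (f + g) m) * monom_eval x m)"
    by (rule peval_superset) (simp_all add: keys_add)
  also have "\<dots> = peval hom x f + peval hom x g"
    by (simp add: lookup_add hom_add distrib_right sum.distrib peval_superset[of ?K])
  finally show ?thesis .
qed

lemma peval_0 [simp]: "peval hom x 0 = 0"
  by (simp add: peval_def)

lemma peval_sum: "peval hom x (sum f A) = (\<Sum>a\<in>A. peval hom x (f a))"
  by (induction A rule: infinite_finite_induct) (auto simp: peval_add)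

lemma peval_uminus: "peval hom x (- f) = - peval hom x f"
  using peval_add[of x f "- f"] by (simp add: eq_neg_iff_add_eq_0 add.commute)

lemma peval_diff: "peval hom x (f - g) = peval hom x f - peval hom x g"
  using peval_add[of x f "- g"] by (simp add: peval_uminus)

lemma peval_single: "peval hom x (Poly_Mapping.single m c) = hom c * monom_eval x m"
  by (simp add: peval_def)

lemma peval_mult: "peval hom x (f * g) = peval hom x f * peval hom x g"
proof -
  have "f * g = (\<Sum>m\<in>Poly_Mapping.keys f. \<Sum>m'\<in>Poly_Mapping.keys g.
      Poly_Mapping.single (m + m') (Poly_Mapping.lookup f m * Poly_Mapping.lookup g m'))"
    by (subst poly_mapping_sum_single[of f], subst poly_mapping_sum_single[of g])
      (simp add: sum_product mult_single)
  then show ?thesis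
    by (simp add: peval_sum peval_single monom_eval_add hom_mult)
      (simp add: peval_def sum_product mult_ac)
qed

lemma peval_const [simp]: "peval hom x (const_poly c) = hom c"
  by (simp add: const_poly_def peval_single)

lemma peval_indet [simp]: "peval hom x (indet v) = x v"
  by (simp add: indet_def peval_single monom_eval_def)

end

abbreviation eval_at :: "(nat \<Rightarrow> 'a::field) \<Rightarrow> 'a multi_poly \<Rightarrow> 'a" where
  "eval_at \<equiv> peval (\<lambda>c. c)"

lemma const_hom_ident: "const_hom (\<lambda>c::'a::field. c)"
  by unfold_locales auto

lemma const_hom_pCons0: "const_hom (\<lambda>c::'a::field. [:c:])"
  by unfold_locales (auto simp: one_pCons)

lemmas eval_at_simps [simp] =
  const_hom.peval_0[OF const_hom_ident]
  const_hom.peval_const[OF const_hom_ident]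
  const_hom.peval_indet[OF const_hom_ident]
  const_hom.peval_add[OF const_hom_ident]
  const_hom.peval_diff[OF const_hom_ident]
  const_hom.peval_mult[OF const_hom_ident]
  const_hom.peval_sum[OF const_hom_ident]

lemmas pCons0_simps =
  const_hom.peval_0[OF const_hom_pCons0]
  const_hom.peval_const[OF const_hom_pCons0]
  const_hom.peval_indet[OF const_hom_pCons0]
  const_hom.peval_add[OF const_hom_pCons0]
  const_hom.peval_diff[OF const_hom_pCons0]
  const_hom.peval_mult[OF const_hom_pCons0]

text \<open>Gradient weights are attached to polynomials, so the possible inputs of a program, zero
  and the indeterminates, have to be pairwise distinct.\<close>

lemma zero_neq_indet: "0 \<noteq> (indet v :: 'a::field multi_poly)"
proof
  assume "0 = (indet v :: 'a multi_poly)"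
  then have "eval_at (\<lambda>_. 1) (0 :: 'a multi_poly) = eval_at (\<lambda>_. 1) (indet v)" by simp
  then show False by simp
qed

lemma indet_eq_iff: "indet r = (indet v :: 'a::field multi_poly) \<longleftrightarrow> r = v"
proof
  assume "indet r = (indet v :: 'a multi_poly)"
  then have "eval_at (\<lambda>u. if u = v then 1 else 0) (indet r)
      = eval_at (\<lambda>u. if u = v then 1 else (0::'a)) (indet v)" by simp
  then show "r = v" by (simp split: if_splits)
qed simp

text \<open>Registers are forgotten and all polynomials computed so far are kept, so that copying
  and overwriting disappear and a backward pass still finds every intermediate value.\<close>

inductive freach :: "'a::field multi_poly set \<Rightarrow> nat \<Rightarrow> 'a multi_poly set \<Rightarrow> bool" for V where
  base: "freach V 0 V"
| const: "freach V c W \<Longrightarrow> freach V c (insert (const_poly k) W)"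
| add: "freach V c W \<Longrightarrow> f \<in> W \<Longrightarrow> g \<in> W \<Longrightarrow> freach V (Suc c) (insert (f + g) W)"
| sub: "freach V c W \<Longrightarrow> f \<in> W \<Longrightarrow> g \<in> W \<Longrightarrow> freach V (Suc c) (insert (f - g) W)"
| mul: "freach V c W \<Longrightarrow> f \<in> W \<Longrightarrow> g \<in> W \<Longrightarrow> freach V (Suc c) (insert (f * g) W)"

lemma freach_finite: "freach V c W \<Longrightarrow> finite V \<Longrightarrow> finite W"
  by (induction rule: freach.induct) auto

lemma freach_run:
  assumes "freach V c W" and "range m \<subseteq> W" and "division_free p"
  shows "\<exists>W'. freach V (c + cost p) W' \<and> range (formal_run p m) \<subseteq> W'"
  using assms
proof (induction p arbitrary: m c W)
  case Nil
  then show ?case by (auto simp: formal_run_def cost_def)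
next
  case (Cons i p)
  let ?m = "exec_instr const_poly (\<lambda>_ _. 0) i m"
  have m: "m r \<in> W" for r using Cons.prems(2) by auto
  have "\<exists>W'. freach V (c + instr_cost i) W' \<and> range ?m \<subseteq> W'"
  proof (cases i)
    case (Const r k)
    then show ?thesis using freach.const[OF Cons.prems(1), of k] m by auto
  next
    case (Copy r x)
    then show ?thesis using Cons.prems(1) m by auto
  next
    case (Add r x y)
    then show ?thesis using freach.add[OF Cons.prems(1) m m, of x y] m by auto
  next
    case (Sub r x y)
    then show ?thesis using freach.sub[OF Cons.prems(1) m m, of x y] m by auto
  next
    case (Mul r x y)
    then show ?thesis using freach.mul[OF Cons.prems(1) m m, of x y] m by auto
  next
    case (Div r x y)
    then show ?thesis using Cons.prems(3) by (auto simp: division_free_def)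
  qed
  then obtain W' where "freach V (c + instr_cost i) W'" "range ?m \<subseteq> W'" by blast
  moreover have "division_free p" using Cons.prems(3) by (auto simp: division_free_def)
  ultimately obtain W'' where "freach V (c + instr_cost i + cost p) W''" "range (formal_run p ?m) \<subseteq> W''"
    using Cons.IH by blast
  then show ?case by (auto simp: formal_run_def cost_def add.assoc)
qed

definition mm_inputs :: "nat \<Rightarrow> 'a::field multi_poly set" where
  "mm_inputs N = insert 0 (indet ` {..<N})"

definition mm_output :: "nat \<Rightarrow> nat \<Rightarrow> nat \<Rightarrow> nat \<Rightarrow> nat \<Rightarrow> 'a::field multi_poly" where
  "mm_output l m k i h = (\<Sum>j<m. indet (i * m + j) * indet (l * m + j * k + h))"

lemma multiplies_freach:
  fixes p :: "'a::field prog"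
  assumes "multiplies l m k p"
  obtains W where "freach (mm_inputs (l * m + m * k)) (cost p) W" "finite W"
    "\<And>i h. i < l \<Longrightarrow> h < k \<Longrightarrow> mm_output l m k i h \<in> (W :: 'a multi_poly set)"
proof -
  let ?m = "\<lambda>r. if r < l * m + m * k then indet r else (0 :: 'a multi_poly)"
  have "range ?m \<subseteq> mm_inputs (l * m + m * k)" by (auto simp: mm_inputs_def)
  from freach_run[OF freach.base this, of p] assms obtain W
    where W: "freach (mm_inputs (l * m + m * k)) (cost p) W" "range (formal_run p ?m) \<subseteq> W"
    by (auto simp: multiplies_def)
  moreover have "mm_output l m k i h \<in> W" if "i < l" "h < k" for i h
  proof -
    have "mm_output l m k i h = formal_run p ?m (i * k + h)"
      using assms that by (simp add: multiplies_def mm_output_def Let_def)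
    then show ?thesis using W(2) by auto
  qed
  ultimately show ?thesis using that freach_finite[OF W(1)] by (auto simp: mm_inputs_def)
qed

lemma derives_eval_at:
  assumes "freach V c W"
  shows "derives D ((\<lambda>f e. eval_at (\<lambda>r. x r e) f) ` V) c ((\<lambda>f e. eval_at (\<lambda>r. x r e) f) ` W)"
  using assms
proof (induction rule: freach.induct)
  case base
  then show ?case by (rule derives.base)
next
  case (const c W k)
  from derives.const[OF const.IH, of k] show ?case by simp
next
  case (add c W f g)
  from derives.op[OF add.IH imageI[OF add.hyps(2)] imageI[OF add.hyps(3)], of "(+)"]
  show ?case by simp
next
  case (sub c W f g)
  from derives.op[OF sub.IH imageI[OF sub.hyps(2)] imageI[OF sub.hyps(3)], of "(-)"]
  show ?case by simp
next
  case (mul c W f g)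
  from derives.op[OF mul.IH imageI[OF mul.hyps(2)] imageI[OF mul.hyps(3)], of "(*)"]
  show ?case by simp
qed

text \<open>A univariate polynomial: the variable \<open>v\<close> becomes the unknown, and the
  other variables in \<open>U\<close> become zero. Its coefficients of degree 0 and 1 are the value
  and the partial derivative by \<open>v\<close> at the point where all variables in
  \<open>U\<close> vanish. For a matrix product, with \<open>U\<close> the variables of one factor,
  the derivative is the same at every other choice of these variables.\<close>

definition pd_eval :: "nat set \<Rightarrow> (nat \<Rightarrow> 'a::field) \<Rightarrow> nat \<Rightarrow> 'a multi_poly \<Rightarrow> 'a poly" where
  "pd_eval U x v = peval (\<lambda>c. [:c:]) (\<lambda>r. if r \<in> U then (if r = v then [:0, 1:] else 0) else [:x r:])"

definition pd :: "nat set \<Rightarrow> (nat \<Rightarrow> 'a::field) \<Rightarrow> nat \<Rightarrow> 'a multi_poly \<Rightarrow> 'a" where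
  "pd U x v f = coeff (pd_eval U x v f) 1"

definition base_val :: "nat set \<Rightarrow> (nat \<Rightarrow> 'a::field) \<Rightarrow> 'a multi_poly \<Rightarrow> 'a" where
  "base_val U x f = eval_at (\<lambda>r. if r \<in> U then 0 else x r) f"

lemma coeff_0_pd_eval: "coeff (pd_eval U x v f) 0 = base_val U x f"
proof -
  have "coeff (monom_eval (\<lambda>r. if r \<in> U then if r = v then [:0, 1:] else 0 else [:x r:]) m) 0
      = monom_eval (\<lambda>r. if r \<in> U then 0 else x r) m" for m
    unfolding monom_eval_def poly_0_coeff_0[symmetric] poly_prod poly_power
    by (rule prod.cong) auto
  then show ?thesis
    by (simp add: pd_eval_def base_val_def peval_def coeff_sum coeff_mult_0)
qed

lemma pd_const [simp]: "pd U x v (const_poly c) = 0"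
  and pd_0 [simp]: "pd U x v 0 = 0"
  and pd_add: "pd U x v (f + g) = pd U x v f + pd U x v g"
  and pd_diff: "pd U x v (f - g) = pd U x v f - pd U x v g"
  and pd_indet: "pd U x v (indet r) = (if r \<in> U \<and> r = v then 1 else 0)"
  by (auto simp: pd_def pd_eval_def pCons0_simps)

lemma pd_sum: "pd U x v (sum f A) = (\<Sum>a\<in>A. pd U x v (f a))"
  by (induction A rule: infinite_finite_induct) (auto simp: pd_add)

lemma pd_mult: "pd U x v (f * g) = base_val U x f * pd U x v g + base_val U x g * pd U x v f"
proof -
  have 1: "coeff (p * q) 1 = coeff p 0 * coeff q 1 + coeff q 0 * coeff p 1" for p q :: "'a poly"
    by (simp add: coeff_mult atMost_Suc)
  have "pd_eval U x v (f * g) = pd_eval U x v f * pd_eval U x v g"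
    by (simp add: pd_eval_def pCons0_simps)
  then show ?thesis
    unfolding pd_def by (simp only: 1 coeff_0_pd_eval)
qed

section \<open>Reverse accumulation of gradients\<close>

definition bump :: "('p \<Rightarrow> 'e \<Rightarrow> 'a::field) \<Rightarrow> 'p \<Rightarrow> ('e \<Rightarrow> 'a) \<Rightarrow> 'p \<Rightarrow> 'e \<Rightarrow> 'a" where
  "bump g w t = g(w := (\<lambda>e. g w e + t e))"

lemma knows_bump:
  assumes "g ` W \<subseteq> V" and "t \<in> V" and "w \<in> W"
  shows "knows D V 1 (bump g w t ` W)"
proof (rule knows_trans'[where b = 0])
  show "knows D V 1 {\<lambda>e. g w e + t e}"
    by (rule knows_add) (use assms in auto)
qed (use assms in \<open>auto simp: bump_def intro!: knows_refl\<close>)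

lemma sum_bump:
  assumes "finite W" and "w \<in> W"
  shows "(\<Sum>u\<in>W. bump g w t u e * P u) = (\<Sum>u\<in>W. g u e * P u) + t e * P w"
  using assms by (simp add: bump_def sum.remove[of W w] distrib_right)

text \<open>The latest value \<open>w\<close> passes its weight on to its operands by the chain
  rule. At most two operations compute the contributions \<open>t\<close> and \<open>t'\<close>, and
  two add them to the weights of the operands: hence the factor 4. If \<open>w\<close> was already
  among the values, the sum does not change.\<close>

lemma knows_gradient_step:
  assumes fin: "finite W" and "f \<in> W" and "f' \<in> W"
    and T: "knows D Q 2 {t, t'}" and Q: "g ` insert w W \<subseteq> Q"
    and split: "w \<notin> W \<Longrightarrow> (\<And>e v. g w e * P e v w = t e * P e v f + t' e * P e v f')"
    and IH: "\<And>g Q'. Q \<subseteq> Q' \<Longrightarrow> g ` W \<subseteq> Q' \<Longrightarrow> knows D Q' (4 * c) ((\<lambda>v e. \<Sum>u\<in>W. g u e * P e v u) ` U)"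
  shows "knows D Q (4 * Suc c) ((\<lambda>v e. \<Sum>u\<in>insert w W. g u e * P e v u) ` U)"
proof (cases "w \<in> W")
  case True
  then show ?thesis using knows_mono[OF IH[of Q g] subset_refl subset_refl] Q by (simp add: insert_absorb)
next
  case False
  \<comment> \<open>Two successive bumps, so that coinciding operands receive both
    contributions.\<close>
  define g' where "g' = bump (bump g f t) f' t'"
  have "knows D (Q \<union> {t, t'}) 1 (bump g f t ` W)"
    by (rule knows_bump) (use assms in auto)
  moreover have "knows D (Q \<union> {t, t'} \<union> bump g f t ` W) 1 (g' ` W)"
    unfolding g'_def by (rule knows_bump) (use assms in auto)
  ultimately have "knows D (Q \<union> {t, t'}) 2 (g' ` W)"
    by (auto intro: knows_trans')
  from knows_trans'[OF T this] have "knows D Q 4 (g' ` W)" by auto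
  then have "knows D Q (4 * Suc c) ((\<lambda>v e. \<Sum>u\<in>W. g' u e * P e v u) ` U)"
    by (rule knows_trans'[OF _ IH]) auto
  moreover have "(\<Sum>u\<in>W. g' u e * P e v u) = (\<Sum>u\<in>insert w W. g u e * P e v u)" for v e
    using assms(1-3) False split[OF False] unfolding g'_def by (simp add: sum_bump add_ac)
  ultimately show ?thesis by simp
qed

text \<open>Baur and Strassen: all partial derivatives of a straight-line program are computed by
  running it backwards. Since the weights \<open>g\<close> are attached to values and not to registers, copies
  remain free.\<close>

lemma knows_gradient_aux:
  assumes "freach V c W" and "finite V" and "V \<subseteq> insert 0 (range indet)"
    and "(\<lambda>f e. base_val U (\<lambda>r. x r e) f) ` W \<subseteq> Q" and "g ` W \<subseteq> Q"
    and "finite U" and "\<And>v. v \<in> U \<Longrightarrow> indet v \<in> V"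
  shows "knows D Q (4 * c) ((\<lambda>v e. \<Sum>f\<in>W. g f e * pd U (\<lambda>r. x r e) v f) ` U)"
  using assms
proof (induction arbitrary: g Q rule: freach.induct)
  case base
  \<comment> \<open>Among the inputs, only \<open>indet v\<close> depends on \<open>v\<close>, so
    the derivative is the weight accumulated there.\<close>
  have "(\<lambda>e. \<Sum>f\<in>V. g f e * pd U (\<lambda>r. x r e) v f) = g (indet v)" if "v \<in> U" for v
  proof
    fix e
    have "(\<Sum>f\<in>V. g f e * pd U (\<lambda>r. x r e) v f) = (\<Sum>f\<in>V. if f = indet v then g f e else 0)"
    proof (rule sum.cong[OF refl])
      fix f assume "f \<in> V"
      then consider "f = 0" | r where "f = indet r" using base.prems(2) by auto
      then show "g f e * pd U (\<lambda>r. x r e) v f = (if f = indet v then g f e else 0)"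
      proof cases
        case 1
        have "(0 :: 'a multi_poly) \<noteq> indet v"
          by (rule zero_neq_indet)
        with 1 show ?thesis by simp
      next
        case 2
        have "indet r \<noteq> (indet v :: 'a multi_poly)" if "r \<noteq> v"
          using that by (simp add: indet_eq_iff)
        with 2 \<open>v \<in> U\<close> show ?thesis by (auto simp: pd_indet)
      qed
    qed
    also have "\<dots> = g (indet v) e" using base.prems that by simp
    finally show "(\<Sum>f\<in>V. g f e * pd U (\<lambda>r. x r e) v f) = g (indet v) e" .
  qed
  then show ?case using base.prems by (auto intro!: knows_refl)
next
  case (const c W k)
  have fin: "finite W" using freach_finite[OF const.hyps] const.prems by simp
  have "(\<Sum>f\<in>insert (const_poly k) W. g f e * pd U (\<lambda>r. x r e) v f)
      = (\<Sum>f\<in>W. g f e * pd U (\<lambda>r. x r e) v f)" for e v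
    using fin by (cases "const_poly k \<in> W") (auto simp: insert_absorb)
  then show ?case using const.IH[of Q g] const.prems by simp
next
  case (add c W f f')
  have fin: "finite W" using freach_finite[OF add.hyps(1)] add.prems by simp
  show ?case
  proof (rule knows_gradient_step[OF fin add.hyps(2,3), of _ _ "g (f + f')" "g (f + f')"], goal_cases)
    case (4 g' Q')
    show ?case by (rule add.IH) (use add.prems 4 in auto)
  qed (use add.prems in \<open>auto simp: pd_add algebra_simps intro: knows_refl\<close>)
next
  case (sub c W f f')
  have fin: "finite W" using freach_finite[OF sub.hyps(1)] sub.prems by simp
  \<comment> \<open>There is no instruction for negation; the constant 0 is free and one subtraction
    suffices.\<close>
  have "knows D Q (0 + 0 + 1) {\<lambda>e. 0 - g (f - f') e}"
    by (rule knows_sub') (use sub.prems in \<open>auto intro: knows_const knows_refl\<close>)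
  then have T: "knows D Q 2 {g (f - f'), \<lambda>e. 0 - g (f - f') e}"
    by (rule knows_trans'[where b = 0]) (use sub.prems in \<open>auto intro: knows_refl\<close>)
  show ?case
  proof (rule knows_gradient_step[OF fin sub.hyps(2,3) T], goal_cases)
    case (3 g' Q')
    show ?case by (rule sub.IH) (use sub.prems 3 in auto)
  qed (use sub.prems in \<open>auto simp: pd_diff algebra_simps intro: knows_refl\<close>)
next
  case (mul c W f f')
  have fin: "finite W" using freach_finite[OF mul.hyps(1)] mul.prems by simp
  let ?b = "\<lambda>f e. base_val U (\<lambda>r. x r e) f" and ?w = "g (f * f')"
  have "knows D Q (1 + 1) ({\<lambda>e. ?w e * ?b f' e} \<union> {\<lambda>e. ?w e * ?b f e})"
    by (intro knows_Un knows_mul) (use mul.prems mul.hyps in auto)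
  then have T: "knows D Q 2 {\<lambda>e. ?w e * ?b f' e, \<lambda>e. ?w e * ?b f e}"
    by (auto elim: knows_mono)
  show ?case
  proof (rule knows_gradient_step[OF fin mul.hyps(2,3) T], goal_cases)
    case (3 g' Q')
    show ?case by (rule mul.IH) (use mul.prems 3 in auto)
  qed (use mul.prems in \<open>auto simp: pd_mult algebra_simps intro: knows_refl\<close>)
qed

subsection \<open>Products in all orientations\<close>

definition ent :: "(nat \<Rightarrow> nat \<Rightarrow> 'e \<Rightarrow> 'a) \<Rightarrow> nat set \<Rightarrow> nat set \<Rightarrow> ('e \<Rightarrow> 'a) set" where
  "ent M I J = (\<lambda>(i, j). M i j) ` (I \<times> J)"

definition mprod :: "nat set \<Rightarrow> (nat \<Rightarrow> nat \<Rightarrow> 'e \<Rightarrow> 'a::field) \<Rightarrow> (nat \<Rightarrow> nat \<Rightarrow> 'e \<Rightarrow> 'a) \<Rightarrow> nat \<Rightarrow> nat \<Rightarrow> 'e \<Rightarrow> 'a" where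
  "mprod J M N = (\<lambda>i h e. \<Sum>j\<in>J. M i j e * N j h e)"

text \<open>Stated for families over arbitrary index sets, so that submatrices can be multiplied
  without renumbering; only the cardinalities count.\<close>

definition matmul_cost :: "('e \<Rightarrow> 'a::field) itself \<Rightarrow> nat \<Rightarrow> nat \<Rightarrow> nat \<Rightarrow> nat \<Rightarrow> bool" where
  "matmul_cost (_ :: ('e \<Rightarrow> 'a) itself) q l m k \<longleftrightarrow>
     (\<forall>(M :: nat \<Rightarrow> nat \<Rightarrow> 'e \<Rightarrow> 'a) N I J H.
        finite I \<and> finite J \<and> finite H \<and> card I \<le> l \<and> card J \<le> m \<and> card H \<le> k \<longrightarrow>
        knows UNIV (ent M I J \<union> ent N J H) q (ent (mprod J M N) I H))"

lemma entI [intro]: "i \<in> I \<Longrightarrow> j \<in> J \<Longrightarrow> M i j \<in> ent M I J"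
  by (auto simp: ent_def)

lemma entE [elim!]:
  assumes "f \<in> ent M I J" obtains i j where "i \<in> I" "j \<in> J" "f = M i j"
  using assms by (auto simp: ent_def)

lemma ent_subset_iff: "ent M I J \<subseteq> V \<longleftrightarrow> (\<forall>i\<in>I. \<forall>j\<in>J. M i j \<in> V)"
  by (auto simp: ent_def)

lemma ent_mono: "I \<subseteq> I' \<Longrightarrow> J \<subseteq> J' \<Longrightarrow> ent M I J \<subseteq> ent M I' J'"
  by (auto simp: ent_def)

lemma finite_ent [simp]: "finite I \<Longrightarrow> finite J \<Longrightarrow> finite (ent M I J)"
  by (simp add: ent_def)

lemma knows_member: "f \<in> V \<Longrightarrow> knows D V c {f}"
  by (rule knows_refl) simp

lemma knows_trans0:
  assumes "knows D V a W" and "knows D W c X" and "X' \<subseteq> X"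
  shows "knows D V (a + c) X'"
  by (rule knows_trans'[OF assms(1) knows_mono[OF assms(2)]]) (use assms(3) in auto)

lemma knows_set:
  assumes "finite W" and "\<And>f. f \<in> W \<Longrightarrow> knows D V 0 {f}"
  shows "knows D V c W"
  using knows_image[OF assms(1), of D V 0 id] assms(2) by (auto elim: knows_mono)

lemma knows_ent:
  assumes "finite I" and "finite J" and "\<And>i j. i \<in> I \<Longrightarrow> j \<in> J \<Longrightarrow> knows D V c {M i j}"
  shows "knows D V (card I * card J * c) (ent M I J)"
  using knows_image[of "I \<times> J" D V c "\<lambda>(i, j). M i j"] assms by (auto simp: ent_def card_cartesian_product)

lemma knows_ent_cong:
  assumes "knows D V c (ent M I J)" and "finite I" and "finite J"
    and "\<And>i j e. i \<in> I \<Longrightarrow> j \<in> J \<Longrightarrow> e \<in> D \<Longrightarrow> M' i j e = M i j e"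
  shows "knows D V c (ent M' I J)"
proof (rule knows_trans'[OF assms(1), where b = 0])
  show "knows D (V \<union> ent M I J) 0 (ent M' I J)"
    by (rule knows_set) (use assms in \<open>auto simp: ent_def intro!: knows_cong\<close>)
qed auto

lemma matmul_costD:
  fixes M N :: "nat \<Rightarrow> nat \<Rightarrow> 'e \<Rightarrow> 'a::field"
  assumes "matmul_cost (T :: ('e \<Rightarrow> 'a) itself) q l m k"
    and "finite I" and "finite J" and "finite H" and "card I \<le> l" and "card J \<le> m" and "card H \<le> k"
    and "ent M I J \<subseteq> V" and "ent N J H \<subseteq> V"
  shows "knows D V q (ent (mprod J M N) I H)"
proof (rule knows_mono)
  show "knows UNIV (ent M I J \<union> ent N J H) q (ent (mprod J M N) I H)"
    using assms(1-7) unfolding matmul_cost_def by blast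
qed (use assms in auto)

lemma matmul_cost_mono:
  assumes "matmul_cost (T :: ('e \<Rightarrow> 'a::field) itself) q l m k" and "q \<le> q'" and "l' \<le> l" and "m' \<le> m" and "k' \<le> k"
  shows "matmul_cost T q' l' m' k'"
  unfolding matmul_cost_def
proof (intro allI impI)
  fix M N :: "nat \<Rightarrow> nat \<Rightarrow> 'e \<Rightarrow> 'a" and I J H :: "nat set"
  assume "finite I \<and> finite J \<and> finite H \<and> card I \<le> l' \<and> card J \<le> m' \<and> card H \<le> k'"
  then have "knows UNIV (ent M I J \<union> ent N J H) q (ent (mprod J M N) I H)"
    using assms unfolding matmul_cost_def by (meson le_trans)
  then show "knows UNIV (ent M I J \<union> ent N J H) q' (ent (mprod J M N) I H)"
    using assms by (auto elim: knows_mono)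
qed

text \<open>Bijections number the index sets, and matrices that are too small are padded by zeros,
  which are free constants.\<close>

lemma matmul_costI:
  assumes "\<And>M N :: nat \<Rightarrow> nat \<Rightarrow> 'e \<Rightarrow> 'a::field.
    knows UNIV (ent M {..<l} {..<m} \<union> ent N {..<m} {..<k}) q (ent (mprod {..<m} M N) {..<l} {..<k})"
  shows "matmul_cost TYPE('e \<Rightarrow> 'a) q l m k"
  unfolding matmul_cost_def
proof (intro allI impI, elim conjE)
  fix M N :: "nat \<Rightarrow> nat \<Rightarrow> 'e \<Rightarrow> 'a" and I J H :: "nat set"
  assume fin: "finite I" "finite J" "finite H" and card: "card I \<le> l" "card J \<le> m" "card H \<le> k"
  obtain a where a: "bij_betw a {..<card I} I"
    using ex_bij_betw_nat_finite[OF fin(1)] by (auto simp: atLeast0LessThan)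
  obtain b where b: "bij_betw b {..<card J} J"
    using ex_bij_betw_nat_finite[OF fin(2)] by (auto simp: atLeast0LessThan)
  obtain c where c: "bij_betw c {..<card H} H"
    using ex_bij_betw_nat_finite[OF fin(3)] by (auto simp: atLeast0LessThan)
  define M' where "M' = (\<lambda>i j. if i < card I \<and> j < card J then M (a i) (b j) else (\<lambda>_. 0))"
  define N' where "N' = (\<lambda>j h. if j < card J \<and> h < card H then N (b j) (c h) else (\<lambda>_. 0))"
  have "knows UNIV (ent M I J \<union> ent N J H) 0 (ent M' {..<l} {..<m} \<union> ent N' {..<m} {..<k})"
  proof (rule knows_set)
    fix f assume "f \<in> ent M' {..<l} {..<m} \<union> ent N' {..<m} {..<k}"
    then consider "f = (\<lambda>_. 0)" | "f \<in> ent M I J \<union> ent N J H"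
      using bij_betwE[OF a] bij_betwE[OF b] bij_betwE[OF c]
      by (fastforce simp: M'_def N'_def split: if_splits)
    then show "knows UNIV (ent M I J \<union> ent N J H) 0 {f}"
      by cases (simp_all add: knows_const knows_member)
  qed simp
  moreover have "ent (mprod J M N) I H \<subseteq> ent (mprod {..<m} M' N') {..<l} {..<k}"
  proof (unfold ent_subset_iff, intro ballI)
    fix i h assume "i \<in> I" "h \<in> H"
    then obtain i' h' where i: "i' < card I" "i = a i'" and h: "h' < card H" "h = c h'"
      using bij_betw_imp_surj_on[OF a] bij_betw_imp_surj_on[OF c] by (metis imageE lessThan_iff)
    have "mprod {..<m} M' N' i' h' e = mprod J M N i h e" for e
    proof -
      have "mprod {..<m} M' N' i' h' e = (\<Sum>j<card J. M' i' j e * N' j h' e)"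
        unfolding mprod_def by (rule sum.mono_neutral_right) (use card in \<open>auto simp: M'_def\<close>)
      also have "\<dots> = (\<Sum>j<card J. M i (b j) e * N (b j) h e)"
        by (simp add: M'_def N'_def i h)
      also have "\<dots> = mprod J M N i h e"
        unfolding mprod_def by (rule sum.reindex_bij_betw[OF b])
      finally show ?thesis .
    qed
    then have "mprod J M N i h = mprod {..<m} M' N' i' h'" by auto
    then show "mprod J M N i h \<in> ent (mprod {..<m} M' N') {..<l} {..<k}"
      using i h card by auto
  qed
  ultimately show "knows UNIV (ent M I J \<union> ent N J H) q (ent (mprod J M N) I H)"
    using knows_trans0[OF _ assms[of M' N']] by fastforce
qed

text \<open>The transpose of a product is the product of the transposes in reverse order, and
  transposing a family does not change its set of entries.\<close>

lemma matmul_cost_transpose: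
  assumes "matmul_cost (T :: ('e \<Rightarrow> 'a::field) itself) q l m k"
  shows "matmul_cost T q k m l"
proof -
  have "matmul_cost TYPE('e \<Rightarrow> 'a) q k m l"
  proof (rule matmul_costI)
    fix M N :: "nat \<Rightarrow> nat \<Rightarrow> 'e \<Rightarrow> 'a"
    have tr: "ent (\<lambda>i j. M j i) J I = ent M I J" for M :: "nat \<Rightarrow> nat \<Rightarrow> 'e \<Rightarrow> 'a" and I J
      by (auto simp: ent_def)
    have "knows UNIV (ent (\<lambda>i j. N j i) {..<l} {..<m} \<union> ent (\<lambda>i j. M j i) {..<m} {..<k}) q
        (ent (mprod {..<m} (\<lambda>i j. N j i) (\<lambda>i j. M j i)) {..<l} {..<k})"
      using assms unfolding matmul_cost_def by simp
    moreover have "mprod {..<m} (\<lambda>i j. N j i) (\<lambda>i j. M j i) = (\<lambda>i j. mprod {..<m} M N j i)"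
      unfolding mprod_def by (intro ext sum.cong refl mult.commute)
    ultimately show "knows UNIV (ent M {..<k} {..<m} \<union> ent N {..<m} {..<l}) q
        (ent (mprod {..<m} M N) {..<k} {..<l})"
      by (simp add: tr[of M] tr[of N] tr[of "mprod {..<m} M N"] Un_commute)
  qed
  then show ?thesis by (simp add: matmul_cost_def)
qed

section \<open>Row-major indices and the products obtained from one program\<close>

lemma index_less: "i < l \<Longrightarrow> j < m \<Longrightarrow> i * m + j < l * (m::nat)"
  by (metis add.commute add_less_cancel_left less_le_trans mult_Suc mult_le_mono1 Suc_leI nat_add_left_cancel_less)

lemma index_eq_iff: "j < m \<Longrightarrow> j' < m \<Longrightarrow> i * m + j = i' * m + j' \<longleftrightarrow> i = i' \<and> j = (j'::nat)"
  by (metis add.commute div_mult_self3 div_less mod_mult_self3 mod_less add_0 gr_implies_not0)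

definition mm_vals :: "nat \<Rightarrow> nat \<Rightarrow> nat \<Rightarrow> (nat \<Rightarrow> nat \<Rightarrow> 'v) \<Rightarrow> (nat \<Rightarrow> nat \<Rightarrow> 'v) \<Rightarrow> nat \<Rightarrow> 'v" where
  "mm_vals l m k M N r =
     (if r < l * m then M (r div m) (r mod m) else N ((r - l * m) div k) ((r - l * m) mod k))"

lemma mm_vals_left: "i < l \<Longrightarrow> j < m \<Longrightarrow> mm_vals l m k M N (i * m + j) = M i j"
  by (simp add: mm_vals_def index_less)

lemma mm_vals_right: "h < k \<Longrightarrow> mm_vals l m k M N (l * m + j * k + h) = N j h"
  by (simp add: mm_vals_def)

lemma less_mult_indexE:
  assumes "r < l * (m::nat)" obtains i j where "i < l" "j < m" "r = i * m + j"
proof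
  show "r div m < l" using assms by (simp add: less_mult_imp_div_less)
  show "r mod m < m" using assms by (metis mod_less_divisor mult_0_right neq0_conv not_less0)
qed simp

text \<open>The program is correct as an identity of polynomials. This survives the substitution of
  functions on \<open>'e\<close> for the indeterminates.\<close>

lemma matmul_cost_program:
  fixes p :: "'a::field prog"
  assumes "multiplies l m k p"
  shows "matmul_cost TYPE('e \<Rightarrow> 'a) (cost p) l m k"
proof (rule matmul_costI)
  fix M N :: "nat \<Rightarrow> nat \<Rightarrow> 'e \<Rightarrow> 'a"
  obtain W where W: "freach (mm_inputs (l * m + m * k)) (cost p) W"
    "\<And>i h. i < l \<Longrightarrow> h < k \<Longrightarrow> mm_output l m k i h \<in> (W :: 'a multi_poly set)"
    using multiplies_freach[OF assms] by metis
  let ?V = "ent M {..<l} {..<m} \<union> ent N {..<m} {..<k}"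
  let ?x = "mm_vals l m k M N"
  let ?P = "\<lambda>f e. eval_at (\<lambda>r. ?x r e) f"
  have x: "?x r \<in> ?V" if "r < l * m + m * k" for r
  proof (cases "r < l * m")
    case True
    then show ?thesis by (auto elim!: less_mult_indexE simp: mm_vals_left)
  next
    case False
    then have "r - l * m < m * k" using that by simp
    then obtain j h where "j < m" "h < k" "r - l * m = j * k + h" by (rule less_mult_indexE)
    then have "r = l * m + j * k + h" using False by simp
    then show ?thesis using \<open>j < m\<close> \<open>h < k\<close> by (auto simp: mm_vals_right)
  qed
  have "knows UNIV ?V 0 (?P ` mm_inputs (l * m + m * k))"
  proof (rule knows_set)
    fix f assume "f \<in> ?P ` mm_inputs (l * m + m * k)"
    then consider "f = (\<lambda>_. 0)" | r where "r < l * m + m * k" "f = ?x r"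
      by (auto simp: mm_inputs_def)
    then show "knows UNIV ?V 0 {f}"
      by cases (simp_all only: knows_const knows_member x)
  qed (simp add: mm_inputs_def)
  moreover have "knows UNIV (?P ` mm_inputs (l * m + m * k)) (cost p) (?P ` W)"
    unfolding knows_def using derives_eval_at[OF W(1)] by blast
  moreover have "ent (mprod {..<m} M N) {..<l} {..<k} \<subseteq> ?P ` W"
  proof (unfold ent_subset_iff, intro ballI)
    fix i h assume "i \<in> {..<l}" "h \<in> {..<k}"
    then have "?P (mm_output l m k i h) = mprod {..<m} M N i h"
      by (simp add: mm_output_def mprod_def mm_vals_left mm_vals_right fun_eq_iff)
    then show "mprod {..<m} M N i h \<in> ?P ` W"
      using W(2)[of i h] \<open>i \<in> _\<close> \<open>h \<in> _\<close> by (metis imageI lessThan_iff)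
  qed
  ultimately show "knows UNIV ?V (cost p) (ent (mprod {..<m} M N) {..<l} {..<k})"
    using knows_trans0 by fastforce
qed

text \<open>A test point that is one only at entry \<open>(i, 0)\<close> of the left and entry
  \<open>(0, h)\<close> of the right factor separates the outputs over every field. The condition
  \<open>0 < m\<close> provides the summand in which these entries meet.\<close>

lemma eval_mm_output_indicator:
  assumes "i < l" "h < k" "i' < l" "h' < k" "0 < m"
  shows "eval_at (\<lambda>r. if r = i * m \<or> r = l * m + h then 1 else 0) (mm_output l m k i' h')
    = (if i = i' \<and> h = h' then 1 else (0::'a::field))"
proof -
  have "(if i' * m + j = i * m \<or> i' * m + j = l * m + h then 1 else 0) *
      (if l * m + j * k + h' = i * m \<or> l * m + j * k + h' = l * m + h then 1 else (0::'a))
      = (if j = 0 then (if i = i' \<and> h = h' then 1 else 0) else 0)" if "j < m" for j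
  proof -
    have "i' * m + j < l * m" "i * m + 0 < l * m"
      using assms that index_less[of i' l j m] index_less[of i l 0 m] by auto
    then have "i' * m + j \<noteq> l * m + x" "l * m + x \<noteq> i * m" "l * m + (y + x) \<noteq> i * m" for x y
      by linarith+
    moreover have "i' * m + j = i * m \<longleftrightarrow> i' = i \<and> j = 0"
      using index_eq_iff[of j m 0 i' i] assms that by auto
    moreover have "j * k + h' = h \<longleftrightarrow> j = 0 \<and> h' = h"
      using index_eq_iff[of h' k h j 0] assms that by auto
    ultimately show ?thesis by auto
  qed
  then have "eval_at (\<lambda>r. if r = i * m \<or> r = l * m + h then 1 else 0) (mm_output l m k i' h')
      = (\<Sum>j<m. if j = 0 then (if i = i' \<and> h = h' then 1 else (0::'a)) else 0)"
    by (simp add: mm_output_def)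
  also have "\<dots> = (if i = i' \<and> h = h' then 1 else 0)"
    using assms by simp
  finally show ?thesis .
qed

lemma inj_on_mm_output:
  assumes "0 < m"
  shows "inj_on (\<lambda>(i, h). mm_output l m k i h :: 'a::field multi_poly) ({..<l} \<times> {..<k})"
proof (rule inj_onI)
  fix q q'
  assume *: "q \<in> {..<l} \<times> {..<k}" "q' \<in> {..<l} \<times> {..<k}"
    and eq: "(case q of (i, h) \<Rightarrow> mm_output l m k i h) = (case q' of (i, h) \<Rightarrow> (mm_output l m k i h :: 'a multi_poly))"
  obtain i h i' h' where q: "q = (i, h)" "q' = (i', h')" by fastforce
  have "eval_at (\<lambda>r. if r = i * m \<or> r = l * m + h then 1 else 0) (mm_output l m k i h)
      = eval_at (\<lambda>r. if r = i * m \<or> r = l * m + h then 1 else (0::'a)) (mm_output l m k i' h')"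
    using eq by (simp add: q)
  then show "q = q'" using * assms by (simp add: q eval_mm_output_indicator split: if_splits)
qed

text \<open>The gradient of the sum of all outputs with weights \<open>w\<close>, which is the trace
  of a product of three matrices. A forward pass for the base values costs \<open>cost p\<close>,
  the backward pass four times as much.\<close>

lemma knows_mm_gradient:
  fixes p :: "'a::field prog" and w :: "nat \<Rightarrow> nat \<Rightarrow> 'e \<Rightarrow> 'a"
  assumes "multiplies l m k p" and "0 < m" and U: "U \<subseteq> {..<l * m + m * k}"
    and x: "\<And>r. r < l * m + m * k \<Longrightarrow> r \<notin> U \<Longrightarrow> x r \<in> Q" and w: "ent w {..<l} {..<k} \<subseteq> Q"
  shows "knows UNIV Q (5 * cost p)
    ((\<lambda>v e. \<Sum>i<l. \<Sum>h<k. w i h e * pd U (\<lambda>r. x r e) v (mm_output l m k i h)) ` U)"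
proof -
  let ?V = "mm_inputs (l * m + m * k) :: 'a multi_poly set"
  obtain W where W: "freach ?V (cost p) W" "finite W"
    "\<And>i h. i < l \<Longrightarrow> h < k \<Longrightarrow> mm_output l m k i h \<in> W"
    using multiplies_freach[OF assms(1)] by metis
  let ?O = "\<lambda>(i, h). mm_output l m k i h :: 'a multi_poly" and ?S = "{..<l} \<times> {..<k}"
  \<comment> \<open>Outputs start with their prescribed weights, all other values with weight zero.
    Injectivity of the outputs makes this consistent.\<close>
  define g where "g = (\<lambda>f. if f \<in> ?O ` ?S then (case inv_into ?S ?O f of (i, h) \<Rightarrow> w i h) else (\<lambda>_. 0))"
  let ?B = "(\<lambda>f e. base_val U (\<lambda>r. x r e) f)"
  have inj: "inj_on ?O ?S" by (rule inj_on_mm_output[OF assms(2)])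
  have g: "g (?O q) = (case q of (i, h) \<Rightarrow> w i h)" if "q \<in> ?S" for q
    unfolding g_def using that inv_into_f_f[OF inj that] by (auto simp del: case_prod_conv)
  have "g ` W \<subseteq> insert (\<lambda>_. 0) Q"
  proof (clarsimp)
    fix f assume "f \<in> W" "g f \<notin> Q"
    then show "g f = (\<lambda>_. 0)"
      using g w by (cases "f \<in> ?O ` ?S") (force simp: ent_subset_iff, simp add: g_def)
  qed
  have "knows UNIV Q 0 (?B ` ?V)"
  proof (rule knows_set)
    fix f assume "f \<in> ?B ` ?V"
    then consider "f = (\<lambda>_. 0)" | r where "r < l * m + m * k" "r \<notin> U" "f = x r"
      by (fastforce simp: mm_inputs_def base_val_def)
    then show "knows UNIV Q 0 {f}"
      by cases (simp_all add: knows_const knows_member x)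
  qed (simp add: mm_inputs_def)
  moreover have "derives UNIV (?B ` ?V) (cost p) (?B ` W)"
    using derives_eval_at[OF W(1), of UNIV "\<lambda>r. if r \<in> U then (\<lambda>e. 0) else x r"]
    by (simp add: base_val_def if_distrib[of "\<lambda>f. f _"])
  then have "knows UNIV (?B ` ?V) (cost p) (?B ` W)" unfolding knows_def by blast
  ultimately have 1: "knows UNIV Q (cost p) (?B ` W)"
    using knows_trans0 by fastforce
  have 2: "knows UNIV Q (cost p) (insert (\<lambda>_. 0) Q \<union> ?B ` W)"
    by (rule knows_trans'[OF knows_Un[OF 1 knows_const[of _ _ 0 0]], where b = 0]) (auto intro: knows_refl)
  have "knows UNIV (insert (\<lambda>_. 0) Q \<union> ?B ` W) (4 * cost p)
      ((\<lambda>v e. \<Sum>f\<in>W. g f e * pd U (\<lambda>r. x r e) v f) ` U)"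
    by (rule knows_gradient_aux[OF W(1)])
      (use \<open>g ` W \<subseteq> _\<close> U in \<open>auto simp: mm_inputs_def intro: finite_subset\<close>)
  with 2 have "knows UNIV Q (cost p + 4 * cost p) ((\<lambda>v e. \<Sum>f\<in>W. g f e * pd U (\<lambda>r. x r e) v f) ` U)"
    by (rule knows_trans0) simp
  moreover have "(\<Sum>f\<in>W. g f e * pd U (\<lambda>r. x r e) v f)
      = (\<Sum>i<l. \<Sum>h<k. w i h e * pd U (\<lambda>r. x r e) v (mm_output l m k i h))" for v e
  proof -
    have "(\<Sum>f\<in>W. g f e * pd U (\<lambda>r. x r e) v f) = (\<Sum>f\<in>?O ` ?S. g f e * pd U (\<lambda>r. x r e) v f)"
      by (rule sum.mono_neutral_right) (use W in \<open>auto simp: g_def\<close>)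
    also have "\<dots> = (\<Sum>q\<in>?S. g (?O q) e * pd U (\<lambda>r. x r e) v (?O q))"
      by (rule sum.reindex_cong[OF inj]) auto
    also have "\<dots> = (\<Sum>q\<in>?S. (case q of (i, h) \<Rightarrow> w i h e * pd U (\<lambda>r. x r e) v (mm_output l m k i h)))"
      by (rule sum.cong) (auto simp: g simp del: case_prod_conv split: prod.splits)
    finally show ?thesis by (simp add: sum.cartesian_product)
  qed
  ultimately show ?thesis by simp
qed

lemma base_val_indet [simp]: "base_val U x (indet r) = (if r \<in> U then 0 else x r)"
  by (simp add: base_val_def)

text \<open>The derivative of the sum of all \<open>M i h\<close> times entry \<open>(i, h)\<close>
  of \<open>Y Z\<close> with respect to \<open>Y i j\<close> is entry \<open>(i, j)\<close> of
  \<open>M\<close> times the transpose of \<open>Z\<close>. So the transpose of \<open>N\<close> is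
  substituted for \<open>Z\<close>.\<close>

lemma matmul_cost_left_gradient:
  fixes p :: "'a::field prog"
  assumes "multiplies l m k p"
  shows "matmul_cost TYPE('e \<Rightarrow> 'a) (5 * cost p) l k m"
proof (rule matmul_costI)
  fix M N :: "nat \<Rightarrow> nat \<Rightarrow> 'e \<Rightarrow> 'a"
  let ?Q = "ent M {..<l} {..<k} \<union> ent N {..<k} {..<m}"
  show "knows UNIV ?Q (5 * cost p) (ent (mprod {..<k} M N) {..<l} {..<m})"
  proof (cases "m = 0")
    case True
    then show ?thesis by (simp add: ent_def knows_refl)
  next
    case False
    let ?U = "{..<l * m}" and ?x = "mm_vals l m k (\<lambda>_ _ _. 0) (\<lambda>j h. N h j)"
    have "?x r \<in> ?Q" if r: "r < l * m + m * k" "r \<notin> ?U" for r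
    proof -
      have "r - l * m < m * k" using r by simp
      then obtain j h where "j < m" "h < k" "r - l * m = j * k + h" by (rule less_mult_indexE)
      then have "r = l * m + j * k + h" using r by simp
      then show ?thesis using \<open>j < m\<close> \<open>h < k\<close> by (auto simp: mm_vals_right)
    qed
    with False have "knows UNIV ?Q (5 * cost p)
        ((\<lambda>v e. \<Sum>i<l. \<Sum>h<k. M i h e * pd ?U (\<lambda>r. ?x r e) v (mm_output l m k i h)) ` ?U)"
      by (intro knows_mm_gradient[OF assms]) auto
    moreover have "mprod {..<k} M N i j \<in>
        ((\<lambda>v e. \<Sum>i<l. \<Sum>h<k. M i h e * pd ?U (\<lambda>r. ?x r e) v (mm_output l m k i h)) ` ?U)"
      (is "_ \<in> ?G") if ij: "i < l" "j < m" for i j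
    proof (rule image_eqI[of _ _ "i * m + j"])
      show "mprod {..<k} M N i j = (\<lambda>e. \<Sum>i'<l. \<Sum>h<k. M i' h e *
          pd ?U (\<lambda>r. ?x r e) (i * m + j) (mm_output l m k i' h))"
      proof
        fix e
        have pd: "pd ?U (\<lambda>r. ?x r e) (i * m + j) (mm_output l m k i' h) = (if i' = i then N h j e else 0)"
          if "i' < l" "h < k" for i' h
        proof -
          have "pd ?U (\<lambda>r. ?x r e) (i * m + j) (mm_output l m k i' h)
              = (\<Sum>j'<m. if j' = j then (if i' = i then N h j e else 0) else 0)"
            unfolding mm_output_def pd_sum pd_mult
            by (rule sum.cong[OF refl])
              (use that ij in \<open>auto simp: pd_indet index_less index_eq_iff mm_vals_right\<close>)
          then show ?thesis using ij by simp
        qed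
        have "(\<Sum>i'<l. \<Sum>h<k. M i' h e * pd ?U (\<lambda>r. ?x r e) (i * m + j) (mm_output l m k i' h))
            = (\<Sum>i'<l. if i' = i then \<Sum>h<k. M i h e * N h j e else 0)"
          by (rule sum.cong[OF refl]) (auto simp: pd)
        then show "mprod {..<k} M N i j e = (\<Sum>i'<l. \<Sum>h<k. M i' h e *
            pd ?U (\<lambda>r. ?x r e) (i * m + j) (mm_output l m k i' h))"
          using ij by (simp add: mprod_def)
      qed
    qed (use ij in \<open>simp add: index_less\<close>)
    then have "ent (mprod {..<k} M N) {..<l} {..<m} \<subseteq> ?G" unfolding ent_subset_iff by blast
    ultimately show ?thesis by (rule knows_mono[OF _ subset_refl subset_refl order_refl])
  qed
qed

text \<open>Now the derivative is taken with respect to the right factor, which yields the transpose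
  of the left factor times \<open>N\<close>. Transposition exchanges the outer dimensions and a
  gradient exchanges neighbouring ones; together they generate all six orders of \<open>l\<close>,
  \<open>m\<close>, \<open>k\<close>.\<close>

lemma matmul_cost_right_gradient:
  fixes p :: "'a::field prog"
  assumes "multiplies l m k p"
  shows "matmul_cost TYPE('e \<Rightarrow> 'a) (5 * cost p) m l k"
proof (rule matmul_costI)
  fix M N :: "nat \<Rightarrow> nat \<Rightarrow> 'e \<Rightarrow> 'a"
  let ?Q = "ent M {..<m} {..<l} \<union> ent N {..<l} {..<k}"
  show "knows UNIV ?Q (5 * cost p) (ent (mprod {..<l} M N) {..<m} {..<k})"
  proof (cases "m = 0")
    case True
    then show ?thesis by (simp add: ent_def knows_refl)
  next
    case False
    let ?U = "{l * m..<l * m + m * k}" and ?x = "mm_vals l m k (\<lambda>i j. M j i) (\<lambda>_ _ _. 0)"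
    have "?x r \<in> ?Q" if r: "r < l * m + m * k" "r \<notin> ?U" for r
    proof -
      have "r < l * m" using r by simp
      then obtain i j where "i < l" "j < m" "r = i * m + j" by (rule less_mult_indexE)
      then show ?thesis by (auto simp: mm_vals_left)
    qed
    with False have "knows UNIV ?Q (5 * cost p)
        ((\<lambda>v e. \<Sum>i<l. \<Sum>h<k. N i h e * pd ?U (\<lambda>r. ?x r e) v (mm_output l m k i h)) ` ?U)"
      by (intro knows_mm_gradient[OF assms]) auto
    moreover have "mprod {..<l} M N j h \<in>
        ((\<lambda>v e. \<Sum>i<l. \<Sum>h<k. N i h e * pd ?U (\<lambda>r. ?x r e) v (mm_output l m k i h)) ` ?U)"
      (is "_ \<in> ?G") if jh: "j < m" "h < k" for j h
    proof (rule image_eqI[of _ _ "l * m + j * k + h"])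
      show "mprod {..<l} M N j h = (\<lambda>e. \<Sum>i<l. \<Sum>h'<k. N i h' e *
          pd ?U (\<lambda>r. ?x r e) (l * m + j * k + h) (mm_output l m k i h'))"
      proof
        fix e
        have pd: "pd ?U (\<lambda>r. ?x r e) (l * m + j * k + h) (mm_output l m k i h') = (if h' = h then M j i e else 0)"
          if "i < l" "h' < k" for i h'
        proof -
          have "pd ?U (\<lambda>r. ?x r e) (l * m + j * k + h) (mm_output l m k i h')
              = (\<Sum>j'<m. if j' = j then (if h' = h then M j i e else 0) else 0)"
            unfolding mm_output_def pd_sum pd_mult
          proof (rule sum.cong[OF refl])
            fix j' assume "j' \<in> {..<m}"
            then have "i * m + j' < l * m" "j' * k + h' < m * k"
              using that index_less by auto
            then show "base_val ?U (\<lambda>r. ?x r e) (indet (i * m + j')) *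
                pd ?U (\<lambda>r. ?x r e) (l * m + j * k + h) (indet (l * m + j' * k + h')) +
                base_val ?U (\<lambda>r. ?x r e) (indet (l * m + j' * k + h')) *
                pd ?U (\<lambda>r. ?x r e) (l * m + j * k + h) (indet (i * m + j')) =
                (if j' = j then if h' = h then M j i e else 0 else 0)"
              using that jh \<open>j' \<in> _\<close> index_eq_iff[of h' k h j' j]
              by (auto simp: pd_indet mm_vals_left add.assoc)
          qed
          then show ?thesis using jh by simp
        qed
        have "(\<Sum>i<l. \<Sum>h'<k. N i h' e * pd ?U (\<lambda>r. ?x r e) (l * m + j * k + h) (mm_output l m k i h'))
            = (\<Sum>i<l. \<Sum>h'<k. if h' = h then M j i e * N i h e else 0)"
          by (intro sum.cong[OF refl]) (auto simp: pd)
        then show "mprod {..<l} M N j h e = (\<Sum>i<l. \<Sum>h'<k. N i h' e *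
            pd ?U (\<lambda>r. ?x r e) (l * m + j * k + h) (mm_output l m k i h'))"
          using jh by (simp add: mprod_def)
      qed
    qed (use jh in \<open>simp add: index_less add.assoc\<close>)
    then have "ent (mprod {..<l} M N) {..<m} {..<k} \<subseteq> ?G" unfolding ent_subset_iff by blast
    ultimately show ?thesis by (rule knows_mono[OF _ subset_refl subset_refl order_refl])
  qed
qed

subsection \<open>Bounds for the exponent\<close>

definition depends_only :: "nat set \<Rightarrow> 'a::field multi_poly \<Rightarrow> bool" where
  "depends_only R f \<longleftrightarrow> (\<forall>x y. (\<forall>r\<in>R. x r = y r) \<longrightarrow> eval_at x f = eval_at y f)"

text \<open>Each operand of an operation is a computed value, which depends on \<open>R\<close>
  only, or an input, which contributes at most one variable. So every operation enlarges
  \<open>R\<close> by at most two.\<close>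

lemma freach_depends_only:
  assumes "freach (mm_inputs N) c W"
  shows "\<exists>R. finite R \<and> card R \<le> 2 * c \<and> (\<forall>f\<in>W. f \<in> mm_inputs N \<or> depends_only R f)"
  using assms
proof (induction rule: freach.induct)
  case base
  then show ?case by (intro exI[of _ "{}"]) auto
next
  case (const c W k)
  then obtain R where "finite R" "card R \<le> 2 * c" "\<forall>f\<in>W. f \<in> mm_inputs N \<or> depends_only R f"
    by blast
  then show ?case by (intro exI[of _ R]) (auto simp: depends_only_def)
next
  have operand: "\<exists>r. depends_only (insert r R) f" if "f \<in> mm_inputs N \<or> depends_only R f"
    for R and f :: "'a multi_poly"
    using that by (auto simp: mm_inputs_def depends_only_def)
  have op: "\<exists>R. finite R \<and> card R \<le> 2 * Suc c \<and> (\<forall>f\<in>insert h W. f \<in> mm_inputs N \<or> depends_only R f)"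
    if IH: "\<exists>R. finite R \<and> card R \<le> 2 * c \<and> (\<forall>f\<in>W. f \<in> mm_inputs N \<or> depends_only R f)"
      and fg: "f \<in> W" "g \<in> W" and h: "\<And>R. depends_only R f \<Longrightarrow> depends_only R g \<Longrightarrow> depends_only R h"
    for c W and f g h :: "'a multi_poly"
  proof -
    obtain R where R: "finite R" "card R \<le> 2 * c" "\<forall>f\<in>W. f \<in> mm_inputs N \<or> depends_only R f"
      using IH by blast
    obtain r s where "depends_only (insert r R) f" "depends_only (insert s R) g"
      using operand R(3) fg by metis
    then have "depends_only (insert r (insert s R)) f" "depends_only (insert r (insert s R)) g"
      by (simp_all add: depends_only_def)
    from h[OF this] R(3) have "\<forall>f\<in>insert h W. f \<in> mm_inputs N \<or> depends_only (insert r (insert s R)) f"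
      by (auto simp: depends_only_def)
    moreover have "card (insert r (insert s R)) \<le> 2 * Suc c"
      using R(1,2) by (simp add: card_insert_if)
    ultimately show ?thesis using R(1) by (intro exI[of _ "insert r (insert s R)"]) simp
  qed
  {
    case (add c W f g)
    show ?case by (rule op[OF add.IH add.hyps(2,3)]) (simp add: depends_only_def, metis)
  next
    case (sub c W f g)
    show ?case by (rule op[OF sub.IH sub.hyps(2,3)]) (simp add: depends_only_def, metis)
  next
    case (mul c W f g)
    show ?case by (rule op[OF mul.IH mul.hyps(2,3)]) (simp add: depends_only_def, metis)
  }
qed

text \<open>Every entry of the left factor influences some output and therefore has to be read. The
  resulting bound for exponents is used later, when products of small formats are cut out of
  programs for smaller dimensions.\<close>

lemma multiplies_cost_ge:
  fixes p :: "'a::field prog"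
  assumes "multiplies l m k p" and "0 < k"
  shows "l * m \<le> 2 * cost p"
proof -
  obtain W where W: "freach (mm_inputs (l * m + m * k)) (cost p) W"
    "\<And>i h. i < l \<Longrightarrow> h < k \<Longrightarrow> mm_output l m k i h \<in> (W :: 'a multi_poly set)"
    using multiplies_freach[OF assms(1)] by metis
  obtain R where R: "finite R" "card R \<le> 2 * cost p"
    "\<forall>f\<in>W. f \<in> mm_inputs (l * m + m * k) \<or> depends_only R f"
    using freach_depends_only[OF W(1)] by blast
  have "r \<in> R" if "r < l * m" for r
  proof (rule ccontr)
    assume "r \<notin> R"
    from \<open>r < l * m\<close> obtain i j where ij: "i < l" "j < m" "r = i * m + j" by (rule less_mult_indexE)
    let ?f = "mm_output l m k i 0 :: 'a multi_poly"
    have lt: "i * m + j' < l * m" if "j' < m" for j' using ij that by (simp add: index_less)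
    then have ne: "i * m + j' \<noteq> l * m + x" if "j' < m" for j' x using that by (metis not_add_less1)
    then have ne': "l * m + x \<noteq> i * m + j'" if "j' < m" for j' x using that by metis
    \<comment> \<open>An output that is itself an input would escape the count; both kinds of inputs
      are excluded by evaluation.\<close>
    have "?f \<noteq> 0"
      using eval_mm_output_indicator[of i l 0 k i 0 m, where 'a = 'a] ij assms(2) by auto
    moreover have "?f \<noteq> indet s" for s
    proof
      assume "?f = indet s"
      then have "eval_at (\<lambda>r. if r = s then 1 else 0) ?f = (1::'a)" by simp
      moreover have "eval_at (\<lambda>r. if r = s then 1 else 0) ?f = (0::'a)"
        using ne ne' by (auto simp: mm_output_def intro!: sum.neutral)
      ultimately show False by simp
    qed
    ultimately have "depends_only R ?f"
      using R(3) W(2)[of i 0] ij assms(2) by (auto simp: mm_inputs_def)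
    then have D: "eval_at x ?f = eval_at y ?f" if "\<And>s. s \<in> R \<Longrightarrow> x s = y s" for x y
      using that by (auto simp: depends_only_def)
    \<comment> \<open>Two points that differ only at \<open>r\<close>: with the matching entry of
      the right factor set to one, the output is one or zero depending on \<open>r\<close>.\<close>
    have "eval_at (\<lambda>u. if u = r \<or> u = l * m + j * k then 1 else 0) ?f
        = eval_at (\<lambda>u. if u = l * m + j * k then 1 else (0::'a)) ?f"
      by (rule D) (use \<open>r \<notin> R\<close> in auto)
    moreover have "eval_at (\<lambda>u. if u = l * m + j * k then 1 else (0::'a)) ?f = 0"
      using ne ne' by (auto simp: mm_output_def intro!: sum.neutral)
    moreover have "eval_at (\<lambda>u. if u = r \<or> u = l * m + j * k then 1 else (0::'a)) ?f = 1"
    proof -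
      have "eval_at (\<lambda>u. if u = r \<or> u = l * m + j * k then 1 else (0::'a)) ?f
          = (\<Sum>j'<m. if j' = j then 1 else 0)"
        by (simp only: mm_output_def eval_at_simps, rule sum.cong[OF refl]) (use ne ne' ij(3) in auto)
      then show ?thesis using ij by simp
    qed
    ultimately show False by simp
  qed
  then have "card {..<l * m} \<le> card R" using R(1) by (intro card_mono) auto
  then show ?thesis using R(2) by simp
qed

section \<open>The cubic algorithm, and exponents near the infimum\<close>

lemma formal_run_append: "formal_run (p @ q) m = formal_run q (formal_run p m)"
  by (simp add: formal_run_def)

lemma cost_append [simp]: "cost (p @ q) = cost p + cost q"
  by (simp add: cost_def)

text \<open>Ensures that the set whose infimum is \<open>omega\<close> is nonempty.\<close>

lemma naive_multiplies:
  "\<exists>p :: 'a::field prog. multiplies l m k p \<and> cost p \<le> 2 * (l * m * k)"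
proof -
  define N where "N = l * m + m * k"
  \<comment> \<open>The products overwrite the input registers, so the inputs are first copied to a
    region starting at \<open>B\<close>, above inputs and outputs; \<open>T\<close> is a scratch
    register behind it.\<close>
  define B where "B = N + l * k"
  define T where "T = B + N"
  define loads :: "nat \<Rightarrow> 'a prog" where "loads = (\<lambda>t. map (\<lambda>r. Copy (B + r) r) [0..<t])"
  define terms :: "nat \<Rightarrow> nat \<Rightarrow> nat \<Rightarrow> 'a prog" where
    "terms = (\<lambda>i h t. concat (map (\<lambda>j. [Mul T (B + (i * m + j)) (B + (l * m + j * k + h)),
       Add (i * k + h) (i * k + h) T]) [0..<t]))"
  define cells :: "nat \<Rightarrow> 'a prog" where
    "cells = (\<lambda>t. concat (map (\<lambda>q. Const q 0 # terms (q div k) (q mod k) m) [0..<t]))"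
  let ?m0 = "\<lambda>r. if r < N then indet r else (0 :: 'a multi_poly)"
  have "formal_run (loads t) ?m0 r = (if B \<le> r \<and> r < B + t then indet (r - B) else ?m0 r)" if "t \<le> N" for t r
    using that
  proof (induction t arbitrary: r)
    case 0
    then show ?case by (auto simp: loads_def formal_run_def)
  next
    case (Suc t)
    then show ?case
      by (auto simp: loads_def formal_run_append) (auto simp: formal_run_def B_def N_def)
  qed
  then have loads: "formal_run (loads N) ?m0 (B + r) = indet r" if "r < N" for r
    using that by simp
  have terms: "formal_run (terms i h t) \<mu> r =
      (if r = i * k + h then \<mu> r + (\<Sum>j<t. \<mu> (B + (i * m + j)) * \<mu> (B + (l * m + j * k + h))) else
       if r = T \<and> t > 0 then \<mu> (B + (i * m + (t - 1))) * \<mu> (B + (l * m + (t - 1) * k + h)) else \<mu> r)"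
    if "t \<le> m" "i < l" "h < k" for t i h \<mu> r
    using that(1)
  proof (induction t arbitrary: r)
    case 0
    then show ?case by (simp add: terms_def formal_run_def)
  next
    case (Suc t)
    have "i * k + h < l * k" "i * m + t < l * m" "t * k + h < m * k"
      using Suc.prems that index_less by auto
    then show ?case using Suc
      by (auto simp: terms_def formal_run_append) (auto simp: formal_run_def T_def B_def N_def)
  qed
  have cells: "formal_run (cells t) (formal_run (loads N) ?m0) r =
      (if r < t then mm_output l m k (r div k) (r mod k) else formal_run (loads N) ?m0 r)"
    if "t \<le> l * k" "r \<noteq> T" for t r
    using that
  proof (induction t arbitrary: r)
    case 0
    then show ?case by (simp add: cells_def formal_run_def)
  next
    case (Suc t)
    let ?\<mu> = "formal_run (cells t) (formal_run (loads N) ?m0)"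
    obtain i h where ih: "i < l" "h < k" "t = i * k + h"
      using Suc.prems less_mult_indexE[of t l k] by auto
    have old: "(?\<mu>(t := 0)) (B + u) = indet u" if "u < N" for u
      using Suc.IH[of "B + u"] Suc.prems that loads by (auto simp: B_def T_def)
    have "formal_run (cells (Suc t)) (formal_run (loads N) ?m0) r = formal_run (terms i h m) (?\<mu>(t := 0)) r"
      using ih by (simp add: cells_def formal_run_append) (simp add: formal_run_def const_poly_def)
    also have "\<dots> = (if r = t then \<Sum>j<m. indet (i * m + j) * indet (l * m + j * k + h) else ?\<mu> r)"
    proof -
      have "i * m + j < N" "l * m + j * k + h < N" if "j < m" for j
        using ih that index_less[of i l j m] index_less[of j m h k] by (auto simp: N_def add.assoc)
      then have "(\<Sum>j<m. (?\<mu>(t := 0)) (B + (i * m + j)) * (?\<mu>(t := 0)) (B + (l * m + j * k + h)))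
          = (\<Sum>j<m. indet (i * m + j) * indet (l * m + j * k + h))"
        by (intro sum.cong[OF refl]) (simp only: old lessThan_iff)
      then show ?thesis
        unfolding terms[OF order_refl ih(1,2)] using Suc.prems(2) ih(3) by simp
    qed
    also have "\<dots> = (if r < Suc t then mm_output l m k (r div k) (r mod k) else formal_run (loads N) ?m0 r)"
      using Suc.IH[of r] Suc.prems ih by (auto simp: mm_output_def less_Suc_eq)
    finally show ?case .
  qed
  let ?p = "loads N @ cells (l * k)"
  have "division_free ?p"
    by (auto simp: division_free_def loads_def cells_def terms_def)
  moreover have "formal_run ?p ?m0 (i * k + h) = mm_output l m k i h" if "i < l" "h < k" for i h
    using that cells[of "l * k" "i * k + h"] index_less[OF that]
    by (auto simp: formal_run_append T_def B_def)
  ultimately have "multiplies l m k ?p"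
    by (simp add: multiplies_def Let_def mm_output_def N_def)
  moreover have "cost ?p \<le> 2 * (l * m * k)"
  proof -
    have "cost (terms i h t) = 2 * t" for i h t
      by (induction t) (auto simp: terms_def cost_def)
    then have "cost (cells t) = 2 * m * t" for t
      by (induction t) (auto simp: cells_def cost_def)
    moreover have "cost (loads t) = 0" for t
      by (induction t) (auto simp: loads_def cost_def)
    ultimately show ?thesis by simp
  qed
  ultimately show ?thesis by blast
qed

lemma npow_ge_1: "1 \<le> n \<Longrightarrow> 0 \<le> a \<Longrightarrow> 1 \<le> npow n a"
  using ge_one_powr_ge_zero[of "real n" a] by (simp add: npow_def le_nat_floor)

lemma npow_le: "real (npow n a) \<le> real n powr a"
  by (simp add: npow_def)

lemma npow_ge:
  assumes "1 \<le> n" and "0 \<le> a" shows "real n powr a \<le> 2 * real (npow n a)"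
proof -
  have "real n powr a \<le> real (npow n a) + 1"
    unfolding npow_def using powr_ge_zero[of "real n" a] by linarith
  then show ?thesis using npow_ge_1[OF assms] by linarith
qed

lemma npow_mono: "1 \<le> n \<Longrightarrow> a \<le> b \<Longrightarrow> npow n a \<le> npow n b"
  by (simp add: npow_def nat_mono floor_mono powr_mono)

lemma npow_1 [simp]: "npow n 1 = n"
  by (simp add: npow_def)

lemma powr_growth:
  assumes "\<And>n::nat. 1 \<le> n \<Longrightarrow> real n powr a \<le> C * real n powr b"
  shows "a \<le> b"
proof (rule ccontr)
  assume "\<not> a \<le> b"
  then have d: "0 < a - b" by simp
  have C: "0 \<le> C" using assms[of 1] by simp
  \<comment> \<open>Large enough for \<open>n powr (a - b)\<close> to be at least
    \<open>C + 1\<close>.\<close>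
  define n where "n = nat \<lceil>(C + 1) powr (1 / (a - b))\<rceil>"
  have "(C + 1) powr (1 / (a - b)) \<ge> 1" using C d by (simp add: ge_one_powr_ge_zero)
  then have n: "real n \<ge> (C + 1) powr (1 / (a - b))" "1 \<le> n" unfolding n_def by linarith+
  have "C + 1 = ((C + 1) powr (1 / (a - b))) powr (a - b)" using C d by (simp add: powr_powr)
  also have "\<dots> \<le> real n powr (a - b)" using n d by (intro powr_mono2) auto
  finally have "C + 1 \<le> real n powr a / real n powr b" by (simp add: powr_diff)
  also have "\<dots> \<le> C" using assms[OF n(2)] n(2) by (simp add: divide_le_eq)
  finally show False by simp
qed

lemma mm_achievable_ge:
  assumes "mm_achievable K a b c \<tau>" and "0 \<le> a" and "0 \<le> b" and "0 \<le> c"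
  shows "a + b \<le> \<tau>"
proof -
  obtain C where C: "\<And>n. n \<ge> 1 \<Longrightarrow> \<exists>p :: 'a prog. multiplies (npow n a) (npow n b) (npow n c) p \<and>
      real (cost p) \<le> C * real n powr \<tau>"
    using assms(1) unfolding mm_achievable_def by blast
  show ?thesis
  proof (rule powr_growth)
    fix n :: nat assume n: "1 \<le> n"
    then obtain p :: "'a prog" where p: "multiplies (npow n a) (npow n b) (npow n c) p"
      "real (cost p) \<le> C * real n powr \<tau>" using C by blast
    have "npow n a * npow n b \<le> 2 * cost p"
      using multiplies_cost_ge[OF p(1)] npow_ge_1[OF n assms(4)] by simp
    then have "real (npow n a) * real (npow n b) \<le> 2 * real (cost p)"
      by (metis of_nat_le_iff of_nat_mult of_nat_numeral)
    have "real n powr (a + b) = real n powr a * real n powr b" by (simp add: powr_add)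
    also have "\<dots> \<le> (2 * real (npow n a)) * (2 * real (npow n b))"
      using npow_ge[OF n] assms by (intro mult_mono) auto
    also have "\<dots> \<le> 8 * real (cost p)" using \<open>_ \<le> 2 * real (cost p)\<close> by simp
    also have "\<dots> \<le> (8 * C) * real n powr \<tau>" using p(2) by simp
    finally show "real n powr (a + b) \<le> (8 * C) * real n powr \<tau>" .
  qed
qed

lemma mm_achievable_naive:
  assumes "0 \<le> a" and "0 \<le> b" and "0 \<le> c"
  shows "mm_achievable (K :: 'a::field itself) a b c (a + b + c)"
  unfolding mm_achievable_def
proof (intro exI[of _ 2] allI impI)
  fix n :: nat assume "1 \<le> n"
  obtain p :: "'a prog" where p: "multiplies (npow n a) (npow n b) (npow n c) p"
    "cost p \<le> 2 * (npow n a * npow n b * npow n c)" using naive_multiplies by blast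
  have "real (cost p) \<le> 2 * (real (npow n a) * real (npow n b) * real (npow n c))"
    using p(2) by (metis of_nat_le_iff of_nat_mult of_nat_numeral)
  also have "\<dots> \<le> 2 * (real n powr a * real n powr b * real n powr c)"
    by (intro mult_left_mono mult_mono npow_le) auto
  finally have "real (cost p) \<le> 2 * real n powr (a + b + c)" by (simp add: powr_add)
  then show "\<exists>p :: 'a prog. multiplies (npow n a) (npow n b) (npow n c) p \<and>
      real (cost p) \<le> 2 * real n powr (a + b + c)" using p(1) by blast
qed

lemma omega_program:
  assumes "0 \<le> a" and "0 \<le> b" and "0 \<le> c" and "0 < \<delta>"
  obtains C \<tau> where "0 \<le> C" and "a + b \<le> \<tau>" and "\<tau> < omega TYPE('a::field) a b c + \<delta>"
    and "\<And>n. 1 \<le> n \<Longrightarrow> \<exists>p :: 'a prog. multiplies (npow n a) (npow n b) (npow n c) p \<and>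
      real (cost p) \<le> C * real n powr \<tau>"
proof -
  let ?S = "{\<tau>. mm_achievable TYPE('a) a b c \<tau>}"
  have "?S \<noteq> {}" using mm_achievable_naive[OF assms(1-3)] by blast
  then obtain \<tau> where \<tau>: "\<tau> \<in> ?S" "\<tau> < omega TYPE('a) a b c + \<delta>"
    using cInf_lessD[of ?S "omega TYPE('a) a b c + \<delta>"] assms(4) unfolding omega_def by auto
  then obtain C where C: "\<And>n. n \<ge> 1 \<Longrightarrow> \<exists>p :: 'a prog. multiplies (npow n a) (npow n b) (npow n c) p \<and>
      real (cost p) \<le> C * real n powr \<tau>"
    unfolding mm_achievable_def by blast
  have "0 \<le> C" using C[of 1] by (auto intro: order_trans[of 0 "real _"])
  then show ?thesis using that C \<tau> mm_achievable_ge[of "TYPE('a)" a b c \<tau>] assms by blast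
qed

subsection \<open>Block products\<close>

lemma partition_blocks:
  assumes "finite I" and "card I \<le> a * l"
  obtains F :: "nat \<Rightarrow> 'i set" where "I = (\<Union>t<a. F t)" and "disjoint_family_on F {..<a}"
    and "\<And>t. card (F t) \<le> l" and "\<And>t. finite (F t)"
proof -
  obtain b where b: "bij_betw b {..<card I} I"
    using ex_bij_betw_nat_finite[OF assms(1)] by (auto simp: atLeast0LessThan)
  define F where "F = (\<lambda>t. b ` {r. r < card I \<and> r div l = t})"
  have sub: "{r. r < card I \<and> r div l = t} \<subseteq> {t * l..<t * l + l}" for t
  proof (cases "l = 0")
    case True
    then show ?thesis using assms(2) by simp
  next
    case False
    show ?thesis
    proof
      fix r assume "r \<in> {r. r < card I \<and> r div l = t}"
      then show "r \<in> {t * l..<t * l + l}"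
        using div_times_less_eq_dividend[of r l] dividend_less_div_times[of l r] False by auto
    qed
  qed
  show ?thesis
  proof
    show "I = (\<Union>t<a. F t)"
    proof
      show "I \<subseteq> (\<Union>t<a. F t)"
      proof
        fix i assume "i \<in> I"
        then obtain r where r: "r < card I" "i = b r"
          using bij_betw_imp_surj_on[OF b] by (metis imageE lessThan_iff)
        then have "r div l < a" using assms(2) by (simp add: less_mult_imp_div_less)
        then show "i \<in> (\<Union>t<a. F t)" using r by (auto simp: F_def)
      qed
      show "(\<Union>t<a. F t) \<subseteq> I" using bij_betwE[OF b] by (auto simp: F_def)
    qed
    show "disjoint_family_on F {..<a}"
      using bij_betw_imp_inj_on[OF b] by (auto simp: disjoint_family_on_def F_def inj_on_def)
    show "card (F t) \<le> l" for t
      unfolding F_def using card_image_le[of "{r. r < card I \<and> r div l = t}" b] card_mono[OF _ sub[of t]]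
      by simp
    show "finite (F t)" for t by (simp add: F_def)
  qed
qed

lemma ent_UN: "ent M (\<Union>t\<in>T. F t) J = (\<Union>t\<in>T. ent M (F t) J)"
  by auto

lemma matmul_cost_rows:
  assumes "matmul_cost (T :: ('e \<Rightarrow> 'a::field) itself) q l m k"
  shows "matmul_cost T (a * q) (a * l) m k"
  unfolding matmul_cost_def
proof (intro allI impI, elim conjE)
  fix M N :: "nat \<Rightarrow> nat \<Rightarrow> 'e \<Rightarrow> 'a" and I J H :: "nat set"
  assume *: "finite I" "finite J" "finite H" "card I \<le> a * l" "card J \<le> m" "card H \<le> k"
  obtain F where F: "I = (\<Union>t<a. F t)" "disjoint_family_on F {..<a}" "\<And>t. card (F t) \<le> l" "\<And>t. finite (F t)"
    by (rule partition_blocks[OF *(1,4)], rule that)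
  have "knows UNIV (ent M I J \<union> ent N J H) (\<Sum>t<a. q) (\<Union>t<a. ent (mprod J M N) (F t) H)"
  proof (rule knows_UN)
    fix t assume "t \<in> {..<a}"
    then have "F t \<subseteq> I" using F(1) by auto
    then show "knows UNIV (ent M I J \<union> ent N J H) q (ent (mprod J M N) (F t) H)"
      using * F(3,4) by (intro matmul_costD[OF assms]) (auto simp: ent_subset_iff)
  qed simp
  then show "knows UNIV (ent M I J \<union> ent N J H) (a * q) (ent (mprod J M N) I H)"
    by (simp add: F(1) ent_UN)
qed

lemma matmul_cost_cols:
  "matmul_cost T q l m k \<Longrightarrow> matmul_cost T (a * q) l m (a * k)"
  by (intro matmul_cost_transpose[of T _ "a * k"] matmul_cost_rows matmul_cost_transpose[of T _ l])

text \<open>Splitting the summation index leaves \<open>a\<close> partial products that have to be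
  added, at \<open>l * k\<close> operations each.\<close>

lemma matmul_cost_mid:
  assumes "matmul_cost (T :: ('e \<Rightarrow> 'a::field) itself) q l m k"
  shows "matmul_cost T (a * (q + l * k)) l (a * m) k"
  unfolding matmul_cost_def
proof (intro allI impI, elim conjE)
  fix M N :: "nat \<Rightarrow> nat \<Rightarrow> 'e \<Rightarrow> 'a" and I J H :: "nat set"
  assume *: "finite I" "finite J" "finite H" "card I \<le> l" "card J \<le> a * m" "card H \<le> k"
  obtain F where F: "J = (\<Union>t<a. F t)" "disjoint_family_on F {..<a}" "\<And>t. card (F t) \<le> m" "\<And>t. finite (F t)"
    by (rule partition_blocks[OF *(2,5)], rule that)
  let ?V = "ent M I J \<union> ent N J H" and ?P = "\<Union>t<a. ent (mprod (F t) M N) I H"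
  have "knows UNIV ?V (\<Sum>t<a. q) ?P"
  proof (rule knows_UN)
    fix t assume "t \<in> {..<a}"
    then have "F t \<subseteq> J" using F(1) by auto
    then show "knows UNIV ?V q (ent (mprod (F t) M N) I H)"
      using * F(3,4) by (intro matmul_costD[OF assms]) (auto simp: ent_subset_iff)
  qed simp
  moreover have "knows UNIV (?V \<union> ?P) (l * k * a) (ent (mprod J M N) I H)"
  proof -
    have "knows UNIV (?V \<union> ?P) (card I * card H * a) (ent (\<lambda>i h e. \<Sum>t<a. mprod (F t) M N i h e) I H)"
    proof (rule knows_ent[OF *(1,3)])
      fix i h assume "i \<in> I" "h \<in> H"
      have "knows UNIV (?V \<union> ?P) (card {..<a} * (0 + 1)) {\<lambda>e. \<Sum>t<a. mprod (F t) M N i h e}"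
        by (rule knows_sum) (use \<open>i \<in> I\<close> \<open>h \<in> H\<close> in \<open>auto intro!: knows_member\<close>)
      then show "knows UNIV (?V \<union> ?P) a {\<lambda>e. \<Sum>t<a. mprod (F t) M N i h e}" by simp
    qed
    moreover have "(\<lambda>i h e. \<Sum>t<a. mprod (F t) M N i h e) = mprod J M N"
      unfolding mprod_def F(1) using F(2,4)
      by (intro ext sum.UNION_disjoint[symmetric]) (auto simp: disjoint_family_on_def)
    moreover have "card I * card H * a \<le> l * k * a" using * by (intro mult_le_mono) auto
    ultimately show ?thesis by (auto elim: knows_mono)
  qed
  ultimately show "knows UNIV ?V (a * (q + l * k)) (ent (mprod J M N) I H)"
    by (rule knows_trans') (auto simp: algebra_simps)
qed

text \<open>In \<open>good T n X Y B\<close>, \<open>B\<close> bounds the cost per row or column of products with a factor of at most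
  \<open>X\<close> columns; \<open>X\<close> and \<open>Y\<close> stand for \<open>n powr x\<close> and \<open>n powr y\<close>, and \<open>B\<close> for
  \<open>n powr (omega 1 y x - x)\<close>.\<close>

definition good :: "('e \<Rightarrow> 'a::field) itself \<Rightarrow> nat \<Rightarrow> nat \<Rightarrow> nat \<Rightarrow> nat \<Rightarrow> bool" where
  "good T n X Y B \<longleftrightarrow> 1 \<le> X \<and> X \<le> Y \<and> n * Y \<le> X * B \<and>
     (\<forall>m. 1 \<le> m \<and> m \<le> X \<longrightarrow> matmul_cost T (m * B) m n m \<and> matmul_cost T (m * B) m m n) \<and>
     matmul_cost T (X * B) Y n X \<and> matmul_cost T (X * B) Y X n \<and> matmul_cost T (X * B) X Y n"

lemma good_le: assumes "good T n X Y B" shows "n \<le> B"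
proof -
  have "n * X \<le> X * B" using assms unfolding good_def by (meson le_trans mult_le_mono2)
  then show ?thesis using assms by (simp add: good_def mult.commute)
qed

text \<open>Enlarging two dimensions by \<open>\<kappa>\<close> means
  \<open>\<kappa>\<^sup>2\<close> block products. The factor 2 pays for the additions when the
  summation index is split; these are no more expensive than the products because of
  \<open>n \<le> B\<close> and \<open>n * Y \<le> X * B\<close>. It takes care of sets that exceed
  powers of \<open>n\<close> by a constant factor.\<close>

lemma good_scale:
  assumes good: "good T n X Y B" and \<kappa>: "1 \<le> \<kappa>"
  shows "good T n (\<kappa> * X) (\<kappa> * Y) (2 * \<kappa>\<^sup>2 * B)"
proof -
  have X: "1 \<le> X" "X \<le> Y" "n * Y \<le> X * B"
    and small: "\<And>m. 1 \<le> m \<Longrightarrow> m \<le> X \<Longrightarrow> matmul_cost T (m * B) m n m \<and> matmul_cost T (m * B) m m n"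
    and big: "matmul_cost T (X * B) Y n X" "matmul_cost T (X * B) Y X n" "matmul_cost T (X * B) X Y n"
    using good unfolding good_def by auto
  have nB: "n \<le> B" by (rule good_le[OF good])
  have "matmul_cost T (m * (2 * \<kappa>\<^sup>2 * B)) m n m \<and> matmul_cost T (m * (2 * \<kappa>\<^sup>2 * B)) m m n"
    if m: "1 \<le> m" "m \<le> \<kappa> * X" for m
  proof -
    \<comment> \<open>The quotient rounded up: \<open>\<kappa> * m0\<close> covers \<open>m\<close>,
      while \<open>m0 \<le> m\<close> keeps the cost proportional to \<open>m\<close>.\<close>
    define m0 where "m0 = (m + \<kappa> - 1) div \<kappa>"
    have "m \<le> \<kappa> * m0"
      using \<kappa> m(1) dividend_less_times_div[of \<kappa> "m + \<kappa> - 1"] unfolding m0_def by simp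
    moreover have "m0 \<le> m"
    proof -
      have "m + \<kappa> - 1 < (m + 1) * \<kappa>" using \<kappa> m(1) by (cases \<kappa>) (auto simp: algebra_simps)
      then show ?thesis unfolding m0_def by (metis Suc_eq_plus1 less_Suc_eq_le less_mult_imp_div_less)
    qed
    moreover have "m0 \<le> X"
    proof -
      have "m + \<kappa> - 1 < (X + 1) * \<kappa>" using \<kappa> m by (auto simp: algebra_simps)
      then show ?thesis unfolding m0_def by (metis Suc_eq_plus1 less_Suc_eq_le less_mult_imp_div_less)
    qed
    moreover have "1 \<le> m0" using \<open>m \<le> \<kappa> * m0\<close> m(1) by (cases m0) auto
    ultimately have m0: "m \<le> \<kappa> * m0" "m0 \<le> m" "1 \<le> m0" "m0 \<le> X" by auto
    have "matmul_cost T (\<kappa> * (\<kappa> * (m0 * B))) (\<kappa> * m0) n (\<kappa> * m0)"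
      using small[OF m0(3,4)] by (blast intro: matmul_cost_rows matmul_cost_cols)
    moreover have "\<kappa> * (\<kappa> * (m0 * B)) \<le> m * (2 * \<kappa>\<^sup>2 * B)"
    proof -
      have "\<kappa> * (\<kappa> * (m0 * B)) = m0 * (\<kappa>\<^sup>2 * B)" by (simp add: power2_eq_square)
      also have "\<dots> \<le> m * (2 * \<kappa>\<^sup>2 * B)" using m0(2) by (intro mult_le_mono) auto
      finally show ?thesis .
    qed
    ultimately have 1: "matmul_cost T (m * (2 * \<kappa>\<^sup>2 * B)) m n m"
      using m0(1) by (blast intro: matmul_cost_mono)
    have "matmul_cost T (\<kappa> * (\<kappa> * (m0 * B) + \<kappa> * m0 * n)) (\<kappa> * m0) (\<kappa> * m0) n"
      using small[OF m0(3,4)] by (blast intro: matmul_cost_rows matmul_cost_mid)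
    moreover have "\<kappa> * (\<kappa> * (m0 * B) + \<kappa> * m0 * n) \<le> m * (2 * \<kappa>\<^sup>2 * B)"
    proof -
      have "\<kappa> * (\<kappa> * (m0 * B) + \<kappa> * m0 * n) = m0 * (\<kappa>\<^sup>2 * (B + n))"
        by (simp add: power2_eq_square algebra_simps)
      also have "\<dots> \<le> m * (\<kappa>\<^sup>2 * (2 * B))" using m0(2) nB by (intro mult_le_mono) auto
      finally show ?thesis by (simp add: ac_simps)
    qed
    ultimately have "matmul_cost T (m * (2 * \<kappa>\<^sup>2 * B)) m m n"
      using m0(1) by (blast intro: matmul_cost_mono)
    with 1 show ?thesis by blast
  qed
  moreover have "matmul_cost T (\<kappa> * X * (2 * \<kappa>\<^sup>2 * B)) (\<kappa> * Y) n (\<kappa> * X)"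
  proof (rule matmul_cost_mono)
    show "matmul_cost T (\<kappa> * (\<kappa> * (X * B))) (\<kappa> * Y) n (\<kappa> * X)"
      using big(1) by (blast intro: matmul_cost_rows matmul_cost_cols)
    have "\<kappa> * (\<kappa> * (X * B)) \<le> (\<kappa> * 2) * (\<kappa> * (\<kappa> * (X * B)))" using \<kappa> by simp
    then show "\<kappa> * (\<kappa> * (X * B)) \<le> \<kappa> * X * (2 * \<kappa>\<^sup>2 * B)" by (simp add: power2_eq_square ac_simps)
  qed auto
  moreover have "matmul_cost T (\<kappa> * X * (2 * \<kappa>\<^sup>2 * B)) (\<kappa> * Y) (\<kappa> * X) n"
  proof (rule matmul_cost_mono)
    show "matmul_cost T (\<kappa> * (\<kappa> * (X * B) + \<kappa> * Y * n)) (\<kappa> * Y) (\<kappa> * X) n"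
      using big(2) by (blast intro: matmul_cost_rows matmul_cost_mid)
    have "\<kappa> * (\<kappa> * (X * B) + \<kappa> * Y * n) = \<kappa> * \<kappa> * (X * B + n * Y)" by (simp add: algebra_simps)
    also have "\<dots> \<le> \<kappa> * \<kappa> * (2 * (X * B))" using X(3) by (intro mult_le_mono2) (simp add: mult.commute)
    also have "\<dots> \<le> \<kappa> * (\<kappa> * \<kappa> * (2 * (X * B)))" using \<kappa> by simp
    finally show "\<kappa> * (\<kappa> * (X * B) + \<kappa> * Y * n) \<le> \<kappa> * X * (2 * \<kappa>\<^sup>2 * B)"
      by (simp add: power2_eq_square ac_simps)
  qed auto
  moreover have "matmul_cost T (\<kappa> * X * (2 * \<kappa>\<^sup>2 * B)) (\<kappa> * X) (\<kappa> * Y) n"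
  proof (rule matmul_cost_mono)
    show "matmul_cost T (\<kappa> * (\<kappa> * (X * B) + \<kappa> * X * n)) (\<kappa> * X) (\<kappa> * Y) n"
      using big(3) by (blast intro: matmul_cost_rows matmul_cost_mid)
    have "\<kappa> * (\<kappa> * (X * B) + \<kappa> * X * n) = \<kappa> * \<kappa> * (X * B + X * n)" by (simp add: algebra_simps)
    also have "\<dots> \<le> \<kappa> * \<kappa> * (2 * (X * B))" using nB by (intro mult_le_mono2) simp
    also have "\<dots> \<le> \<kappa> * (\<kappa> * \<kappa> * (2 * (X * B)))" using \<kappa> by simp
    finally show "\<kappa> * (\<kappa> * (X * B) + \<kappa> * X * n) \<le> \<kappa> * X * (2 * \<kappa>\<^sup>2 * B)"
      by (simp add: power2_eq_square ac_simps)
  qed auto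
  moreover have "n * (\<kappa> * Y) \<le> \<kappa> * X * (2 * \<kappa>\<^sup>2 * B)"
  proof -
    have "n * (\<kappa> * Y) = \<kappa> * (n * Y)" by simp
    also have "\<dots> \<le> \<kappa> * (X * B)" using X(3) by simp
    also have "\<dots> \<le> (2 * \<kappa>\<^sup>2) * (\<kappa> * (X * B))" using \<kappa> by simp
    finally show ?thesis by (simp add: ac_simps)
  qed
  ultimately show ?thesis using X \<kappa> unfolding good_def by (auto simp: mult_le_mono)
qed

text \<open>For \<open>m\<close> far below \<open>X\<close> the program for dimension
  \<open>n\<close> is too expensive. A smaller dimension \<open>N\<close> with
  \<open>N powr x\<close> close to \<open>m\<close> is used, and the long side \<open>n\<close> is
  cut into pieces of length \<open>N\<close>. The cost \<open>(n / N) * N powr \<tau>\<close> equals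
  \<open>n * N powr (\<tau> - 1 - x) * N powr x\<close>, hence is of order
  \<open>m * n powr (\<tau> - x)\<close>; this uses that \<open>\<tau> - 1 - x\<close> is not
  negative.\<close>

lemma good_programs:
  assumes "0 \<le> x" and "x \<le> y" and "y \<le> 1" and "0 \<le> C" and "1 + y \<le> \<tau>"
    and prog: "\<And>n. 1 \<le> n \<Longrightarrow> \<exists>p :: 'a::field prog. multiplies (npow n 1) (npow n y) (npow n x) p \<and>
      real (cost p) \<le> C * real n powr \<tau>"
    and "1 \<le> n"
  shows "\<exists>B. good TYPE('e \<Rightarrow> 'a) n (npow n x) (npow n y) B \<and> real B \<le> (20 * C + 5) * real n powr (\<tau> - x)"
proof -
  let ?T = "TYPE('e \<Rightarrow> 'a)"
  \<comment> \<open>The constant 20 is 5 from the gradients, times 2 for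
    \<open>N powr x \<le> 2 * m\<close>, times 2 for \<open>a * N \<le> 2 * n\<close>. The 4 pays
    for adding up partial products and for rounding.\<close>
  define B where "B = nat \<lceil>(20 * C + 4) * real n powr (\<tau> - x)\<rceil>"
  have ge1: "1 \<le> real n powr (\<tau> - x)" using assms by (intro ge_one_powr_ge_zero) auto
  have B_ge: "(20 * C + 4) * real n powr (\<tau> - x) \<le> real B" unfolding B_def by linarith
  have "real B \<le> (20 * C + 4) * real n powr (\<tau> - x) + 1"
    unfolding B_def using assms ge1 by (simp add: of_nat_nat ceiling_le_iff)
  then have B_le: "real B \<le> (20 * C + 5) * real n powr (\<tau> - x)" using ge1 by (simp add: algebra_simps)
  have perm: "matmul_cost ?T c (npow N y) N (npow N x)" "matmul_cost ?T c (npow N y) (npow N x) N"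
      "matmul_cost ?T c (npow N x) (npow N y) N"
    if N: "1 \<le> N" and c5: "real c \<ge> 5 * C * real N powr \<tau>" for N c
  proof -
    obtain p :: "'a prog" where p: "multiplies N (npow N y) (npow N x) p" "real (cost p) \<le> C * real N powr \<tau>"
      using prog[OF N] by auto
    then have "real (5 * cost p) \<le> real c" using c5 by simp
    then have c: "5 * cost p \<le> c" "cost p \<le> c" by linarith+
    show "matmul_cost ?T c (npow N y) N (npow N x)"
      by (rule matmul_cost_mono[OF matmul_cost_right_gradient[OF p(1)] c(1)]) auto
    show "matmul_cost ?T c (npow N y) (npow N x) N"
      by (rule matmul_cost_mono[OF matmul_cost_transpose[OF matmul_cost_left_gradient[OF p(1)]] c(1)]) auto
    show "matmul_cost ?T c (npow N x) (npow N y) N"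
      by (rule matmul_cost_mono[OF matmul_cost_transpose[OF matmul_cost_program[OF p(1)]] c(2)]) auto
  qed
  let ?X = "npow n x" and ?Y = "npow n y"
  have X1: "1 \<le> ?X" and XY: "?X \<le> ?Y"
    using assms npow_ge_1 npow_mono by auto
  have X2: "real n powr \<tau> \<le> 2 * real ?X * real n powr (\<tau> - x)"
  proof -
    have "real n powr \<tau> = real n powr x * real n powr (\<tau> - x)" by (simp add: powr_add[symmetric])
    also have "\<dots> \<le> 2 * real ?X * real n powr (\<tau> - x)"
      using npow_ge[of n x] assms by (intro mult_right_mono) auto
    finally show ?thesis .
  qed
  have "5 * C * real n powr \<tau> \<le> real (?X * B)"
  proof -
    have "5 * C * real n powr \<tau> \<le> 5 * C * (2 * real ?X * real n powr (\<tau> - x))"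
      using X2 assms by (intro mult_left_mono) auto
    also have "\<dots> = real ?X * (10 * C * real n powr (\<tau> - x))" by simp
    also have "\<dots> \<le> real ?X * ((20 * C + 4) * real n powr (\<tau> - x))"
      using assms by (intro mult_left_mono mult_right_mono) auto
    also have "\<dots> \<le> real ?X * real B" using B_ge by (intro mult_left_mono) auto
    finally show ?thesis by simp
  qed
  note big = perm[OF assms(7) this]
  have nY: "n * ?Y \<le> ?X * B"
  proof -
    have "real (n * ?Y) \<le> real n powr 1 * real n powr y"
      using npow_le[of n y] assms by (simp add: mult_left_mono)
    also have "\<dots> = real n powr (1 + y)" by (rule powr_add[symmetric])
    also have "\<dots> \<le> real n powr \<tau>" using assms by (intro powr_mono) auto
    also have "\<dots> \<le> real ?X * (2 * real n powr (\<tau> - x))" using X2 by simp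
    also have "\<dots> \<le> real ?X * ((20 * C + 4) * real n powr (\<tau> - x))"
      using assms by (intro mult_left_mono mult_right_mono) auto
    also have "\<dots> \<le> real ?X * real B" using B_ge by (intro mult_left_mono) auto
    finally show ?thesis by (metis of_nat_le_iff of_nat_mult)
  qed
  have small: "matmul_cost ?T (m * B) m n m \<and> matmul_cost ?T (m * B) m m n" if m: "1 \<le> m" "m \<le> ?X" for m
  proof -
    \<comment> \<open>Minimality implies \<open>(N - 1) powr x \<le> m\<close>, and doubling
      \<open>N - 1\<close> costs at most a factor 2 as \<open>x \<le> 1\<close>.\<close>
    define N where "N = (LEAST N. 1 \<le> N \<and> m \<le> npow N x)"
    have "1 \<le> n \<and> m \<le> npow n x" using assms m by simp
    then have N: "1 \<le> N" "m \<le> npow N x" "N \<le> n"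
      using LeastI[of "\<lambda>N. 1 \<le> N \<and> m \<le> npow N x" n] Least_le[of "\<lambda>N. 1 \<le> N \<and> m \<le> npow N x" n]
      unfolding N_def by auto
    have Nx: "real N powr x \<le> 2 * real m"
    proof (cases "N = 1")
      case True
      then show ?thesis using m by simp
    next
      case False
      then have "1 \<le> N - 1" "N - 1 < N" using N by auto
      then have "npow (N - 1) x < m"
        using not_less_Least[of "N - 1" "\<lambda>N. 1 \<le> N \<and> m \<le> npow N x"] unfolding N_def by auto
      then have lt: "real (N - 1) powr x \<le> real m"
        unfolding npow_def using m by (simp add: nat_less_iff floor_less_iff)
      have "real N powr x \<le> (2 * real (N - 1)) powr x"
        using \<open>1 \<le> N - 1\<close> assms by (intro powr_mono2) auto
      also have "\<dots> = 2 powr x * real (N - 1) powr x" by (simp add: powr_mult)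
      also have "\<dots> \<le> 2 powr 1 * real m" using lt assms by (intro mult_mono powr_mono) auto
      finally show ?thesis by simp
    qed
    have mN: "real m \<le> real N"
    proof -
      have "real m \<le> real N powr x" using N(2) npow_le[of N x] by linarith
      also have "\<dots> \<le> real N powr 1" using assms N(1) by (intro powr_mono) auto
      finally show ?thesis using N(1) by simp
    qed
    define a where "a = n div N + 1"
    have a: "n \<le> a * N" unfolding a_def using dividend_less_div_times[of N n] N(1) by (simp add: algebra_simps)
    have a2: "real a * real N \<le> 2 * real n"
    proof -
      have "n div N * N \<le> n" by simp
      then have "a * N \<le> 2 * n" unfolding a_def distrib_right using N(3) by linarith
      then show ?thesis by (metis of_nat_le_iff of_nat_mult of_nat_numeral)
    qed
    define c where "c = nat \<lceil>5 * C * real N powr \<tau>\<rceil>"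
    have c: "5 * C * real N powr \<tau> \<le> real c" "real c \<le> 5 * C * real N powr \<tau> + 1"
      unfolding c_def using assms by (simp_all add: of_nat_nat)
    note mm = perm[OF N(1) c(1)]
    have "real N powr \<tau> = real N * (real N powr (\<tau> - 1 - x) * real N powr x)"
      using N(1) by (simp add: powr_add[symmetric] powr_mult_base)
    also have "\<dots> \<le> real N * (real n powr (\<tau> - 1 - x) * (2 * real m))"
      using N assms Nx by (intro mult_left_mono mult_mono powr_mono2) auto
    finally have "real a * real N powr \<tau> \<le> (real a * real N) * (real n powr (\<tau> - 1 - x) * (2 * real m))"
      by (simp add: mult_left_mono mult.assoc)
    also have "\<dots> \<le> (2 * real n) * (real n powr (\<tau> - 1 - x) * (2 * real m))"
      using a2 by (intro mult_right_mono) auto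
    also have "\<dots> = 4 * real m * (real n powr 1 * real n powr (\<tau> - 1 - x))" using assms by simp
    also have "\<dots> = 4 * real m * real n powr (\<tau> - x)" by (simp only: powr_add[symmetric]) simp
    finally have "real a * real N powr \<tau> \<le> 4 * real m * real n powr (\<tau> - x)" .
    from mult_left_mono[OF this, of "5 * C"]
    have 1: "real a * (5 * C * real N powr \<tau>) \<le> 20 * C * (real m * real n powr (\<tau> - x))"
      using assms(4) by (simp add: ac_simps)
    have "real n powr 1 \<le> real n powr (\<tau> - x)" using assms by (intro powr_mono) auto
    then have n: "real n \<le> real n powr (\<tau> - x)" using assms by simp
    have "real a * (1 + real m * real m) \<le> real a * (2 * (real m * real m))"
      using m(1) mult_mono[of 1 "real m" 1 "real m"] by (intro mult_left_mono) auto
    also have "\<dots> \<le> real a * (2 * (real N * real m))"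
      using mN by (intro mult_left_mono mult_right_mono) auto
    also have "\<dots> \<le> 2 * (2 * real n) * real m"
      using a2 mult_right_mono[OF a2, of "2 * real m"] by (simp add: ac_simps)
    also have "\<dots> \<le> 4 * (real m * real n powr (\<tau> - x))"
      using mult_left_mono[OF n, of "real m"] by (simp add: ac_simps)
    finally have 2: "real a * (1 + real m * real m) \<le> 4 * (real m * real n powr (\<tau> - x))" .
    have "real (a * (c + m * m)) \<le> real a * (5 * C * real N powr \<tau>) + real a * (1 + real m * real m)"
      using mult_left_mono[OF c(2), of "real a"] by (simp add: algebra_simps)
    also have "\<dots> \<le> real m * ((20 * C + 4) * real n powr (\<tau> - x))"
      using 1 2 by (simp add: algebra_simps)
    also have "\<dots> \<le> real (m * B)" using B_ge by (simp add: mult_left_mono)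
    finally have key: "a * (c + m * m) \<le> m * B" by (simp only: of_nat_le_iff)
    have "npow N x \<le> npow N y" using N(1) assms by (intro npow_mono)
    then have "m \<le> npow N y" using N(2) by simp
    have "matmul_cost ?T (a * (c + m * m)) m (a * N) m"
      by (rule matmul_cost_mid, rule matmul_cost_mono[OF mm(1)]) (use N(2) \<open>m \<le> npow N y\<close> in auto)
    then have "matmul_cost ?T (m * B) m n m"
      by (rule matmul_cost_mono) (use key a in auto)
    moreover have "matmul_cost ?T (a * c) m m (a * N)"
      by (rule matmul_cost_cols, rule matmul_cost_mono[OF mm(3)]) (use N(2) \<open>m \<le> npow N y\<close> in auto)
    then have "matmul_cost ?T (m * B) m m n"
      by (rule matmul_cost_mono) (use key a in \<open>auto simp: distrib_left\<close>)
    ultimately show ?thesis ..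
  qed
  show ?thesis using X1 XY nY small big B_le unfolding good_def by blast
qed

subsection \<open>Inversion without branching\<close>

lemma mprod_assoc:
  assumes "finite J" and "finite K"
  shows "mprod J (mprod K A B) C = mprod K A (mprod J B C)"
proof (intro ext)
  fix i h e
  have "mprod J (mprod K A B) C i h e = (\<Sum>j\<in>J. \<Sum>k\<in>K. A i k e * B k j e * C j h e)"
    by (simp add: mprod_def sum_distrib_right)
  also have "\<dots> = (\<Sum>k\<in>K. \<Sum>j\<in>J. A i k e * B k j e * C j h e)" by (rule sum.swap)
  also have "\<dots> = mprod K A (mprod J B C) i h e"
    by (simp add: mprod_def sum_distrib_left mult.assoc)
  finally show "mprod J (mprod K A B) C i h e = mprod K A (mprod J B C) i h e" .
qed

text \<open>\<open>lowrank_mult H R M U V\<close> is \<open>M (1 + U V)\<close>, where \<open>U\<close> is an \<open>H \<times> R\<close> matrix and \<open>V\<close> an \<open>R \<times> H\<close> matrix.\<close>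

definition lowrank_mult ::
  "nat set \<Rightarrow> nat set \<Rightarrow> (nat \<Rightarrow> nat \<Rightarrow> 'e \<Rightarrow> 'a::field) \<Rightarrow> (nat \<Rightarrow> nat \<Rightarrow> 'e \<Rightarrow> 'a) \<Rightarrow>
   (nat \<Rightarrow> nat \<Rightarrow> 'e \<Rightarrow> 'a) \<Rightarrow> nat \<Rightarrow> nat \<Rightarrow> 'e \<Rightarrow> 'a" where
  "lowrank_mult H R M U V = (\<lambda>i j e. M i j e + mprod R (mprod H M U) V i j e)"

definition rows_independent :: "nat set \<Rightarrow> (nat \<Rightarrow> nat \<Rightarrow> 'e \<Rightarrow> 'a::field) \<Rightarrow> 'e \<Rightarrow> bool" where
  "rows_independent H M e \<longleftrightarrow>
     (\<forall>x. (\<forall>j\<in>H. (\<Sum>i\<in>H. x i * M i j e) = 0) \<longrightarrow> (\<forall>i\<in>H. x i = 0))"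

definition unit_rows :: "nat set \<Rightarrow> nat set \<Rightarrow> (nat \<Rightarrow> nat \<Rightarrow> 'e \<Rightarrow> 'a::field) \<Rightarrow> 'e \<Rightarrow> bool" where
  "unit_rows H P M e \<longleftrightarrow> (\<forall>i\<in>P. \<forall>j\<in>H. M i j e = (if i = j then 1 else 0))"

text \<open>Column operations, collected in the factor \<open>1 + U V\<close>, turn the rows
  \<open>R\<close> into unit rows. If the rows \<open>P\<close> already are unit rows, the rows
  \<open>P\<close> of \<open>M U\<close> are those of \<open>U\<close>, hence zero, and the unit
  rows survive. That \<open>U\<close> and \<open>V\<close> are computed from the rows
  \<open>R\<close> alone keeps the recursion cheap.\<close>

definition eliminates ::
  "'e set \<Rightarrow> nat set \<Rightarrow> nat set \<Rightarrow> nat set \<Rightarrow> (nat \<Rightarrow> nat \<Rightarrow> 'e \<Rightarrow> 'a::field) \<Rightarrow> nat \<Rightarrow> bool" where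
  "eliminates D H P R M c \<longleftrightarrow> (\<exists>U V. knows D (ent M R H) c (ent U H R \<union> ent V R H) \<and>
     (\<forall>e\<in>D. (\<forall>i\<in>P. \<forall>r\<in>R. U i r e = 0) \<and> unit_rows H R (lowrank_mult H R M U V) e \<and>
        rows_independent H (lowrank_mult H R M U V) e))"

text \<open>The zero tests \<open>a j / a j\<close> select one nonzero entry of \<open>a\<close> without branching.\<close>

lemma knows_selector:
  assumes "distinct xs" and "\<And>e. e \<in> D \<Longrightarrow> c e = 0 \<or> c e = 1"
  shows "\<exists>f :: nat \<Rightarrow> 'e \<Rightarrow> 'a::field. knows D (a ` set xs \<union> {c}) (3 * length xs) (f ` set xs) \<and>
    (\<forall>e\<in>D. (c e = 0 \<longrightarrow> (\<forall>j\<in>set xs. f j e = 0)) \<and>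
       (c e = 1 \<longrightarrow> (\<forall>j\<in>set xs. a j e = 0) \<or>
          (\<exists>j\<in>set xs. a j e \<noteq> 0 \<and> (\<forall>k\<in>set xs. f k e = (if k = j then 1 else 0)))))"
  using assms
proof (induction xs arbitrary: c)
  case Nil
  then show ?case by (auto intro: knows_refl)
next
  case (Cons x xs)
  define g where "g = (\<lambda>e. c e * (a x e / a x e))"
  define c' where "c' = (\<lambda>e. c e - g e)"
  have c': "c' e = 0 \<or> c' e = 1" if "e \<in> D" for e
    using Cons.prems(2)[OF that] by (auto simp: c'_def g_def)
  from Cons.prems(1) have "distinct xs" by simp
  from Cons.IH[of c', OF this c'] obtain f where
    f: "knows D (a ` set xs \<union> {c'}) (3 * length xs) (f ` set xs)" and
    f': "\<And>e. e \<in> D \<Longrightarrow> (c' e = 0 \<longrightarrow> (\<forall>j\<in>set xs. f j e = 0)) \<and>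
       (c' e = 1 \<longrightarrow> (\<forall>j\<in>set xs. a j e = 0) \<or>
          (\<exists>j\<in>set xs. a j e \<noteq> 0 \<and> (\<forall>k\<in>set xs. f k e = (if k = j then 1 else 0))))"
    by blast
  let ?V = "a ` set (x # xs) \<union> {c}" and ?f = "f(x := g)"
  have "knows D ?V (0 + (0 + 0 + 1) + 1) {g}"
    unfolding g_def by (intro knows_mul' knows_div' knows_member) auto
  moreover have "knows D (?V \<union> {g}) 1 {c'}"
    unfolding c'_def by (rule knows_sub) auto
  ultimately have "knows D ?V 3 {g, c'}"
    by (rule knows_trans') auto
  moreover have "knows D (?V \<union> {g, c'}) (3 * length xs) (f ` set xs)"
    by (rule knows_mono[OF f]) auto
  ultimately have "knows D ?V (3 * length (x # xs)) (?f ` set (x # xs))"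
    by (rule knows_trans') auto
  moreover have "(c e = 0 \<longrightarrow> (\<forall>j\<in>set (x # xs). ?f j e = 0)) \<and>
       (c e = 1 \<longrightarrow> (\<forall>j\<in>set (x # xs). a j e = 0) \<or>
          (\<exists>j\<in>set (x # xs). a j e \<noteq> 0 \<and> (\<forall>k\<in>set (x # xs). ?f k e = (if k = j then 1 else 0))))"
    if e: "e \<in> D" for e
  proof -
    have x: "x \<notin> set xs" using Cons.prems(1) by simp
    consider "c e = 0" | "c e = 1" "a x e = 0" | "c e = 1" "a x e \<noteq> 0"
      using Cons.prems(2)[OF e] by blast
    then show ?thesis
    proof cases
      case 1
      then have "g e = 0" "c' e = 0" by (auto simp: g_def c'_def)
      then show ?thesis using f'[OF e] 1 by auto
    next
      case 2
      then have g: "g e = 0" "c' e = 1" by (auto simp: g_def c'_def)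
      show ?thesis
      proof (cases "\<forall>j\<in>set xs. a j e = 0")
        case True
        then show ?thesis using 2 by auto
      next
        case False
        then obtain j where "j \<in> set xs" "a j e \<noteq> 0" "\<forall>k\<in>set xs. f k e = (if k = j then 1 else 0)"
          using f'[OF e] g by blast
        then show ?thesis using 2 g x by (intro conjI impI disjI2 bexI[of _ j]) auto
      qed
    next
      case 3
      then have g: "g e = 1" "c' e = 0" by (auto simp: g_def c'_def)
      then have "\<forall>j\<in>set xs. f j e = 0" using f'[OF e] by blast
      then show ?thesis using 3 g x by (intro conjI impI disjI2 bexI[of _ x]) auto
    qed
  qed
  ultimately show ?case by blast
qed

lemma eliminates_mono:
  assumes "eliminates D H P R M c" and "c \<le> c'"
  shows "eliminates D H P R M c'"
  using assms(1) knows_mono[OF _ subset_refl subset_refl assms(2) subset_refl]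
  unfolding eliminates_def by blast

text \<open>Let \<open>a\<close> be row \<open>i\<close> and \<open>e_i\<close> the unit row. With a
  column \<open>u\<close> that is zero on \<open>P\<close>, has \<open>u_i = 1\<close> and makes
  \<open>s = a u\<close> nonzero, put \<open>v = (e_i - a) / s\<close>. Then row \<open>i\<close> of
  \<open>M (1 + u v)\<close> is \<open>e_i\<close>, and \<open>1 + u v\<close> is regular since
  \<open>1 + v u = 1 / s\<close>. The column \<open>u\<close> is \<open>e_i\<close> if
  \<open>a_i\<close> is nonzero, and otherwise has one further entry 1, at a nonzero entry of
  \<open>a\<close> outside \<open>P\<close>.\<close>

lemma eliminates_single:
  assumes H: "finite H" "i \<in> H" "P \<subseteq> H" "i \<notin> P"
    and P: "\<And>e. e \<in> D \<Longrightarrow> unit_rows H P M e" and ind: "\<And>e. e \<in> D \<Longrightarrow> rows_independent H M e"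
  shows "eliminates D H P {i} M (9 * card H)"
proof -
  let ?S = "H - P - {i}" and ?a = "M i" and ?V = "ent M {i} H"
  \<comment> \<open>The flag is 1 exactly if entry \<open>i\<close> is zero, so that another entry
    has to be selected.\<close>
  define c where "c = (\<lambda>e. 1 - ?a i e / ?a i e)"
  obtain xs where xs: "set xs = ?S" "distinct xs" using finite_distinct_list[of ?S] H by auto
  have "c e = 0 \<or> c e = 1" for e by (simp add: c_def)
  from knows_selector[of xs D c ?a, OF xs(2) this] obtain f where
    f: "knows D (?a ` ?S \<union> {c}) (3 * length xs) (f ` ?S)" and
    f': "\<And>e. e \<in> D \<Longrightarrow> (c e = 0 \<longrightarrow> (\<forall>j\<in>?S. f j e = 0)) \<and>
       (c e = 1 \<longrightarrow> (\<forall>j\<in>?S. ?a j e = 0) \<or>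
          (\<exists>j\<in>?S. ?a j e \<noteq> 0 \<and> (\<forall>k\<in>?S. f k e = (if k = j then 1 else 0))))"
    unfolding xs(1) by blast
  define u where "u = (\<lambda>j. if j \<in> P then (\<lambda>_. 0) else if j = i then (\<lambda>_. 1) else f j)"
  define s where "s = (\<lambda>e. \<Sum>j\<in>H. ?a j e * u j e)"
  define v where "v = (\<lambda>j e. ((if i = j then 1 else 0) - ?a j e) / s e)"
  define U where "U = (\<lambda>k (r::nat). u k)"
  define V where "V = (\<lambda>r::nat. v)"
  have H1: "1 \<le> card H" using H by (metis One_nat_def Suc_leI card_gt_0_iff empty_iff)
  have len: "length xs \<le> card H"
    using xs H by (metis Diff_subset card_mono distinct_card finite_Diff2 Diff_Diff_Int le_infI1 subset_trans)
  have "knows D ?V (0 + (0 + 0 + 1) + 1) {c}"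
    unfolding c_def by (intro knows_sub' knows_div' knows_const knows_member) (use H in auto)
  moreover have "knows D (?V \<union> {c}) (3 * length xs) (f ` ?S)"
    by (rule knows_mono[OF f]) auto
  ultimately have "knows D ?V (2 + 3 * length xs) (f ` ?S)"
    by (rule knows_trans') auto
  moreover have "knows D (?V \<union> f ` ?S) 0 (u ` H)"
  proof (rule knows_set)
    fix g assume "g \<in> u ` H"
    then consider "g = (\<lambda>_. 0)" | "g = (\<lambda>_. 1)" | "g \<in> f ` ?S" by (auto simp: u_def)
    then show "knows D (?V \<union> f ` ?S) 0 {g}" by cases (simp_all add: knows_const knows_member)
  qed (use H in auto)
  ultimately have u: "knows D ?V (2 + 3 * length xs) (u ` H)"
    by (rule knows_trans') auto
  moreover have "knows D (?V \<union> u ` H) (card H * (1 + 1)) {s}"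
    unfolding s_def by (rule knows_sum[OF H(1)]) (rule knows_mul, auto)
  ultimately have us: "knows D ?V (2 + 3 * length xs + 2 * card H) (u ` H \<union> {s})"
    by (rule knows_trans') auto
  moreover have "knows D (?V \<union> (u ` H \<union> {s})) (card H * (0 + 0 + 1 + 0 + 1)) (v ` H)"
    unfolding v_def
    by (intro knows_image[OF H(1)] knows_div' knows_sub' knows_const knows_member) auto
  ultimately have "knows D ?V (9 * card H) (ent U H {i} \<union> ent V {i} H)"
    by (rule knows_trans') (use len H1 in \<open>auto simp: U_def V_def\<close>)
  moreover have "(\<forall>k\<in>P. \<forall>r\<in>{i}. U k r e = 0) \<and> unit_rows H {i} (lowrank_mult H {i} M U V) e \<and>
        rows_independent H (lowrank_mult H {i} M U V) e" if e: "e \<in> D" for e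
  proof -
    have aP: "M k j e = (if k = j then 1 else 0)" if "k \<in> P" "j \<in> H" for k j
      using P[OF e] that by (auto simp: unit_rows_def)
    \<comment> \<open>Otherwise row \<open>i\<close> would be a linear combination of the unit rows
      \<open>P\<close>.\<close>
    have nz: "\<exists>j\<in>H - P. ?a j e \<noteq> 0"
    proof (rule ccontr)
      assume *: "\<not> ?thesis"
      define x where "x = (\<lambda>k. if k = i then 1 else if k \<in> P then - ?a k e else 0)"
      have "(\<Sum>k\<in>H. x k * M k j e) = 0" if j: "j \<in> H" for j
      proof -
        have "(\<Sum>k\<in>H. x k * M k j e) = M i j e + (\<Sum>k\<in>H - {i}. x k * M k j e)"
          using H by (subst sum.remove[of H i]) (auto simp: x_def)
        also have "(\<Sum>k\<in>H - {i}. x k * M k j e) = (\<Sum>k\<in>H - {i}. if k = j then (if j \<in> P then - ?a j e else 0) else 0)"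
          by (rule sum.cong) (use aP j in \<open>auto simp: x_def\<close>)
        also have "\<dots> = (if j \<in> P then - ?a j e else 0)"
          using H j by auto
        also have "M i j e + \<dots> = 0" using * j by auto
        finally show ?thesis .
      qed
      then have "x i = 0" using ind[OF e] H unfolding rows_independent_def by blast
      then show False by (simp add: x_def)
    qed
    have s0: "s e \<noteq> 0"
    proof -
      have s: "s e = ?a i e + (\<Sum>j\<in>?S. ?a j e * f j e)"
      proof -
        have "s e = (\<Sum>j\<in>H - P. ?a j e * u j e)"
          unfolding s_def by (rule sum.mono_neutral_right) (use H in \<open>auto simp: u_def\<close>)
        also have "\<dots> = ?a i e * u i e + (\<Sum>j\<in>?S. ?a j e * u j e)"
          using H by (intro sum.remove) auto
        also have "\<dots> = ?a i e + (\<Sum>j\<in>?S. ?a j e * f j e)"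
          using H by (intro arg_cong2[of _ _ _ _ "(+)"] sum.cong) (auto simp: u_def)
        finally show ?thesis .
      qed
      show ?thesis
      proof (cases "?a i e = 0")
        case True
        then have "c e = 1" by (simp add: c_def)
        moreover have "\<exists>j\<in>?S. ?a j e \<noteq> 0" using nz True by auto
        ultimately obtain j where j: "j \<in> ?S" "?a j e \<noteq> 0" "\<forall>k\<in>?S. f k e = (if k = j then 1 else 0)"
          using f'[OF e] by blast
        have "(\<Sum>k\<in>?S. ?a k e * f k e) = (\<Sum>k\<in>?S. if k = j then ?a j e else 0)"
          by (rule sum.cong) (use j in auto)
        also have "\<dots> = ?a j e" using j H by simp
        finally show ?thesis using s True j by simp
      next
        case False
        then have "c e = 0" by (simp add: c_def)
        then have "\<forall>j\<in>?S. f j e = 0" using f'[OF e] by blast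
        then show ?thesis using s False by simp
      qed
    qed
    have ui: "u i e = 1" using H by (simp add: u_def)
    have L: "lowrank_mult H {i} M U V k j e = M k j e + (\<Sum>h\<in>H. M k h e * u h e) * v j e" for k j
      by (simp add: lowrank_mult_def mprod_def U_def V_def)
    have "unit_rows H {i} (lowrank_mult H {i} M U V) e"
      using s0 by (auto simp: unit_rows_def L s_def[symmetric, THEN fun_cong, simplified] v_def)
    moreover have "rows_independent H (lowrank_mult H {i} M U V) e"
      unfolding rows_independent_def
    proof (intro allI impI)
      fix x assume x: "\<forall>j\<in>H. (\<Sum>k\<in>H. x k * lowrank_mult H {i} M U V k j e) = 0"
      define y where "y = (\<lambda>j. \<Sum>k\<in>H. x k * M k j e)"
      \<comment> \<open>With \<open>y = x M\<close>, the hypothesis says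
        \<open>y = - \<beta> v\<close> where \<open>\<beta> = y u\<close>. Multiplication by
        \<open>u\<close> gives \<open>\<beta> = - \<beta> (1 - s) / s\<close>, hence
        \<open>\<beta> = 0\<close>.\<close>
      define \<beta> where "\<beta> = (\<Sum>h\<in>H. y h * u h e)"
      have "(\<Sum>k\<in>H. x k * (\<Sum>h\<in>H. M k h e * u h e)) = \<beta>"
        unfolding \<beta>_def y_def sum_distrib_left sum_distrib_right
        by (subst sum.swap) (simp add: mult.assoc)
      then have "(\<Sum>k\<in>H. x k * lowrank_mult H {i} M U V k j e) = y j + \<beta> * v j e" for j
        by (simp add: L distrib_left sum.distrib y_def mult.assoc[symmetric] sum_distrib_right[symmetric])
      then have y: "y j = - \<beta> * v j e" if "j \<in> H" for j
        using x that by (simp add: eq_neg_iff_add_eq_0)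
      have "(\<Sum>j\<in>H. v j e * u j e) = (\<Sum>j\<in>H. ((if j = i then u i e else 0) - ?a j e * u j e)) / s e"
        unfolding v_def sum_divide_distrib by (rule sum.cong) (auto simp: field_simps)
      also have "\<dots> = (1 - s e) / s e"
        using H ui by (simp add: sum_subtractf s_def)
      finally have vu: "(\<Sum>j\<in>H. v j e * u j e) = (1 - s e) / s e" .
      have "\<beta> = (\<Sum>h\<in>H. - \<beta> * (v h e * u h e))"
        unfolding \<beta>_def by (rule sum.cong) (use y in \<open>auto simp: \<beta>_def\<close>)
      also have "\<dots> = - \<beta> * ((1 - s e) / s e)" by (simp only: sum_distrib_left[symmetric] vu)
      finally have "\<beta> = 0" using s0 by (simp add: field_simps)
      then have "\<forall>j\<in>H. (\<Sum>k\<in>H. x k * M k j e) = 0" using y by (auto simp: y_def)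
      then show "\<forall>k\<in>H. x k = 0" using ind[OF e] unfolding rows_independent_def by blast
    qed
    moreover have "U k r e = 0" if "k \<in> P" for k r using that by (simp add: U_def u_def)
    ultimately show ?thesis by blast
  qed
  ultimately show ?thesis unfolding eliminates_def by blast
qed

text \<open>Since \<open>(1 + U1 V1) (1 + U2 V2) = 1 + U1 V1 + (U2 + U1 V1 U2) V2\<close>, the two
  low-rank factors are simply put side by side. Of the intermediate matrix \<open>M1\<close> only
  the rows \<open>R2\<close> are formed. Four products and two additions account for
  \<open>6 * (m * B)\<close>.\<close>

lemma eliminates_Un:
  assumes H: "finite H" "P \<union> R1 \<union> R2 \<subseteq> H" "P \<inter> R1 = {}" "P \<inter> R2 = {}" "R1 \<inter> R2 = {}"
    and P: "\<And>e. e \<in> D \<Longrightarrow> unit_rows H P M e"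
    and elim1: "eliminates D H P R1 M c1"
    and elim2: "\<And>M :: nat \<Rightarrow> nat \<Rightarrow> 'e \<Rightarrow> 'a. (\<And>e. e \<in> D \<Longrightarrow> unit_rows H (P \<union> R1) M e) \<Longrightarrow>
      (\<And>e. e \<in> D \<Longrightarrow> rows_independent H M e) \<Longrightarrow> eliminates D H (P \<union> R1) R2 M c2"
    and m: "card R1 \<le> m" "card R2 \<le> m" "card H \<le> B"
    and mm: "matmul_cost (T :: ('e \<Rightarrow> 'a::field) itself) (m * B) m (card H) m" "matmul_cost T (m * B) m m (card H)"
  shows "eliminates D H P (R1 \<union> R2) (M :: nat \<Rightarrow> nat \<Rightarrow> 'e \<Rightarrow> 'a) (c1 + c2 + 6 * (m * B))"
proof -
  have fin: "finite R1" "finite R2" using H by (auto intro: finite_subset)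
  obtain U1 V1 where UV1: "knows D (ent M R1 H) c1 (ent U1 H R1 \<union> ent V1 R1 H)"
    and 1: "\<And>e i r. e \<in> D \<Longrightarrow> i \<in> P \<Longrightarrow> r \<in> R1 \<Longrightarrow> U1 i r e = 0"
      "\<And>e. e \<in> D \<Longrightarrow> unit_rows H R1 (lowrank_mult H R1 M U1 V1) e"
      "\<And>e. e \<in> D \<Longrightarrow> rows_independent H (lowrank_mult H R1 M U1 V1) e"
    using elim1 unfolding eliminates_def by blast
  define M1 where "M1 = lowrank_mult H R1 M U1 V1"
  have unit1: "unit_rows H (P \<union> R1) M1 e" if e: "e \<in> D" for e
  proof -
    have "mprod H M U1 i r e = 0" if "i \<in> P" "r \<in> R1" for i r
    proof -
      have "mprod H M U1 i r e = (\<Sum>k\<in>H. if k = i then U1 i r e else 0)"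
        unfolding mprod_def by (rule sum.cong) (use P[OF e] that in \<open>auto simp: unit_rows_def\<close>)
      then show ?thesis using 1(1)[OF e that] by (simp add: H(1))
    qed
    then have "M1 i j e = M i j e" if "i \<in> P" for i j
      using that by (simp add: M1_def lowrank_mult_def mprod_def[of R1])
    then show ?thesis using P[OF e] 1(2)[OF e] by (auto simp: unit_rows_def M1_def)
  qed
  have "eliminates D H (P \<union> R1) R2 M1 c2"
    by (rule elim2) (use unit1 1(3) in \<open>auto simp: M1_def\<close>)
  then obtain U2 V2 where UV2: "knows D (ent M1 R2 H) c2 (ent U2 H R2 \<union> ent V2 R2 H)"
    and 2: "\<And>e i r. e \<in> D \<Longrightarrow> i \<in> P \<union> R1 \<Longrightarrow> r \<in> R2 \<Longrightarrow> U2 i r e = 0"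
      "\<And>e. e \<in> D \<Longrightarrow> unit_rows H R2 (lowrank_mult H R2 M1 U2 V2) e"
      "\<And>e. e \<in> D \<Longrightarrow> rows_independent H (lowrank_mult H R2 M1 U2 V2) e"
    unfolding eliminates_def by blast
  define VU where "VU = mprod H V1 U2"
  define U where "U = (\<lambda>i r. if r \<in> R1 then U1 i r else (\<lambda>e. U2 i r e + mprod R1 U1 VU i r e))"
  define V where "V = (\<lambda>r. if r \<in> R1 then V1 r else V2 r)"
  have R12: "r \<notin> R1" if "r \<in> R2" for r using that H by auto
  let ?K = "ent M (R1 \<union> R2) H" and ?UV1 = "ent U1 H R1 \<union> ent V1 R1 H"
  have k1: "knows D ?K c1 ?UV1"
    by (rule knows_mono[OF UV1]) (auto simp: ent_subset_iff)
  have "knows D (?K \<union> ?UV1) (m * B) (ent (mprod H M U1) R2 R1)"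
    by (rule matmul_costD[OF mm(1)]) (use fin H m in \<open>auto simp: ent_subset_iff\<close>)
  moreover have "knows D (?K \<union> ?UV1 \<union> ent (mprod H M U1) R2 R1) (m * B) (ent (mprod R1 (mprod H M U1) V1) R2 H)"
    by (rule matmul_costD[OF mm(2)]) (use fin H m in \<open>auto simp: ent_subset_iff\<close>)
  ultimately have "knows D (?K \<union> ?UV1) (2 * (m * B)) (ent (mprod R1 (mprod H M U1) V1) R2 H)"
    by (rule knows_trans') auto
  moreover have "knows D (?K \<union> ?UV1 \<union> ent (mprod R1 (mprod H M U1) V1) R2 H) (m * B) (ent M1 R2 H)"
  proof (rule knows_mono)
    show "knows D (?K \<union> ?UV1 \<union> ent (mprod R1 (mprod H M U1) V1) R2 H) (card R2 * card H * 1) (ent M1 R2 H)"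
      unfolding M1_def lowrank_mult_def by (intro knows_ent fin H knows_add) auto
    show "card R2 * card H * 1 \<le> m * B" unfolding mult_1_right using m by (intro mult_le_mono)
  qed auto
  ultimately have "knows D (?K \<union> ?UV1) (3 * (m * B)) (ent M1 R2 H)"
    by (rule knows_trans') auto
  from knows_trans'[OF this knows_mono[OF UV2 subset_refl _ order_refl subset_refl] order_refl]
  have k2: "knows D (?K \<union> ?UV1) (3 * (m * B) + c2) (ent U2 H R2 \<union> ent V2 R2 H)" by auto
  let ?K2 = "?K \<union> ?UV1 \<union> (ent U2 H R2 \<union> ent V2 R2 H)"
  have "knows D ?K2 (m * B) (ent VU R1 R2)"
    unfolding VU_def by (rule matmul_costD[OF mm(1)]) (use fin H m in \<open>auto simp: ent_subset_iff\<close>)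
  moreover have "knows D (?K2 \<union> ent VU R1 R2) (m * B) (ent (mprod R1 U1 VU) H R2)"
    by (rule matmul_costD[OF matmul_cost_transpose[OF mm(2)]]) (use fin H m in \<open>auto simp: ent_subset_iff\<close>)
  ultimately have "knows D ?K2 (2 * (m * B)) (ent (mprod R1 U1 VU) H R2)"
    by (rule knows_trans') auto
  moreover have "knows D (?K2 \<union> ent (mprod R1 U1 VU) H R2) (m * B) (ent U H R2)"
  proof (rule knows_mono)
    show "knows D (?K2 \<union> ent (mprod R1 U1 VU) H R2) (card H * card R2 * 1) (ent U H R2)"
    proof (rule knows_ent[OF H(1) fin(2)])
      fix i r assume "i \<in> H" "r \<in> R2"
      then have "U i r = (\<lambda>e. U2 i r e + mprod R1 U1 VU i r e)" using R12 by (simp add: U_def)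
      moreover have "knows D (?K2 \<union> ent (mprod R1 U1 VU) H R2) 1 {\<lambda>e. U2 i r e + mprod R1 U1 VU i r e}"
        by (rule knows_add) (use \<open>i \<in> H\<close> \<open>r \<in> R2\<close> in auto)
      ultimately show "knows D (?K2 \<union> ent (mprod R1 U1 VU) H R2) 1 {U i r}" by simp
    qed
    show "card H * card R2 * 1 \<le> m * B"
      unfolding mult_1_right mult.commute[of "card H"] using m by (intro mult_le_mono)
  qed auto
  ultimately have "knows D ?K2 (3 * (m * B)) (ent U H R2)"
    by (rule knows_trans') auto
  with k2 have "knows D (?K \<union> ?UV1) (c2 + 6 * (m * B)) (ent U2 H R2 \<union> ent V2 R2 H \<union> ent U H R2)"
    by (rule knows_trans') auto
  with k1 have "knows D ?K (c1 + c2 + 6 * (m * B)) (?K \<union> ?UV1 \<union> (ent U2 H R2 \<union> ent V2 R2 H \<union> ent U H R2))"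
    by (rule knows_trans') auto
  moreover have "ent U H (R1 \<union> R2) \<union> ent V (R1 \<union> R2) H \<subseteq> ?K \<union> ?UV1 \<union> (ent U2 H R2 \<union> ent V2 R2 H \<union> ent U H R2)"
  proof -
    have "U i r = U1 i r" "V r = V1 r" if "r \<in> R1" for i r using that by (simp_all add: U_def V_def)
    moreover have "V r = V2 r" if "r \<in> R2" for r using R12[OF that] by (simp add: V_def)
    ultimately show ?thesis by auto
  qed
  ultimately have K: "knows D ?K (c1 + c2 + 6 * (m * B)) (ent U H (R1 \<union> R2) \<union> ent V (R1 \<union> R2) H)"
    by (rule_tac knows_mono) auto
  have "lowrank_mult H (R1 \<union> R2) M U V i j e = lowrank_mult H R2 M1 U2 V2 i j e" for i j e
  proof -
    have "mprod H M1 U2 i r e = mprod H M U i r e" if "r \<in> R2" for i r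
    proof -
      have "mprod H M1 U2 i r e = mprod H M U2 i r e + mprod H (mprod R1 (mprod H M U1) V1) U2 i r e"
        by (simp add: M1_def lowrank_mult_def mprod_def[of H] distrib_right sum.distrib)
      also have "mprod H (mprod R1 (mprod H M U1) V1) U2 = mprod H M (mprod R1 U1 VU)"
        using fin H by (simp add: mprod_assoc VU_def)
      also have "mprod H M U2 i r e + mprod H M (mprod R1 U1 VU) i r e = mprod H M U i r e"
        using R12[OF that] by (simp add: mprod_def[of H] U_def distrib_left sum.distrib)
      finally show ?thesis .
    qed
    then have "mprod R2 (mprod H M1 U2) V2 i j e = mprod R2 (mprod H M U) V i j e"
      by (simp add: mprod_def[of R2] V_def R12)
    moreover have "mprod R1 (mprod H M U1) V1 i j e = mprod R1 (mprod H M U) V i j e"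
      by (simp add: mprod_def U_def V_def)
    moreover have "mprod (R1 \<union> R2) (mprod H M U) V i j e
        = mprod R1 (mprod H M U) V i j e + mprod R2 (mprod H M U) V i j e"
      using fin H by (simp add: mprod_def[of "R1 \<union> R2"] mprod_def[of R1] mprod_def[of R2] sum.union_disjoint)
    ultimately show ?thesis by (simp add: lowrank_mult_def M1_def)
  qed
  then have L: "lowrank_mult H (R1 \<union> R2) M U V = lowrank_mult H R2 M1 U2 V2" by blast
  have "unit_rows H (R1 \<union> R2) (lowrank_mult H R2 M1 U2 V2) e" if e: "e \<in> D" for e
  proof -
    have "mprod H M1 U2 i r e = 0" if "i \<in> R1" "r \<in> R2" for i r
    proof -
      have "mprod H M1 U2 i r e = (\<Sum>k\<in>H. if k = i then U2 i r e else 0)"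
        unfolding mprod_def by (rule sum.cong) (use unit1[OF e] that in \<open>auto simp: unit_rows_def\<close>)
      then show ?thesis using 2(1)[OF e _ that(2), of i] that by (simp add: H(1))
    qed
    then have "lowrank_mult H R2 M1 U2 V2 i j e = M1 i j e" if "i \<in> R1" for i j
      using that by (simp add: lowrank_mult_def mprod_def[of R2])
    then show ?thesis using unit1[OF e] 2(2)[OF e] by (auto simp: unit_rows_def)
  qed
  moreover have "U i r e = 0" if "e \<in> D" "i \<in> P" "r \<in> R1 \<union> R2" for e i r
    using that 1(1) 2(1) by (auto simp: U_def mprod_def)
  ultimately show ?thesis
    unfolding eliminates_def using K L 2(3) by (intro exI[of _ U] exI[of _ V]) auto
qed

text \<open>\<open>R\<close> is halved \<open>j\<close> times. Each level costs \<open>6 * B\<close>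
  per row, and a single row costs \<open>9 * B\<close> in the end.\<close>

lemma eliminates_block:
  fixes M :: "nat \<Rightarrow> nat \<Rightarrow> 'e \<Rightarrow> 'a::field"
  assumes H: "finite H" "P \<union> R \<subseteq> H" "P \<inter> R = {}" and B: "card H \<le> B"
    and mm: "\<And>m. 1 \<le> m \<Longrightarrow> m \<le> card H \<Longrightarrow> matmul_cost (T :: ('e \<Rightarrow> 'a) itself) (m * B) m (card H) m \<and>
      matmul_cost T (m * B) m m (card H)"
    and P: "\<And>e. e \<in> D \<Longrightarrow> unit_rows H P M e" and ind: "\<And>e. e \<in> D \<Longrightarrow> rows_independent H M e"
    and "card R \<le> 2 ^ j"
  shows "eliminates D H P R M (card R * (6 * j + 9) * B)"
  using H(2,3) P ind \<open>card R \<le> 2 ^ j\<close>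
proof (induction j arbitrary: P R M)
  case 0
  have "finite R" using 0 H(1) by (auto intro: finite_subset)
  show ?case
  proof (cases "R = {}")
    case True
    then show ?thesis using 0(4)
      by (auto simp: eliminates_def unit_rows_def lowrank_mult_def mprod_def ent_def intro: knows_refl)
  next
    case False
    then have "card R = 1" using 0 \<open>finite R\<close> by (simp add: le_Suc_eq)
    then obtain i where i: "R = {i}" by (auto simp: card_1_singleton_iff)
    have "eliminates D H P {i} M (9 * card H)"
      by (rule eliminates_single) (use 0 H(1) i in auto)
    then show ?thesis
      unfolding i by (rule eliminates_mono) (use B in auto)
  qed
next
  case (Suc j)
  have fin: "finite R" using Suc.prems H(1) by (auto intro: finite_subset)
  show ?case
  proof (cases "card R \<le> 1")
    case True
    \<comment> \<open>Halving would not make such a set smaller, but the bound for \<open>j\<close>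
      already applies.\<close>
    then have "eliminates D H P R M (card R * (6 * j + 9) * B)"
      using Suc.IH[OF Suc.prems(1-4)] by (metis le_trans one_le_numeral one_le_power)
    then show ?thesis by (rule eliminates_mono) simp
  next
    case False
    define m where "m = (card R + 1) div 2"
    have "m \<le> card R" using False by (simp add: m_def)
    then obtain R1 where R1: "R1 \<subseteq> R" "card R1 = m" using obtain_subset_with_card_n by metis
    define R2 where "R2 = R - R1"
    have R2: "card R2 \<le> m" "R = R1 \<union> R2" "card R = card R1 + card R2" "R1 \<inter> R2 = {}"
      using R1 fin unfolding R2_def m_def
      by (auto simp: card_Diff_subset finite_subset card_mono)
    have mj: "m \<le> 2 ^ j" using Suc.prems(5) by (simp add: m_def)
    have "card R \<le> card H" using Suc.prems(1) H(1) by (intro card_mono) auto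
    then have m1: "1 \<le> m" "m \<le> card H" "m \<le> card R" using False by (auto simp: m_def)
    have "eliminates D H P (R1 \<union> R2) M
        (card R1 * (6 * j + 9) * B + card R2 * (6 * j + 9) * B + 6 * (m * B))"
    proof (rule eliminates_Un[OF H(1)])
      show "eliminates D H P R1 M (card R1 * (6 * j + 9) * B)"
        by (rule Suc.IH) (use Suc.prems R1 mj in auto)
      show "eliminates D H (P \<union> R1) R2 M' (card R2 * (6 * j + 9) * B)"
        if "\<And>e. e \<in> D \<Longrightarrow> unit_rows H (P \<union> R1) M' e" "\<And>e. e \<in> D \<Longrightarrow> rows_independent H M' e"
        for M' :: "nat \<Rightarrow> nat \<Rightarrow> 'e \<Rightarrow> 'a"
        by (rule Suc.IH) (use that Suc.prems R1 R2 mj in auto)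
      show "matmul_cost T (m * B) m (card H) m" "matmul_cost T (m * B) m m (card H)"
        using mm[OF m1(1,2)] by auto
    qed (use Suc.prems R1 R2 B in auto)
    moreover have "card R1 * (6 * j + 9) * B + card R2 * (6 * j + 9) * B + 6 * (m * B)
        \<le> card R * (6 * Suc j + 9) * B"
    proof -
      have "card R1 * (6 * j + 9) * B + card R2 * (6 * j + 9) * B = card R * (6 * j + 9) * B"
        by (simp add: R2(3) algebra_simps)
      moreover have "6 * (m * B) \<le> 6 * (card R * B)" using m1 by simp
      ultimately show ?thesis by (simp add: algebra_simps)
    qed
    ultimately show ?thesis unfolding R2(2)[symmetric] by (rule eliminates_mono)
  qed
qed

text \<open>Eliminating all rows gives \<open>M (1 + U V) = 1\<close>, so the inverse is
  \<open>1 + U V\<close>. The product and the addition of the identity raise 9 to 11.\<close>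

lemma knows_inverse:
  fixes M :: "nat \<Rightarrow> nat \<Rightarrow> 'e \<Rightarrow> 'a::field"
  assumes H: "finite H" "1 \<le> card H" and B: "card H \<le> B"
    and mm: "\<And>m. 1 \<le> m \<Longrightarrow> m \<le> card H \<Longrightarrow> matmul_cost (T :: ('e \<Rightarrow> 'a) itself) (m * B) m (card H) m \<and>
      matmul_cost T (m * B) m m (card H)"
    and right: "\<And>e i j. e \<in> D \<Longrightarrow> i \<in> H \<Longrightarrow> j \<in> H \<Longrightarrow> mprod H M X i j e = (if i = j then 1 else 0)"
    and left: "\<And>e i j. e \<in> D \<Longrightarrow> i \<in> H \<Longrightarrow> j \<in> H \<Longrightarrow> mprod H X M i j e = (if i = j then 1 else 0)"
    and "card H \<le> 2 ^ j"
  shows "knows D (ent M H H) (card H * (6 * j + 11) * B) (ent X H H)"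
proof -
  have "rows_independent H M e" if e: "e \<in> D" for e
    unfolding rows_independent_def
  proof (intro allI impI ballI)
    fix x i assume x: "\<forall>j\<in>H. (\<Sum>i\<in>H. x i * M i j e) = 0" and i: "i \<in> H"
    have "x i = (\<Sum>k\<in>H. if k = i then x k else 0)" using i H by simp
    also have "\<dots> = (\<Sum>k\<in>H. x k * mprod H M X k i e)"
      by (rule sum.cong) (use right[OF e _ i] in auto)
    also have "\<dots> = (\<Sum>j\<in>H. (\<Sum>k\<in>H. x k * M k j e) * X j i e)"
      unfolding mprod_def sum_distrib_left sum_distrib_right mult.assoc by (rule sum.swap)
    also have "\<dots> = 0" using x by simp
    finally show "x i = 0" .
  qed
  then have "eliminates D H {} H M (card H * (6 * j + 9) * B)"
    by (intro eliminates_block[OF H(1) _ _ B mm]) (use assms(7) in \<open>auto simp: unit_rows_def\<close>)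
  then obtain U V where UV: "knows D (ent M H H) (card H * (6 * j + 9) * B) (ent U H H \<union> ent V H H)"
    and unit: "\<And>e. e \<in> D \<Longrightarrow> unit_rows H H (lowrank_mult H H M U V) e"
    unfolding eliminates_def by blast
  define Y where "Y = (\<lambda>i j e. (if i = j then 1 else 0) + mprod H U V i j e)"
  have "X i j e = Y i j e" if e: "e \<in> D" and ij: "i \<in> H" "j \<in> H" for i j e
  proof -
    have XMU: "mprod H X (mprod H M Z) i k e = Z i k e" for Z k
    proof -
      have "mprod H X (mprod H M Z) i k e = mprod H (mprod H X M) Z i k e" using H by (simp add: mprod_assoc)
      also have "\<dots> = (\<Sum>h\<in>H. if h = i then Z i k e else 0)"
        unfolding mprod_def[of H "mprod H X M"] by (rule sum.cong) (use left[OF e ij(1)] in auto)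
      finally show ?thesis using ij H by simp
    qed
    have "X i j e = (\<Sum>k\<in>H. if k = j then X i k e else 0)" using ij H by simp
    also have "\<dots> = (\<Sum>k\<in>H. X i k e * lowrank_mult H H M U V k j e)"
      by (rule sum.cong) (use unit[OF e] ij in \<open>auto simp: unit_rows_def\<close>)
    also have "\<dots> = mprod H X M i j e + mprod H X (mprod H (mprod H M U) V) i j e"
      by (simp add: lowrank_mult_def mprod_def[of H X] distrib_left sum.distrib)
    also have "mprod H (mprod H M U) V = mprod H M (mprod H U V)" using H by (simp add: mprod_assoc)
    also have "mprod H X M i j e + mprod H X (mprod H M (mprod H U V)) i j e = Y i j e"
      by (simp add: XMU left[OF e ij] Y_def)
    finally show ?thesis .
  qed
  note XY = this
  have "knows D (ent U H H \<union> ent V H H) (card H * B) (ent (mprod H U V) H H)"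
    by (rule matmul_costD[OF mm[OF H(2) order_refl, THEN conjunct1]]) (use H in auto)
  moreover have "knows D (ent U H H \<union> ent V H H \<union> ent (mprod H U V) H H) (card H * B) (ent Y H H)"
  proof (rule knows_mono)
    show "knows D (ent U H H \<union> ent V H H \<union> ent (mprod H U V) H H) (card H * card H * (0 + 0 + 1)) (ent Y H H)"
      unfolding Y_def by (intro knows_ent H knows_add' knows_const knows_member) auto
    show "card H * card H * (0 + 0 + 1) \<le> card H * B" using B by simp
  qed auto
  ultimately have "knows D (ent U H H \<union> ent V H H) (2 * (card H * B)) (ent Y H H)"
    by (rule knows_trans') auto
  with UV have "knows D (ent M H H) (card H * (6 * j + 9) * B + 2 * (card H * B)) (ent Y H H)"
    by (rule knows_trans0) simp
  then have "knows D (ent M H H) (card H * (6 * j + 11) * B) (ent Y H H)"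
    by (simp add: algebra_simps)
  then show ?thesis by (rule knows_ent_cong) (use H XY in auto)
qed

subsection \<open>Rows of the inverse after column updates\<close>

definition inverse_family :: "'e set \<Rightarrow> nat \<Rightarrow> (nat \<Rightarrow> nat \<Rightarrow> 'e \<Rightarrow> 'a::field) \<Rightarrow> (nat \<Rightarrow> nat \<Rightarrow> 'e \<Rightarrow> 'a) \<Rightarrow> bool" where
  "inverse_family D n A N \<longleftrightarrow> (\<forall>e\<in>D. \<forall>i<n. \<forall>j<n.
     mprod {..<n} A N i j e = (if i = j then 1 else 0) \<and> mprod {..<n} N A i j e = (if i = j then 1 else 0))"

definition agree_off :: "'e set \<Rightarrow> nat \<Rightarrow> nat set \<Rightarrow> (nat \<Rightarrow> nat \<Rightarrow> 'e \<Rightarrow> 'a) \<Rightarrow> (nat \<Rightarrow> nat \<Rightarrow> 'e \<Rightarrow> 'a) \<Rightarrow> bool" where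
  "agree_off D n H A A' \<longleftrightarrow> (\<forall>e\<in>D. \<forall>i<n. \<forall>j<n. j \<notin> H \<longrightarrow> A i j e = A' i j e)"

lemma inverse_family_cancel:
  assumes "inverse_family D n A N" and "e \<in> D" and "i < n"
  shows "mprod {..<n} A (mprod {..<n} N Z) i k e = Z i k e"
    and "mprod {..<n} N (mprod {..<n} A Z) i k e = Z i k e"
proof -
  have "mprod {..<n} P (mprod {..<n} Q Z) i k e = Z i k e"
    if "\<And>j. j < n \<Longrightarrow> mprod {..<n} P Q i j e = (if i = j then 1 else 0)" for P Q
  proof -
    have "mprod {..<n} P (mprod {..<n} Q Z) i k e = mprod {..<n} (mprod {..<n} P Q) Z i k e"
      by (simp add: mprod_assoc)
    also have "\<dots> = (\<Sum>j<n. if j = i then Z i k e else 0)"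
      unfolding mprod_def[of _ "mprod _ P Q"] by (rule sum.cong) (use that in auto)
    finally show ?thesis using assms(3) by simp
  qed
  then show "mprod {..<n} A (mprod {..<n} N Z) i k e = Z i k e"
    "mprod {..<n} N (mprod {..<n} A Z) i k e = Z i k e"
    using assms unfolding inverse_family_def by auto
qed

text \<open>Outside the columns \<open>H\<close>, such a matrix contributes its diagonal entry only.
  This reduces products over all \<open>n\<close> indices to products over \<open>H\<close>.\<close>

lemma mprod_split_columns:
  assumes "H \<subseteq> {..<n}" and "i < n" and "k < n"
    and "\<And>j. j < n \<Longrightarrow> j \<notin> H \<Longrightarrow> P i j e = (if i = j then 1 else 0)"
  shows "mprod {..<n} P Z i k e = mprod H P Z i k e + (if i \<in> H then 0 else Z i k e)"
proof -
  have "mprod {..<n} P Z i k e = mprod H P Z i k e + (\<Sum>j\<in>{..<n} - H. P i j e * Z j k e)"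
    unfolding mprod_def using assms(1) by (subst sum.subset_diff[of H]) (auto simp: add.commute)
  also have "(\<Sum>j\<in>{..<n} - H. P i j e * Z j k e) = (\<Sum>j\<in>{..<n} - H. if j = i then Z i k e else 0)"
    by (rule sum.cong) (use assms(4) in auto)
  finally show ?thesis using assms(2) by simp
qed

text \<open>The matrices \<open>M = N A'\<close> and \<open>P = N' A\<close> are inverse to each
  other and both are the identity outside the columns \<open>H\<close>, so their blocks on
  \<open>H\<close> are inverse to each other as well. As \<open>N' = P N\<close>, the rows
  \<open>H\<close> of \<open>N'\<close> follow from those of \<open>N\<close>. The two products at
  the beginning and the end raise 11 to 13.\<close>

lemma knows_step_rows:
  fixes A A' N N' :: "nat \<Rightarrow> nat \<Rightarrow> 'e \<Rightarrow> 'a::field"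
  assumes good: "good (T :: ('e \<Rightarrow> 'a) itself) n X Y B" and H: "H \<subseteq> {..<n}" "card H \<le> X" "card H \<le> 2 ^ j"
    and inv: "inverse_family D n A N" "inverse_family D n A' N'" and off: "agree_off D n H A A'"
    and V: "ent N H {..<n} \<subseteq> V" "ent A' {..<n} H \<subseteq> V"
  shows "knows D V (card H * (6 * j + 13) * B) (ent N' H {..<n})"
proof (cases "card H = 0")
  case True
  then have "H = {}" using H(1) finite_subset by fastforce
  then show ?thesis by (auto simp: ent_def intro: knows_refl)
next
  case False
  define h where "h = card H"
  have fin: "finite H" using H(1) finite_subset by blast
  have h: "1 \<le> h" "h \<le> X" "h \<le> n" "h \<le> B"
    using False H card_mono[of "{..<n}" H] good_le[OF good] unfolding h_def by auto
  have mm: "matmul_cost T (m * B) m n m" "matmul_cost T (m * B) m m n" if "1 \<le> m" "m \<le> h" for m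
    using good that h(2) unfolding good_def by auto
  define M where "M = mprod {..<n} N A'"
  define P where "P = mprod {..<n} N' A"
  have 1: "knows D V (h * B) (ent M H H)"
    unfolding M_def by (rule matmul_costD[OF mm(1)[OF h(1) order_refl]]) (use fin V h_def in auto)
  have Pcol: "P i k e = (if i = k then 1 else 0)" if "e \<in> D" "i < n" "k < n" "k \<notin> H" for i k e
  proof -
    have "P i k e = mprod {..<n} N' A' i k e"
      unfolding P_def mprod_def using off that by (intro sum.cong) (auto simp: agree_off_def)
    then show ?thesis using inv(2) that by (simp add: inverse_family_def)
  qed
  have Mcol: "M i k e = (if i = k then 1 else 0)" if "e \<in> D" "i < n" "k < n" "k \<notin> H" for i k e
  proof -
    have "M i k e = mprod {..<n} N A i k e"
      unfolding M_def mprod_def using off that by (intro sum.cong) (auto simp: agree_off_def)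
    then show ?thesis using inv(1) that by (simp add: inverse_family_def)
  qed
  have MP: "mprod {..<n} M P i k e = (if i = k then 1 else 0)"
    and PM: "mprod {..<n} P M i k e = (if i = k then 1 else 0)" if "e \<in> D" "i < n" "k < n" for i k e
  proof -
    have "mprod {..<n} M P i k e = mprod {..<n} N (mprod {..<n} A' (mprod {..<n} N' A)) i k e"
      by (simp add: M_def P_def mprod_assoc)
    also have "\<dots> = mprod {..<n} N A i k e"
      unfolding mprod_def[of _ N] using inverse_family_cancel(1)[OF inv(2) that(1)] by (intro sum.cong) auto
    finally show "mprod {..<n} M P i k e = (if i = k then 1 else 0)"
      using inv(1) that by (simp add: inverse_family_def)
    have "mprod {..<n} P M i k e = mprod {..<n} N' (mprod {..<n} A (mprod {..<n} N A')) i k e"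
      by (simp add: M_def P_def mprod_assoc)
    also have "\<dots> = mprod {..<n} N' A' i k e"
      unfolding mprod_def[of _ N'] using inverse_family_cancel(1)[OF inv(1) that(1)] by (intro sum.cong) auto
    finally show "mprod {..<n} P M i k e = (if i = k then 1 else 0)"
      using inv(2) that by (simp add: inverse_family_def)
  qed
  have "knows D (ent M H H) (card H * (6 * j + 11) * B) (ent P H H)"
  proof (rule knows_inverse[OF fin, where T = T])
    fix m assume "1 \<le> m" "m \<le> card H"
    then have m: "1 \<le> m" "m \<le> h" by (simp_all add: h_def)
    show "matmul_cost T (m * B) m (card H) m \<and> matmul_cost T (m * B) m m (card H)"
      using mm[OF m] h(3) unfolding h_def by (blast intro: matmul_cost_mono)
  next
    fix e i k assume e: "e \<in> D" and ik: "i \<in> H" "k \<in> H"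
    then have lt: "i < n" "k < n" using H by auto
    show "mprod H M P i k e = (if i = k then 1 else 0)"
      using mprod_split_columns[OF H(1) lt, of M e P] Mcol[OF e lt(1)] MP[OF e lt] ik by auto
    show "mprod H P M i k e = (if i = k then 1 else 0)"
      using mprod_split_columns[OF H(1) lt, of P e M] Pcol[OF e lt(1)] PM[OF e lt] ik by auto
  qed (use h H in \<open>auto simp: h_def\<close>)
  then have 2: "knows D V (h * B + h * (6 * j + 11) * B) (ent P H H)"
    using knows_trans0[OF 1] by (simp add: h_def)
  have "knows D (V \<union> ent P H H) (h * B) (ent (mprod H P N) H {..<n})"
    by (rule matmul_costD[OF mm(2)[OF h(1) order_refl]]) (use fin V h_def in auto)
  with 2 have "knows D V (h * (6 * j + 13) * B) (ent (mprod H P N) H {..<n})"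
    by (rule knows_trans') (auto simp: algebra_simps)
  then have "knows D V (h * (6 * j + 13) * B) (ent N' H {..<n})"
  proof (rule knows_ent_cong)
    fix i k e assume *: "i \<in> H" "k \<in> {..<n}" and e: "e \<in> D"
    then have i: "i < n" using H by auto
    have "N' i k e = (\<Sum>r<n. if r = k then N' i r e else 0)" using * by simp
    also have "\<dots> = (\<Sum>r<n. N' i r e * mprod {..<n} A N r k e)"
      by (rule sum.cong) (use inv(1) e * in \<open>auto simp: inverse_family_def\<close>)
    also have "\<dots> = mprod {..<n} N' (mprod {..<n} A N) i k e" by (simp add: mprod_def[of _ N'])
    also have "\<dots> = mprod {..<n} P N i k e" by (simp add: P_def mprod_assoc)
    also have "\<dots> = mprod H P N i k e"
      using mprod_split_columns[OF H(1) i, of k P e N] Pcol[OF e i] * by auto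
    finally show "N' i k e = mprod H P N i k e" .
  qed (use fin in auto)
  then show ?thesis by (simp add: h_def)
qed

text \<open>As \<open>A' - A\<close> vanishes outside the columns \<open>H\<close>, the correction
  involves only the rows \<open>H\<close> of the new inverse. The four parts of the cost are the
  difference, two products and the subtraction.\<close>

lemma knows_extend_rows:
  fixes A A' N N' :: "nat \<Rightarrow> nat \<Rightarrow> 'e \<Rightarrow> 'a::field"
  assumes H: "H \<subseteq> {..<n}" "card H \<le> h" and G: "G \<subseteq> {..<n}" "card G \<le> g"
    and inv: "inverse_family D n A N" "inverse_family D n A' N'" and off: "agree_off D n H A A'"
    and V: "ent N G {..<n} \<subseteq> V" "ent A {..<n} H \<subseteq> V" "ent A' {..<n} H \<subseteq> V" "ent N' H {..<n} \<subseteq> V"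
    and mm: "matmul_cost (T :: ('e \<Rightarrow> 'a) itself) c g n h" "matmul_cost T c g h n"
    and c: "n * h \<le> c" "g * n \<le> c"
  shows "knows D V (4 * c) (ent N' G {..<n})"
proof -
  have fin: "finite H" "finite G" using H G finite_subset by blast+
  define \<Delta> where "\<Delta> = (\<lambda>i j e. A' i j e - A i j e)"
  define Q where "Q = mprod {..<n} N \<Delta>"
  define Z where "Z = mprod H Q N'"
  have "knows D V c (ent \<Delta> {..<n} H)"
  proof (rule knows_mono)
    show "knows D V (card {..<n} * card H * 1) (ent \<Delta> {..<n} H)"
      unfolding \<Delta>_def by (intro knows_ent fin knows_sub) (use V in auto)
    have "card {..<n} * card H * 1 \<le> n * h" using H by simp
    then show "card {..<n} * card H * 1 \<le> c" using c by linarith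
  qed auto
  moreover have "knows D (V \<union> ent \<Delta> {..<n} H) c (ent Q G H)"
    unfolding Q_def by (rule matmul_costD[OF mm(1)]) (use V H G fin in auto)
  ultimately have "knows D V (2 * c) (ent Q G H)"
    by (rule knows_trans') auto
  moreover have "knows D (V \<union> ent Q G H) c (ent Z G {..<n})"
    unfolding Z_def by (rule matmul_costD[OF mm(2)]) (use V H G fin in auto)
  ultimately have "knows D V (3 * c) (ent Z G {..<n})"
    by (rule knows_trans') auto
  moreover have "knows D (V \<union> ent Z G {..<n}) c (ent (\<lambda>i j e. N i j e - Z i j e) G {..<n})"
  proof (rule knows_mono)
    show "knows D (V \<union> ent Z G {..<n}) (card G * card {..<n} * 1) (ent (\<lambda>i j e. N i j e - Z i j e) G {..<n})"
      by (intro knows_ent fin knows_sub) (use V in auto)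
    have "card G * card {..<n} * 1 \<le> g * n" using G by simp
    then show "card G * card {..<n} * 1 \<le> c" using c by linarith
  qed auto
  ultimately have "knows D V (4 * c) (ent (\<lambda>i j e. N i j e - Z i j e) G {..<n})"
    by (rule knows_trans') auto
  then show ?thesis
  proof (rule knows_ent_cong)
    fix i k e assume *: "i \<in> G" "k \<in> {..<n}" and e: "e \<in> D"
    then have i: "i < n" using G by auto
    have "Z i k e = mprod {..<n} Q N' i k e"
      unfolding Z_def mprod_def[of _ Q]
    proof (rule sum.mono_neutral_left)
      show "\<forall>r\<in>{..<n} - H. Q i r e * N' r k e = 0"
        using off e by (auto simp: Q_def mprod_def \<Delta>_def agree_off_def)
    qed (use H in auto)
    also have "\<dots> = mprod {..<n} N (mprod {..<n} \<Delta> N') i k e" by (simp add: Q_def mprod_assoc)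
    also have "\<dots> = mprod {..<n} N (mprod {..<n} A' N') i k e - mprod {..<n} N (mprod {..<n} A N') i k e"
      by (simp add: mprod_def \<Delta>_def left_diff_distrib right_diff_distrib sum_subtractf)
    also have "mprod {..<n} N (mprod {..<n} A' N') i k e = (\<Sum>r<n. if r = k then N i r e else 0)"
      unfolding mprod_def[of _ N]
      by (rule sum.cong) (use inv(2) e * in \<open>auto simp: inverse_family_def\<close>)
    also have "\<dots> = N i k e" using * by simp
    also have "mprod {..<n} N (mprod {..<n} A N') i k e = N' i k e"
      by (rule inverse_family_cancel(2)[OF inv(1) e i])
    finally show "N' i k e = N i k e - Z i k e" by simp
  qed (use fin in auto)
qed

subsection \<open>The schedule of tasks\<close>

type_synonym 'a session = "'a mat \<times> (nat \<Rightarrow> 'a vec operation) \<times> (nat \<Rightarrow> nat \<Rightarrow> nat set)"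

text \<open>The sessions that the algorithm cannot tell apart by their discrete data; one program
  has to serve all of them. The set shrinks as the history grows, so knowledge once gained
  persists.\<close>

definition sessions :: "nat \<Rightarrow> nat \<Rightarrow> nat \<Rightarrow> history \<Rightarrow> 'a::field session set" where
  "sessions n s l h = {(A, ops, F). valid_session n s l A ops F \<and>
     (\<forall>r<length h. h ! r = (F r, map_operation (\<lambda>_. ()) (ops r)))}"

definition mat_entry :: "nat \<Rightarrow> nat \<Rightarrow> nat \<Rightarrow> 'a::field session \<Rightarrow> 'a" where
  "mat_entry t i k = (\<lambda>(A, ops, F). matrix_at A ops t $$ (i, k))"

definition inverse_of :: "nat \<Rightarrow> 'a::field mat \<Rightarrow> 'a mat" where
  "inverse_of n A = (SOME B. B \<in> carrier_mat n n \<and> inverts_mat A B \<and> inverts_mat B A)"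

definition inv_entry :: "nat \<Rightarrow> nat \<Rightarrow> nat \<Rightarrow> nat \<Rightarrow> 'a::field session \<Rightarrow> 'a" where
  "inv_entry n t i k = (\<lambda>(A, ops, F). inverse_of n (matrix_at A ops t) $$ (i, k))"

lemma sessions_append: "sessions n s l (h @ [x]) \<subseteq> sessions n s l h"
proof
  fix e :: "'a session" assume e: "e \<in> sessions n s l (h @ [x])"
  obtain A ops F where "e = (A, ops, F)" by (cases e)
  moreover have "h ! r = (h @ [x]) ! r" if "r < length h" for r using that by (simp add: nth_append)
  ultimately show "e \<in> sessions n s l h" using e by (auto simp: sessions_def)
qed

lemma apply_op_carrier: "A \<in> carrier_mat n n \<Longrightarrow> apply_op u A \<in> carrier_mat n n"
  by (cases u) (auto simp: replace_col_def)

lemma matrix_at_carrier: "valid_session n s l A ops F \<Longrightarrow> matrix_at A ops t \<in> carrier_mat n n"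
  by (induction t) (auto simp: valid_session_def intro: apply_op_carrier)

lemma inverse_of:
  assumes "A \<in> carrier_mat n n" and "invertible_mat A"
  shows "inverse_of n A \<in> carrier_mat n n" and "inverts_mat A (inverse_of n A)" and "inverts_mat (inverse_of n A) A"
proof -
  obtain B where B: "inverts_mat A B" "inverts_mat B A"
    using assms(2) unfolding invertible_mat_def by blast
  have "dim_col B = n"
    using arg_cong[OF B(1)[unfolded inverts_mat_def], of dim_col] assms(1) by auto
  moreover have "dim_row B = n"
    using arg_cong[OF B(2)[unfolded inverts_mat_def], of dim_col] assms(1) by auto
  ultimately have "\<exists>B. B \<in> carrier_mat n n \<and> inverts_mat A B \<and> inverts_mat B A" using B by blast
  from someI_ex[OF this] show "inverse_of n A \<in> carrier_mat n n" "inverts_mat A (inverse_of n A)"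
    "inverts_mat (inverse_of n A) A" unfolding inverse_of_def by auto
qed

lemma inverts_mat_unique:
  assumes "A \<in> carrier_mat n n" and "B \<in> carrier_mat n n" and "C \<in> carrier_mat n n"
    and "inverts_mat B A" and "inverts_mat A C"
  shows "B = (C :: 'a::field mat)"
proof -
  have "B = B * (A * C)" using assms by (simp add: inverts_mat_def)
  also have "\<dots> = (B * A) * C" using assms by (simp add: assoc_mult_mat)
  also have "\<dots> = C" using assms by (simp add: inverts_mat_def)
  finally show ?thesis .
qed

lemma inverse_family_entries:
  assumes "D \<subseteq> sessions n s l h"
  shows "inverse_family D n (mat_entry t) (inv_entry n t)"
  unfolding inverse_family_def
proof (intro ballI allI impI)
  fix e i k assume "e \<in> D" and ik: "i < n" "k < n"
  then obtain A ops F where e: "e = (A, ops, F)" "valid_session n s l A ops F"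
    using assms by (auto simp: sessions_def)
  let ?A = "matrix_at A ops t" and ?B = "inverse_of n (matrix_at A ops t)"
  have A: "?A \<in> carrier_mat n n" by (rule matrix_at_carrier[OF e(2)])
  have B: "?B \<in> carrier_mat n n" "inverts_mat ?A ?B" "inverts_mat ?B ?A"
    using inverse_of[OF A] e(2) by (auto simp: valid_session_def)
  have mult: "(P * Q) $$ (i, k) = (\<Sum>r<n. P $$ (i, r) * Q $$ (r, k))"
    if "P \<in> carrier_mat n n" "Q \<in> carrier_mat n n" for P Q :: "'a mat"
    using that ik by (simp add: scalar_prod_def atLeast0LessThan)
  have "(?A * ?B) $$ (i, k) = (if i = k then 1 else 0)" "(?B * ?A) $$ (i, k) = (if i = k then 1 else 0)"
    using A B ik by (auto simp: inverts_mat_def)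
  then show "mprod {..<n} (mat_entry t) (inv_entry n t) i k e = (if i = k then 1 else 0) \<and>
      mprod {..<n} (inv_entry n t) (mat_entry t) i k e = (if i = k then 1 else 0)"
    using mult[OF A B(1)] mult[OF B(1) A] by (simp add: mprod_def mat_entry_def inv_entry_def e(1))
qed

lemma mat_entry_Suc:
  assumes "(A, ops, F) \<in> sessions n s l h" and "i < n" and "k < n"
  shows "mat_entry (Suc t) i k (A, ops, F) =
    (case ops t of Update c v \<Rightarrow> if k = c then v $ i else mat_entry t i k (A, ops, F)
     | Query _ \<Rightarrow> mat_entry t i k (A, ops, F))"
  using assms matrix_at_carrier[of n s l A ops F t]
  by (auto simp: sessions_def mat_entry_def replace_col_def split: operation.splits)

lemma agree_off_entries:
  assumes "D \<subseteq> sessions n s l h" and "a \<le> b"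
    and "\<And>e r A ops F. (A, ops, F) \<in> D \<Longrightarrow> a \<le> r \<Longrightarrow> r < b \<Longrightarrow> op_index (ops r) \<in> H"
  shows "agree_off D n H (mat_entry a) (mat_entry b)"
  using assms(2,3)
proof (induction b)
  case 0
  then show ?case by (auto simp: agree_off_def)
next
  case (Suc b)
  show ?case
  proof (cases "a = Suc b")
    case True
    then show ?thesis by (auto simp: agree_off_def)
  next
    case False
    then have "a \<le> b" using Suc.prems by simp
    have IH: "agree_off D n H (mat_entry a) (mat_entry b)"
      by (rule Suc.IH[OF \<open>a \<le> b\<close>]) (use Suc.prems(2) in auto)
    show ?thesis
      unfolding agree_off_def
    proof (intro ballI allI impI)
      fix e i k assume *: "e \<in> D" "i < n" "k < n" "k \<notin> H"
      obtain A ops F where e: "e = (A, ops, F)" by (cases e)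
      have "op_index (ops b) \<in> H" using Suc.prems(2)[of A ops F b] * e \<open>a \<le> b\<close> by auto
      then have "mat_entry (Suc b) i k e = mat_entry b i k e"
        using mat_entry_Suc[of A ops F n s l h i k b] * e assms(1) by (auto split: operation.splits)
      then show "mat_entry a i k e = mat_entry (Suc b) i k e" using IH * by (simp add: agree_off_def)
    qed
  qed
qed

text \<open>\<open>X\<close> bounds a look-ahead set, and \<open>Y\<close> such a set together with
  the columns changed in up to \<open>2 * L\<close> rounds. The condition on \<open>K\<close> makes
  the widest look-ahead fit into \<open>l\<close>. \<open>q\<close> bounds the rows handled per
  round of a period: \<open>X / 2 ^ K\<close> at level \<open>K\<close>, and \<open>6 * s\<close> at
  the levels below.\<close>

locale schedule =
  fixes T :: "('a::field session \<Rightarrow> 'a) itself" and n s l L K X Y B B2 j q :: nat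
  assumes L: "1 \<le> L" and K: "3 * 2 ^ K \<le> l + 2" and X: "s * l \<le> X" "X \<le> q * 2 ^ K" and q: "6 * s \<le> q"
    and Y: "2 * L + s * l \<le> Y" and j: "n \<le> 2 ^ j"
    and good1: "good T n X Y B" and good2: "good T n L n B2"
begin

abbreviation dom :: "history \<Rightarrow> 'a session set" where
  "dom \<equiv> sessions n s l"

abbreviation full :: "(nat \<Rightarrow> nat \<Rightarrow> 'a session \<Rightarrow> 'a) \<Rightarrow> ('a session \<Rightarrow> 'a) set" where
  "full M \<equiv> ent M {..<n} {..<n}"

text \<open>The solution of \<open>reach (k + 1) = reach k + 3 * 2 ^ k\<close> with
  \<open>reach 0 = 1\<close>. A task of level \<open>k\<close> starts up to \<open>3 * 2 ^ k\<close>
  rounds after the task of level \<open>k + 1\<close> on which it relies, and its own look-ahead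
  must lie within that of the latter. A query relies on the task of level 0 from the round
  before.\<close>

definition reach :: "nat \<Rightarrow> nat" where
  "reach k = 3 * 2 ^ k - 2"

definition index_at :: "history \<Rightarrow> nat \<Rightarrow> nat" where
  "index_at h r = op_index (snd (h ! r))"

definition changed :: "history \<Rightarrow> nat \<Rightarrow> nat \<Rightarrow> nat set" where
  "changed h a b = index_at h ` {a..<b}"

text \<open>The recomputation started at \<open>t div L * L\<close> is still running, so the one
  before is the last that is finished. Truncated subtraction yields 0 at the beginning, where the
  inverse is known from pre-processing.\<close>

definition base_time :: "nat \<Rightarrow> nat" where
  "base_time t = (t div L - 1) * L"

definition rows :: "history \<Rightarrow> nat \<Rightarrow> nat \<Rightarrow> nat set" where
  "rows h k t = fst (h ! t) (reach k) \<union> (if k = K then changed h (base_time t) t else {})"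

fun period :: "nat option \<Rightarrow> nat" where
  "period None = L"
| "period (Some k) = 2 ^ k"

text \<open>The cost of a task per round of its period. A step for the rows of changed columns
  contributes 13, each extension to other rows 4. A recomputation has one extension, a task of level
  \<open>K\<close> has two; the lower levels share the rate of level \<open>K\<close>.\<close>

fun rate :: "nat option \<Rightarrow> nat" where
  "rate None = (6 * j + 17) * B2"
| "rate (Some k) = q * (6 * j + 21) * B"

fun target :: "history \<Rightarrow> nat option \<Rightarrow> nat \<Rightarrow> ('a session \<Rightarrow> 'a) set" where
  "target h None t = full (inv_entry n t)"
| "target h (Some k) t = ent (inv_entry n t) (rows h k t) {..<n}"

definition tasks :: "nat option set" where
  "tasks = insert None (Some ` {..K})"

lemma reach_bounds:
  assumes "k \<le> K" shows "1 \<le> reach k" and "reach k \<le> l" and "reach k + 2 = 3 * 2 ^ k"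
proof -
  have "(1::nat) \<le> 2 ^ k" by simp
  moreover have "(2::nat) ^ k \<le> 2 ^ K" using assms by (simp add: power_increasing)
  ultimately show "1 \<le> reach k" "reach k \<le> l" "reach k + 2 = 3 * 2 ^ k"
    using K unfolding reach_def by linarith+
qed

text \<open>Programs are chosen from the history alone; it inherits these properties from any
  session that is consistent with it.\<close>

lemma lookahead:
  assumes "dom h \<noteq> {}" and "r < length h" and "i \<le> l"
  shows lookahead_less: "fst (h ! r) i \<subseteq> {..<n}"
    and lookahead_index: "r \<le> r' \<Longrightarrow> r' \<le> r + i \<Longrightarrow> r' < length h \<Longrightarrow> index_at h r' \<in> fst (h ! r) i"
    and lookahead_card: "1 \<le> i \<Longrightarrow> card (fst (h ! r) i) \<le> s * i"
    and lookahead_mono: "r \<le> r' \<Longrightarrow> r' < length h \<Longrightarrow> r' + i' \<le> r + i \<Longrightarrow> i' \<le> l \<Longrightarrow> fst (h ! r') i' \<subseteq> fst (h ! r) i"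
proof -
  obtain A :: "'a mat" and ops F where "valid_session n s l A ops F"
    and h: "\<And>r. r < length h \<Longrightarrow> h ! r = (F r, map_operation (\<lambda>_. ()) (ops r))"
  proof -
    obtain e where "e \<in> dom h" using assms(1) by blast
    moreover obtain A ops F where "e = (A, ops, F)" by (cases e)
    ultimately show thesis by (intro that[of A ops F]) (simp_all add: sessions_def)
  qed
  then have F: "accurate_lookahead n s l ops F" by (simp add: valid_session_def)
  have idx: "index_at h r' = op_index (ops r')" if "r' < length h" for r'
    using h[OF that] by (cases "ops r'") (auto simp: index_at_def)
  show "fst (h ! r) i \<subseteq> {..<n}" using F h assms by (auto simp: accurate_lookahead_def)
  show "index_at h r' \<in> fst (h ! r) i" if "r \<le> r'" "r' \<le> r + i" "r' < length h"
    using F h assms that idx[OF that(3)] by (auto simp: accurate_lookahead_def)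
  show "card (fst (h ! r) i) \<le> s * i" if "1 \<le> i"
    using F h assms that by (auto simp: accurate_lookahead_def)
  show "fst (h ! r') i' \<subseteq> fst (h ! r) i" if "r \<le> r'" "r' < length h" "r' + i' \<le> r + i" "i' \<le> l"
    using F h assms that unfolding accurate_lookahead_def by (metis fst_conv)
qed

lemma index_at_less: "dom h \<noteq> {} \<Longrightarrow> r < length h \<Longrightarrow> index_at h r < n"
  using lookahead_index[of h r 0 r] lookahead_less[of h r 0] by auto

lemma changedI: "a \<le> r \<Longrightarrow> r < b \<Longrightarrow> index_at h r \<in> changed h a b"
  by (simp add: changed_def)

lemma changed_less:
  assumes "dom h \<noteq> {}" and "b \<le> length h" shows "changed h a b \<subseteq> {..<n}"
  unfolding changed_def
proof (intro image_subsetI)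
  fix r assume "r \<in> {a..<b}"
  then show "index_at h r \<in> {..<n}" using index_at_less[OF assms(1), of r] assms(2) by simp
qed

lemma card_changed: "card (changed h a b) \<le> b - a"
  unfolding changed_def using card_image_le[of "{a..<b}"] by fastforce

lemma agree_off_changed:
  assumes "a \<le> b" and "b \<le> length h" and "changed h a b \<subseteq> H"
  shows "agree_off (dom h) n H (mat_entry a) (mat_entry b)"
proof (rule agree_off_entries[OF subset_refl assms(1)])
  fix A ops F r assume "(A, ops, F) \<in> dom h" and r: "a \<le> r" "r < b"
  then have "h ! r = (F r, map_operation (\<lambda>_. ()) (ops r))" using assms by (auto simp: sessions_def)
  then have "index_at h r = op_index (ops r)" by (cases "ops r") (auto simp: index_at_def)
  then show "op_index (ops r) \<in> H" using assms(3) changedI[OF r, of h] by auto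
qed

lemma knows_step:
  assumes "dom h \<noteq> {}" and "a \<le> b" and "b < length h" and "changed h a b \<subseteq> H" and "H \<subseteq> {..<n}"
    and good: "good T n X' Y' B'" and "card H \<le> X'"
    and "ent (inv_entry n a) H {..<n} \<subseteq> V" and "full (mat_entry b) \<subseteq> V"
  shows "knows (dom h) V (card H * (6 * j + 13) * B') (ent (inv_entry n b) H {..<n})"
proof (rule knows_step_rows[OF good assms(5,7)])
  show "card H \<le> 2 ^ j" using j card_mono[OF _ assms(5)] by simp
  show "inverse_family (dom h) n (mat_entry a) (inv_entry n a)" "inverse_family (dom h) n (mat_entry b) (inv_entry n b)"
    by (rule inverse_family_entries, rule subset_refl)+
  show "agree_off (dom h) n H (mat_entry a) (mat_entry b)"
    by (rule agree_off_changed) (use assms in auto)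
  show "ent (inv_entry n a) H {..<n} \<subseteq> V" by fact
  show "ent (mat_entry b) {..<n} H \<subseteq> V" using assms(5,9) ent_mono by blast
qed

lemma knows_extend:
  assumes "a \<le> b" and "b < length h" and "changed h a b \<subseteq> H" and H: "H \<subseteq> {..<n}" "card H \<le> p"
    and G: "G \<subseteq> {..<n}" "card G \<le> g"
    and V: "ent (inv_entry n a) G {..<n} \<subseteq> V" "full (mat_entry a) \<subseteq> V" "full (mat_entry b) \<subseteq> V"
      "ent (inv_entry n b) H {..<n} \<subseteq> V"
    and mm: "matmul_cost T c g n p" "matmul_cost T c g p n" and c: "n * p \<le> c" "g * n \<le> c"
  shows "knows (dom h) V (4 * c) (ent (inv_entry n b) G {..<n})"
proof (rule knows_extend_rows[OF H G _ _ _ V(1) _ _ V(4) mm c])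
  show "inverse_family (dom h) n (mat_entry a) (inv_entry n a)" "inverse_family (dom h) n (mat_entry b) (inv_entry n b)"
    by (rule inverse_family_entries, rule subset_refl)+
  show "agree_off (dom h) n H (mat_entry a) (mat_entry b)"
    by (rule agree_off_changed) (use assms in auto)
  show "ent (mat_entry a) {..<n} H \<subseteq> V" "ent (mat_entry b) {..<n} H \<subseteq> V"
    using V H ent_mono by blast+
qed

lemma base_time_le: "base_time t \<le> t"
proof -
  have "base_time t \<le> t div L * L" unfolding base_time_def by (intro mult_le_mono1) simp
  also have "\<dots> \<le> t" by simp
  finally show ?thesis .
qed

lemma base_time_mono: "c \<le> t \<Longrightarrow> base_time c \<le> base_time t"
  unfolding base_time_def by (intro mult_le_mono1 diff_le_mono div_le_mono)

lemma minus_base_time_le: "t - base_time t \<le> 2 * L"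
proof -
  have "t < (t div L) * L + L" using dividend_less_div_times[of L t] L by simp
  moreover have "(t div L) * L \<le> base_time t + L" by (cases "t div L") (auto simp: base_time_def)
  ultimately show ?thesis by linarith
qed

lemma card_rows:
  assumes "dom h \<noteq> {}" and "t < length h"
  shows "rows h K t \<subseteq> {..<n}" and "card (rows h K t) \<le> Y"
proof -
  note rK = reach_bounds[OF order_refl]
  show "rows h K t \<subseteq> {..<n}"
    using lookahead_less[OF assms rK(2)] changed_less[OF assms(1), of t "base_time t"] assms(2) by (auto simp: rows_def)
  have "card (rows h K t) \<le> card (fst (h ! t) (reach K)) + card (changed h (base_time t) t)"
    by (simp add: rows_def card_Un_le)
  also have "\<dots> \<le> s * reach K + 2 * L"
    using lookahead_card[OF assms rK(2,1)] card_changed[of h "base_time t" t] minus_base_time_le[of t] by linarith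
  also have "\<dots> \<le> s * l + 2 * L" using rK(2) by simp
  finally show "card (rows h K t) \<le> Y" using Y by simp
qed

section \<open>The cost of a task at its start\<close>

context
  fixes h :: history and t :: nat and S :: "('a session \<Rightarrow> 'a) set"
  assumes ne: "dom h \<noteq> {}" and t: "t < length h"
    and mats: "\<And>r. r \<le> t \<Longrightarrow> full (mat_entry r) \<subseteq> S" and init: "full (inv_entry n 0) \<subseteq> S"
    and finished: "\<And>\<pi> b. \<pi> \<in> tasks \<Longrightarrow> period \<pi> dvd b \<Longrightarrow> b + period \<pi> \<le> t \<Longrightarrow> knows (dom h) S 0 (target h \<pi> b)"
begin

lemma start_rebuild:
  assumes "L dvd t"
  shows "knows (dom h) S (L * rate None) (full (inv_entry n t))"
proof (cases "t = 0")
  case True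
  then show ?thesis using init by (simp add: knows_refl)
next
  case False
  \<comment> \<open>The recomputation started at \<open>a\<close> has just been finished.\<close>
  define a where "a = t - L"
  have "L \<le> t" using assms False by (simp add: dvd_imp_le)
  then have a: "a + L = t" "L dvd a" using assms by (simp_all add: a_def dvd_diff_nat)
  let ?H = "changed h a t"
  have H: "?H \<subseteq> {..<n}" "card ?H \<le> L"
    using changed_less[OF ne, of t a] t card_changed[of h a t] a by auto
  have mm: "matmul_cost T (L * B2) n n L" "matmul_cost T (L * B2) n L n" and c: "n * n \<le> L * B2"
    using good2 unfolding good_def by auto
  have nB: "n \<le> B2" by (rule good_le[OF good2])
  have 0: "knows (dom h) S 0 (full (inv_entry n a))"
    using finished[of None a] a by (simp add: tasks_def)
  let ?V = "S \<union> full (inv_entry n a)"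
  have 1: "knows (dom h) ?V (L * (6 * j + 13) * B2) (ent (inv_entry n t) ?H {..<n})"
  proof (rule knows_mono[OF knows_step[OF ne _ t subset_refl H(1) good2 H(2)]])
    show "ent (inv_entry n a) ?H {..<n} \<subseteq> ?V" using H(1) ent_mono by blast
    show "full (mat_entry t) \<subseteq> ?V" using mats[of t] by auto
    show "card ?H * (6 * j + 13) * B2 \<le> L * (6 * j + 13) * B2" using H(2) by (intro mult_le_mono1)
  qed (use a in auto)
  have 2: "knows (dom h) (?V \<union> ent (inv_entry n t) ?H {..<n}) (4 * (L * B2)) (full (inv_entry n t))"
  proof (rule knows_extend[OF _ t subset_refl H])
    show "full (mat_entry a) \<subseteq> ?V \<union> ent (inv_entry n t) ?H {..<n}"
      "full (mat_entry t) \<subseteq> ?V \<union> ent (inv_entry n t) ?H {..<n}"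
      using mats[of a] mats[of t] a by auto
    show "n * L \<le> L * B2" using nB by simp
  qed (use a mm c in auto)
  have "knows (dom h) ?V (L * ((6 * j + 17) * B2)) (full (inv_entry n t))"
    by (rule knows_trans'[OF 1 2]) (auto simp: algebra_simps)
  with 0 show ?thesis using knows_trans'[OF 0, of "L * ((6 * j + 17) * B2)"] by auto
qed

lemma done_inverse: "(b = 0 \<or> L dvd b \<and> b + L \<le> t) \<Longrightarrow> knows (dom h) S 0 (full (inv_entry n b))"
  using init finished[of None b] by (auto simp: tasks_def intro: knows_refl)

lemma done_rows:
  assumes "k \<le> K" and "2 ^ k dvd c" and "c + 2 ^ k \<le> t"
  shows "knows (dom h) S 0 (ent (inv_entry n c) (rows h k c) {..<n})"
  using finished[of "Some k" c] assms by (auto simp: tasks_def)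

lemma start_lookahead_block:
  assumes "2 ^ K dvd t"
  shows "knows (dom h) S (2 ^ K * rate (Some K)) (ent (inv_entry n t) (rows h K t) {..<n})"
proof (cases "t = 0")
  case True
  then show ?thesis
    using init card_rows(1)[OF ne t] ent_mono[of "rows h K t" "{..<n}" "{..<n}" "{..<n}"]
    by (intro knows_refl) (auto dest: subsetD)
next
  case False
  note rK = reach_bounds[OF order_refl]
  define c where "c = t - 2 ^ K"
  have "2 ^ K \<le> t" using assms False by (simp add: dvd_imp_le)
  then have c: "c + 2 ^ K = t" "2 ^ K dvd c" "c < length h" "c \<le> t" using assms t by (auto simp: c_def dvd_diff_nat)
  let ?H = "fst (h ! c) (reach K)" and ?G = "rows h K c" and ?J = "changed h (base_time t) t"
    and ?H' = "fst (h ! t) (reach K)"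
  have sX: "s * reach K \<le> X" using X(1) rK(2) by (meson le_trans mult_le_mono2)
  have H: "?H \<subseteq> {..<n}" "card ?H \<le> X"
    using lookahead_less[OF ne c(3) rK(2)] lookahead_card[OF ne c(3) rK(2,1)] sX by auto
  have H': "?H' \<subseteq> {..<n}" "card ?H' \<le> X"
    using lookahead_less[OF ne t rK(2)] lookahead_card[OF ne t rK(2,1)] sX by auto
  have G: "?G \<subseteq> {..<n}" "card ?G \<le> Y" using card_rows[OF ne c(3)] by auto
  have J: "?J \<subseteq> {..<n}" "card ?J \<le> Y"
    using changed_less[OF ne, of t "base_time t"] t card_changed[of h "base_time t" t] minus_base_time_le[of t] Y by auto
  have HG: "?H \<subseteq> ?G" by (auto simp: rows_def)
  have ct: "changed h c t \<subseteq> ?H"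
    using lookahead_index[OF ne c(3) rK(2)] t c(1) rK(3) by (auto simp: changed_def)
  \<comment> \<open>Columns changed before \<open>c\<close> belong to the rows kept at
    \<open>c\<close>, since base times are monotone; those changed later are in the look-ahead of
    \<open>c\<close>.\<close>
  have JG: "?J \<subseteq> ?G"
  proof
    fix i assume "i \<in> ?J"
    then obtain r where r: "base_time t \<le> r" "r < t" "i = index_at h r" by (auto simp: changed_def)
    show "i \<in> ?G"
    proof (cases "r < c")
      case True
      then show ?thesis using r base_time_mono[OF c(4)] by (auto simp: rows_def changed_def)
    next
      case False
      then show ?thesis using r ct HG changedI[of c r t h] by auto
    qed
  qed
  have mm: "matmul_cost T (X * B) Y n X" "matmul_cost T (X * B) Y X n" "matmul_cost T (X * B) X Y n"
    and XY: "X \<le> Y" and nY: "n * Y \<le> X * B"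
    using good1 unfolding good_def by auto
  have nX: "n * X \<le> X * B" using good_le[OF good1] by simp
  let ?N = "inv_entry n"
  have 0: "knows (dom h) S (0 + 0) (ent (?N c) ?G {..<n} \<union> full (?N (base_time t)))"
  proof (intro knows_Un)
    show "knows (dom h) S 0 (ent (?N c) ?G {..<n})" using c by (intro done_rows) auto
    show "knows (dom h) S 0 (full (?N (base_time t)))"
    proof (rule done_inverse, cases "t div L")
      case (Suc q')
      have "t div L * L \<le> t" by simp
      then show "base_time t = 0 \<or> L dvd base_time t \<and> base_time t + L \<le> t"
        using Suc by (simp add: base_time_def)
    qed (simp add: base_time_def)
  qed
  let ?V = "S \<union> (ent (?N c) ?G {..<n} \<union> full (?N (base_time t)))"
  have 1: "knows (dom h) ?V (X * (6 * j + 13) * B) (ent (?N t) ?H {..<n})"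
  proof (rule knows_mono[OF knows_step[OF ne c(4) t ct H(1) good1 H(2)]])
    show "ent (?N c) ?H {..<n} \<subseteq> ?V" using HG ent_mono by blast
    show "full (mat_entry t) \<subseteq> ?V" using mats[of t] by auto
    show "card ?H * (6 * j + 13) * B \<le> X * (6 * j + 13) * B" using H(2) by (intro mult_le_mono1)
  qed auto
  let ?V1 = "?V \<union> ent (?N t) ?H {..<n}"
  have 2: "knows (dom h) ?V1 (4 * (X * B)) (ent (?N t) ?G {..<n})"
  proof (rule knows_extend[OF c(4) t ct H G])
    show "full (mat_entry c) \<subseteq> ?V1" "full (mat_entry t) \<subseteq> ?V1"
      using mats[of c] mats[of t] c(4) by auto
    show "Y * n \<le> X * B" using nY by (simp add: mult.commute)
  qed (use mm nX in auto)
  have 12: "knows (dom h) ?V (X * (6 * j + 17) * B) (ent (?N t) ?G {..<n})"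
    by (rule knows_trans'[OF 1 2]) (auto simp: algebra_simps)
  let ?V2 = "?V \<union> ent (?N t) ?G {..<n}"
  \<comment> \<open>New rows are taken from the last finished full inverse. Their correction uses
    the current rows of all columns changed since then, which were updated just before as a part of
    \<open>?G\<close>.\<close>
  have 3: "knows (dom h) ?V2 (4 * (X * B)) (ent (?N t) ?H' {..<n})"
  proof (rule knows_extend[OF base_time_le t subset_refl J H'])
    show "ent (?N (base_time t)) ?H' {..<n} \<subseteq> ?V2" using H'(1) ent_mono by blast
    show "full (mat_entry (base_time t)) \<subseteq> ?V2" "full (mat_entry t) \<subseteq> ?V2"
      using mats[of "base_time t"] mats[of t] base_time_le[of t] by auto
    show "ent (?N t) ?J {..<n} \<subseteq> ?V2" using JG ent_mono by blast
    show "matmul_cost T (X * B) X n Y" by (rule matmul_cost_transpose[OF mm(1)])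
    show "X * n \<le> X * B" using nX by (simp add: mult.commute)
  qed (use mm nY in auto)
  have "rows h K t \<subseteq> ?G \<union> ?H'" using JG by (auto simp: rows_def)
  then have "ent (?N t) (rows h K t) {..<n} \<subseteq> ?V2 \<union> ent (?N t) ?H' {..<n}" by blast
  from knows_trans'[OF 12 3 order_refl this]
  have "knows (dom h) ?V (X * (6 * j + 17) * B + 4 * (X * B)) (ent (?N t) (rows h K t) {..<n})" .
  then have "knows (dom h) S (0 + 0 + (X * (6 * j + 17) * B + 4 * (X * B))) (ent (?N t) (rows h K t) {..<n})"
    by (rule knows_trans'[OF 0]) auto
  moreover have "0 + 0 + (X * (6 * j + 17) * B + 4 * (X * B)) \<le> 2 ^ K * rate (Some K)"
  proof -
    have "0 + 0 + (X * (6 * j + 17) * B + 4 * (X * B)) = X * ((6 * j + 21) * B)" by (simp add: algebra_simps)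
    also have "\<dots> \<le> q * 2 ^ K * ((6 * j + 21) * B)" using X(2) by (intro mult_le_mono1)
    finally show ?thesis by (simp add: ac_simps)
  qed
  ultimately show ?thesis by (rule_tac knows_mono[OF _ subset_refl subset_refl _ subset_refl])
qed

lemma start_lookahead_rows:
  assumes "k < K" and "2 ^ k dvd t"
  shows "knows (dom h) S (2 ^ k * rate (Some k)) (ent (inv_entry n t) (rows h k t) {..<n})"
proof -
  let ?w = "2 ^ Suc k :: nat" and ?N = "inv_entry n"
  have kK: "k \<le> K" "Suc k \<le> K" using assms by auto
  note rk = reach_bounds[OF kK(1)] and rk' = reach_bounds[OF kK(2)]
  define b where "b = t div ?w * ?w"
  have b: "b \<le> t" "?w dvd b" by (auto simp: b_def)
  \<comment> \<open>As \<open>t\<close> is a multiple of \<open>2 ^ k\<close>, it exceeds the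
    preceding multiple of \<open>2 ^ Suc k\<close> by 0 or by \<open>2 ^ k\<close>.\<close>
  have tb: "t \<le> b + 2 ^ k"
  proof -
    obtain u where u: "t = 2 ^ k * u" using assms(2) by (auto elim: dvdE)
    have "t div ?w = u div 2" by (simp add: u)
    then have "b = 2 ^ k * (2 * (u div 2))" by (simp add: b_def)
    moreover have "u \<le> 2 * (u div 2) + 1" by simp
    then have "2 ^ k * u \<le> 2 ^ k * (2 * (u div 2) + 1)" by (rule mult_le_mono2)
    ultimately show ?thesis by (simp add: u distrib_left)
  qed
  \<comment> \<open>The start of the last finished task of level \<open>Suc k\<close>. For
    \<open>b = 0\<close> there is none yet; truncation gives \<open>c = 0\<close>, where the whole
    inverse is known.\<close>
  define c where "c = b - ?w"
  have c: "c \<le> t" "c < length h" using b t by (auto simp: c_def)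
  have tc: "t \<le> c + 3 * 2 ^ k" using tb by (simp add: c_def)
  let ?H = "fst (h ! c) (reach (Suc k))"
  have H: "?H \<subseteq> {..<n}" "card ?H \<le> s * reach (Suc k)"
    using lookahead_less[OF ne c(2) rk'(2)] lookahead_card[OF ne c(2) rk'(2,1)] by auto
  have HX: "card ?H \<le> X" using H(2) X(1) rk'(2) by (meson le_trans mult_le_mono2)
  have ct: "changed h c t \<subseteq> ?H"
    using lookahead_index[OF ne c(2) rk'(2)] t tc rk'(3) by (auto simp: changed_def)
  have sub: "rows h k t \<subseteq> ?H"
    using lookahead_mono[OF ne c(2) rk'(2) c(1) t _ rk(2)] tc rk(3) rk'(3) assms(1) by (auto simp: rows_def)
  have 0: "knows (dom h) S 0 (ent (?N c) ?H {..<n})"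
  proof (cases "b = 0")
    case True
    then have "c = 0" by (simp add: c_def)
    have "knows (dom h) S 0 (full (?N c))" by (rule done_inverse) (simp add: \<open>c = 0\<close>)
    then show ?thesis by (rule knows_mono) (use H(1) in auto)
  next
    case False
    then have "?w \<le> b" using b(2) by (simp add: dvd_imp_le)
    then have "?w dvd c" "c + ?w \<le> t" using b by (simp_all add: c_def dvd_diff_nat)
    then have "knows (dom h) S 0 (ent (?N c) (rows h (Suc k) c) {..<n})" by (rule done_rows[OF kK(2)])
    then show ?thesis by (rule knows_mono) (auto simp: rows_def)
  qed
  have 1: "knows (dom h) (S \<union> ent (?N c) ?H {..<n}) (card ?H * (6 * j + 13) * B) (ent (?N t) ?H {..<n})"
    by (rule knows_step[OF ne c(1) t ct H(1) good1 HX]) (use mats[of t] in auto)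
  have "card ?H * (6 * j + 13) * B \<le> 2 ^ k * rate (Some k)"
  proof -
    have "reach (Suc k) \<le> 6 * 2 ^ k" using rk'(3) by simp
    then have "card ?H \<le> s * (6 * 2 ^ k)" using H(2) mult_le_mono2 by (meson le_trans)
    also have "\<dots> = 6 * s * 2 ^ k" by simp
    also have "\<dots> \<le> q * 2 ^ k" using q by (rule mult_le_mono1)
    finally have "card ?H * ((6 * j + 13) * B) \<le> q * 2 ^ k * ((6 * j + 21) * B)"
      by (intro mult_le_mono) auto
    then show ?thesis by (simp add: ac_simps)
  qed
  then show ?thesis
    by (intro knows_trans'[OF 0 1]) (use sub in auto)
qed

lemma start_task:
  assumes "\<pi> \<in> tasks" and "period \<pi> dvd t"
  shows "knows (dom h) S (period \<pi> * rate \<pi>) (target h \<pi> t)"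
proof (cases \<pi>)
  case None
  then show ?thesis using start_rebuild assms by simp
next
  case (Some k)
  then consider "k = K" | "k < K" using assms(1) by (fastforce simp: tasks_def)
  then show ?thesis
    using start_lookahead_block start_lookahead_rows assms(2) Some by cases auto
qed

text \<open>The task of level 0 started in the previous round is finished, and its look-ahead of
  reach 1 contains the indices of both the previous and the current operation. So a single step from
  \<open>t - 1\<close> to \<open>t\<close> suffices.\<close>

lemma knows_answer: "knows (dom h) S (q * (6 * j + 21) * B) (ent (inv_entry n t) {index_at h t} {..<n})"
proof (cases "t = 0")
  case True
  have "ent (inv_entry n 0) {index_at h t} {..<n} \<subseteq> full (inv_entry n 0)"
    using index_at_less[OF ne t] by (intro ent_mono) auto
  then show ?thesis using init True by (intro knows_refl) auto
next
  case False
  let ?N = "inv_entry n"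
  define c where "c = t - 1"
  have c: "t = Suc c" "c < length h" "c \<le> t" using False t by (auto simp: c_def)
  note r0 = reach_bounds[of 0]
  let ?H = "fst (h ! c) (reach 0)"
  have reach0: "reach 0 = 1" by (simp add: reach_def)
  have H: "?H \<subseteq> {..<n}" "card ?H \<le> s"
    using lookahead_less[OF ne c(2) r0(2)] lookahead_card[OF ne c(2) r0(2,1)] by (auto simp: reach0)
  have "1 \<le> l" using r0(2) by (simp add: reach0)
  then have "s * 1 \<le> s * l" by (rule mult_le_mono2)
  then have HX: "card ?H \<le> X" using H(2) X(1) by linarith
  have idx: "index_at h r \<in> ?H" if "r = c \<or> r = t" for r
    using lookahead_index[OF ne c(2) r0(2), of r] that c t reach0 by auto
  have 0: "knows (dom h) S 0 (ent (?N c) (rows h 0 c) {..<n})" using c by (intro done_rows) auto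
  have 1: "knows (dom h) (S \<union> ent (?N c) (rows h 0 c) {..<n}) (card ?H * (6 * j + 13) * B) (ent (?N t) ?H {..<n})"
  proof (rule knows_step[OF ne c(3) t _ H(1) good1 HX])
    show "changed h c t \<subseteq> ?H" using idx[of c] c by (auto simp: changed_def)
    have "?H \<subseteq> rows h 0 c" by (auto simp: rows_def)
    then show "ent (?N c) ?H {..<n} \<subseteq> S \<union> ent (?N c) (rows h 0 c) {..<n}" using ent_mono by blast
  qed (use mats[of t] in auto)
  have "card ?H * (6 * j + 13) * B \<le> q * (6 * j + 21) * B"
    using H(2) q by (intro mult_le_mono) auto
  then show ?thesis
    by (intro knows_trans'[OF 0 1]) (use idx[of t] in auto)
qed

end

end

subsection \<open>From derivations to programs\<close>

text \<open>The address of a value is the same for all sessions in \<open>D\<close>, only the memory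
  varies. Registers below \<open>N\<close> are left free for input and output.\<close>

definition stored :: "nat \<Rightarrow> 'e set \<Rightarrow> ('e \<Rightarrow> nat \<Rightarrow> 'a) \<Rightarrow> (('e \<Rightarrow> 'a) \<Rightarrow> nat) \<Rightarrow> ('e \<Rightarrow> 'a) set \<Rightarrow> bool" where
  "stored N D mem ad S \<longleftrightarrow> (\<forall>f\<in>S. N \<le> ad f \<and> (\<forall>e\<in>D. mem e (ad f) = f e))"

lemma stored_mono: "stored N D mem ad S \<Longrightarrow> S' \<subseteq> S \<Longrightarrow> stored N D mem ad S'"
  unfolding stored_def by blast

lemma run_append: "run (p @ p') m = run p' (run p m)"
  by (simp add: run_def)

lemma fresh_register:
  assumes "finite W"
  obtains r where "(N::nat) \<le> r" and "\<And>f. f \<in> W \<Longrightarrow> ad f < r"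
proof
  show "N \<le> Suc (Max (insert N (ad ` W)))" using assms by (simp add: le_SucI)
  show "ad f < Suc (Max (insert N (ad ` W)))" if "f \<in> W" for f
    using assms that by (simp add: less_Suc_eq_le)
qed

lemma stored_insert:
  assumes "stored N D mem ad W" and "N \<le> r" and "\<And>f. f \<in> W \<Longrightarrow> ad f < r"
    and "\<And>e. e \<in> D \<Longrightarrow> mem' e = (mem e)(r := g e)"
  shows "stored N D mem' (ad(g := r)) (insert g W)"
  unfolding stored_def
proof (intro ballI conjI)
  fix f assume f: "f \<in> insert g W"
  then show "N \<le> (ad(g := r)) f" using assms(1,2) by (auto simp: stored_def)
  fix e assume e: "e \<in> D"
  show "mem' e ((ad(g := r)) f) = f e"
    using f assms(1) assms(3)[of f] e by (auto simp: assms(4)[OF e] stored_def)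
qed

text \<open>Program and addresses are fixed before the memory, hence do not depend on the session.
  Every result goes to a register above all used ones, so nothing is lost; the rule
  \<open>cong\<close> merely gives a second name to a register.\<close>

lemma realize_derives:
  assumes "derives D V c W" and "finite V"
  shows "\<exists>p ad'. cost p = c \<and>
    (\<forall>mem. stored N D mem ad V \<longrightarrow> stored N D (\<lambda>e. run p (mem e)) ad' W)"
  using assms(1)
proof (induction rule: derives.induct)
  case base
  show ?case by (intro exI[of _ "[]"] exI[of _ ad]) (simp add: cost_def run_def)
next
  case (cong c W f f')
  then obtain p ad' where p: "cost p = c"
    "\<And>mem. stored N D mem ad V \<Longrightarrow> stored N D (\<lambda>e. run p (mem e)) ad' W" by blast
  have "stored N D (\<lambda>e. run p (mem e)) (ad'(f' := ad' f)) (insert f' W)" if "stored N D mem ad V" for mem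
    using p(2)[OF that] cong.hyps(2,3) by (auto simp: stored_def)
  then show ?case using p(1) by blast
next
  case (const c W k)
  then obtain p ad' where p: "cost p = c"
    "\<And>mem. stored N D mem ad V \<Longrightarrow> stored N D (\<lambda>e. run p (mem e)) ad' W" by blast
  obtain r where r: "N \<le> r" "\<And>f. f \<in> W \<Longrightarrow> ad' f < r"
    using fresh_register[OF derives_finite[OF const.hyps(1) assms(2)]] by metis
  have "stored N D (\<lambda>e. run (p @ [Const r k]) (mem e)) (ad'((\<lambda>_. k) := r)) (insert (\<lambda>_. k) W)"
    if "stored N D mem ad V" for mem
    by (rule stored_insert[OF p(2)[OF that] r]) (simp_all add: run_def)
  moreover have "cost (p @ [Const r k]) = c" using p(1) by (simp add: cost_def)
  ultimately show ?case by blast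
next
  case (op c W f g h)
  then obtain p ad' where p: "cost p = c"
    "\<And>mem. stored N D mem ad V \<Longrightarrow> stored N D (\<lambda>e. run p (mem e)) ad' W" by blast
  obtain r where r: "N \<le> r" "\<And>f. f \<in> W \<Longrightarrow> ad' f < r"
    using fresh_register[OF derives_finite[OF op.hyps(1) assms(2)]] by metis
  obtain i :: "'b instr" where i: "instr_cost i = 1"
    "\<And>m. exec_instr (\<lambda>c. c) (/) i m = m(r := h (m (ad' f)) (m (ad' g)))"
    using op.hyps(4) that[of "Add r (ad' f) (ad' g)"] that[of "Sub r (ad' f) (ad' g)"]
      that[of "Mul r (ad' f) (ad' g)"] that[of "Div r (ad' f) (ad' g)"] by auto
  have "stored N D (\<lambda>e. run (p @ [i]) (mem e)) (ad'((\<lambda>e. h (f e) (g e)) := r)) (insert (\<lambda>e. h (f e) (g e)) W)"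
    if "stored N D mem ad V" for mem
    by (rule stored_insert[OF p(2)[OF that] r])
      (use p(2)[OF that] op.hyps(2,3) in \<open>simp_all add: run_def i(2) stored_def\<close>)
  moreover have "cost (p @ [i]) = Suc c" using p(1) i(1) by (simp add: cost_def)
  ultimately show ?case by blast
qed

text \<open>Inputs are moved out of the unprotected registers. All copies go to \<open>M\<close> or
  above, so inputs not yet copied stay intact; a value that was already stored just receives a new
  address.\<close>

lemma load_program:
  assumes "finite V" and "m \<le> M" and "N \<le> M"
  shows "\<exists>p ad'. cost p = 0 \<and> (\<forall>\<mu>. \<forall>r<M. run p \<mu> r = \<mu> r) \<and>
    (\<forall>mem. stored N D mem ad V \<and> (\<forall>i<m. \<forall>e\<in>D. mem e i = f i e) \<longrightarrow>
       stored N D (\<lambda>e. run p (mem e)) ad' (V \<union> f ` {..<m}))"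
  using assms(2)
proof (induction m)
  case 0
  show ?case by (intro exI[of _ "[]"] exI[of _ ad]) (simp add: cost_def run_def)
next
  case (Suc m)
  then obtain p ad' where p: "cost p = 0" "\<And>\<mu> r. r < M \<Longrightarrow> run p \<mu> r = \<mu> r"
    "\<And>mem. stored N D mem ad V \<Longrightarrow> (\<forall>i<m. \<forall>e\<in>D. mem e i = f i e) \<Longrightarrow>
       stored N D (\<lambda>e. run p (mem e)) ad' (V \<union> f ` {..<m})"
    by (metis Suc_leD)
  obtain r where r: "M \<le> r" "\<And>g. g \<in> V \<union> f ` {..<m} \<Longrightarrow> ad' g < r"
    using fresh_register[of "V \<union> f ` {..<m}"] assms(1) by (metis finite_Un finite_imageI finite_lessThan)
  let ?p = "p @ [Copy r m]"
  have ins: "V \<union> f ` {..<Suc m} = insert (f m) (V \<union> f ` {..<m})" by (auto simp: lessThan_Suc)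
  have "stored N D (\<lambda>e. run ?p (mem e)) (ad'(f m := r)) (V \<union> f ` {..<Suc m})"
    if "stored N D mem ad V" "\<forall>i<Suc m. \<forall>e\<in>D. mem e i = f i e" for mem
    unfolding ins
  proof (rule stored_insert)
    show "stored N D (\<lambda>e. run p (mem e)) ad' (V \<union> f ` {..<m})" using p(3) that by simp
    fix e assume "e \<in> D"
    then show "run ?p (mem e) = (run p (mem e))(r := f m e)"
      using p(2)[of m "mem e"] Suc.prems that(2) by (simp add: run_append) (simp add: run_def)
  qed (use r assms in auto)
  moreover have "run ?p \<mu> r' = \<mu> r'" if "r' < M" for \<mu> r'
    using p(2)[OF that] r(1) that by (simp add: run_append) (simp add: run_def)
  moreover have "cost ?p = 0" using p(1) by (simp add: cost_def)
  ultimately show ?case by blast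
qed

lemma output_program:
  assumes "g ` {..<m} \<subseteq> S" and "m \<le> N"
  shows "\<exists>p. cost p = 0 \<and> (\<forall>mem. stored N D mem ad S \<longrightarrow>
    stored N D (\<lambda>e. run p (mem e)) ad S \<and> (\<forall>i<m. \<forall>e\<in>D. run p (mem e) i = g i e))"
  using assms
proof (induction m)
  case 0
  show ?case by (intro exI[of _ "[]"]) (simp add: cost_def run_def)
next
  case (Suc m)
  then obtain p where p: "cost p = 0" "\<And>mem. stored N D mem ad S \<Longrightarrow>
      stored N D (\<lambda>e. run p (mem e)) ad S \<and> (\<forall>i<m. \<forall>e\<in>D. run p (mem e) i = g i e)"
    by (auto simp: lessThan_Suc)
  let ?p = "p @ [Copy m (ad (g m))]"
  have "stored N D (\<lambda>e. run ?p (mem e)) ad S \<and> (\<forall>i<Suc m. \<forall>e\<in>D. run ?p (mem e) i = g i e)"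
    if "stored N D mem ad S" for mem
  proof -
    have run: "run ?p \<mu> = (run p \<mu>)(m := run p \<mu> (ad (g m)))" for \<mu>
      by (simp add: run_append) (simp add: run_def)
    have "ad f \<noteq> m" if "f \<in> S" for f
      using \<open>stored N D mem ad S\<close> that Suc.prems(2) by (auto simp: stored_def)
    moreover have "g m \<in> S" using Suc.prems(1) by auto
    ultimately show ?thesis
      using p(2)[OF that] unfolding run by (auto simp: stored_def less_Suc_eq)
  qed
  moreover have "cost ?p = 0" using p(1) by (simp add: cost_def)
  ultimately show ?case by blast
qed

definition input_entry :: "nat \<Rightarrow> nat \<Rightarrow> 'a::field session \<Rightarrow> 'a" where
  "input_entry t i = (\<lambda>(A, ops, F). case ops t of Update c v \<Rightarrow> v $ i | Query _ \<Rightarrow> 0)"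

section \<open>One round of the algorithm\<close>

context schedule
begin

definition inputs :: "nat \<Rightarrow> unit operation \<Rightarrow> ('a session \<Rightarrow> 'a) set" where
  "inputs t u = (case u of Update _ _ \<Rightarrow> input_entry t ` {..<n} | Query _ \<Rightarrow> {})"

text \<open>The factor \<open>b + period \<pi> - length h\<close> counts the rounds left to a task.
  By truncated subtraction, it is zero for finished tasks, whose results are then known at no
  cost.\<close>

definition invariant :: "history \<Rightarrow> ('a session \<Rightarrow> 'a) set \<Rightarrow> bool" where
  "invariant h S \<longleftrightarrow> finite S \<and> (\<forall>r\<le>length h. full (mat_entry r) \<subseteq> S) \<and> full (inv_entry n 0) \<subseteq> S \<and>
     (\<forall>\<pi>\<in>tasks. \<forall>b<length h. period \<pi> dvd b \<longrightarrow>
        knows (dom h) S ((b + period \<pi> - length h) * rate \<pi>) (target h \<pi> b))"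

definition round_cost :: nat where
  "round_cost = (6 * j + 17) * B2 + (K + 2) * (q * (6 * j + 21) * B)"

lemma period_ge_1: "1 \<le> period \<pi>"
  using L by (cases \<pi>) auto

lemma finite_tasks: "finite tasks"
  by (simp add: tasks_def)

lemma sum_rates: "(\<Sum>\<pi>\<in>tasks. rate \<pi>) + q * (6 * j + 21) * B = round_cost"
proof -
  have "(\<Sum>\<pi>\<in>tasks. rate \<pi>) = rate None + (\<Sum>k\<le>K. rate (Some k))"
    unfolding tasks_def by (subst sum.insert) (auto simp: sum.reindex)
  then show ?thesis by (simp add: round_cost_def)
qed

lemma target_append: "b < length h \<Longrightarrow> target (h @ [x]) \<pi> b = target h \<pi> b"
  by (cases \<pi>) (auto simp: rows_def changed_def index_at_def nth_append intro!: arg_cong2[of _ _ _ _ "ent _"])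

text \<open>Of each kind exactly one task is running, the one started at the last multiple of the
  period; it receives \<open>rate \<pi>\<close> operations. Earlier tasks of this kind are finished,
  and knowledge of their results is preserved.\<close>

lemma advance_tasks:
  assumes "finite Ps"
    and "\<And>\<pi> b. \<pi> \<in> Ps \<Longrightarrow> b \<le> t \<Longrightarrow> period \<pi> dvd b \<Longrightarrow> knows D S ((b + period \<pi> - t) * rate \<pi>) (tgt \<pi> b)"
  shows "\<exists>S' c. derives D S c S' \<and> c \<le> (\<Sum>\<pi>\<in>Ps. rate \<pi>) \<and>
    (\<forall>\<pi>\<in>Ps. \<forall>b\<le>t. period \<pi> dvd b \<longrightarrow> knows D S' ((b + period \<pi> - Suc t) * rate \<pi>) (tgt \<pi> b))"
  using assms
proof (induction Ps rule: finite_induct)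
  case empty
  then show ?case using derives.base by auto
next
  case (insert \<pi> Ps)
  then obtain S' c where S': "derives D S c S'" "c \<le> (\<Sum>\<pi>\<in>Ps. rate \<pi>)"
    "\<And>\<pi>' b. \<pi>' \<in> Ps \<Longrightarrow> b \<le> t \<Longrightarrow> period \<pi>' dvd b \<Longrightarrow>
       knows D S' ((b + period \<pi>' - Suc t) * rate \<pi>') (tgt \<pi>' b)"
    by (metis insertI2)
  let ?w = "period \<pi>"
  define b0 where "b0 = t div ?w * ?w"
  have w: "1 \<le> ?w" by (rule period_ge_1)
  have b0: "b0 \<le> t" "?w dvd b0" by (auto simp: b0_def)
  have "t < b0 + ?w" unfolding b0_def using dividend_less_div_times[of ?w t] w by simp
  then have "b0 + ?w - t = Suc (b0 + ?w - Suc t)" by simp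
  moreover have "knows D S' ((b0 + ?w - t) * rate \<pi>) (tgt \<pi> b0)"
    using insert.prems[of \<pi> b0] b0 derives_subset[OF S'(1)] by (auto elim: knows_mono)
  ultimately have "knows D S' (rate \<pi> + (b0 + ?w - Suc t) * rate \<pi>) (tgt \<pi> b0)" by simp
  from knows_split[OF this] obtain U c' where U: "derives D S' c' U" "c' \<le> rate \<pi>"
    "knows D U ((b0 + ?w - Suc t) * rate \<pi>) (tgt \<pi> b0)" by blast
  have SU: "S \<subseteq> U" "S' \<subseteq> U" using derives_subset[OF S'(1)] derives_subset[OF U(1)] by auto
  have other: "knows D U ((b + ?w - Suc t) * rate \<pi>) (tgt \<pi> b)" if b: "b \<le> t" "?w dvd b" for b
  proof (cases "b = b0")
    case True
    then show ?thesis using U(3) by simp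
  next
    case False
    obtain u where u: "b = ?w * u" using b(2) by (auto elim: dvdE)
    have "u \<le> t div ?w" using b(1) u w by (simp add: less_eq_div_iff_mult_less_eq mult.commute)
    moreover have "u \<noteq> t div ?w" using False u by (auto simp: b0_def)
    ultimately have "Suc u \<le> t div ?w" by simp
    then have "Suc u * ?w \<le> b0" unfolding b0_def by (rule mult_le_mono1)
    then have "b + ?w \<le> t" using b0(1) u by (simp add: mult.commute)
    then have "knows D S 0 (tgt \<pi> b)" using insert.prems[of \<pi> b] b by simp
    then show ?thesis using SU by (auto elim: knows_mono)
  qed
  have rest: "knows D U ((b + period \<pi>' - Suc t) * rate \<pi>') (tgt \<pi>' b)"
    if "\<pi>' \<in> Ps" "b \<le> t" "period \<pi>' dvd b" for \<pi>' b
    by (rule knows_mono[OF S'(3)[OF that]]) (use SU in auto)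
  have "derives D S (c + c') U" by (rule derives_trans[OF U(1) S'(1)])
  moreover have "c + c' \<le> (\<Sum>\<pi>\<in>insert \<pi> Ps. rate \<pi>)" using S'(2) U(2) insert.hyps by simp
  ultimately show ?case using other rest by (metis insert_iff)
qed

text \<open>Which column is replaced belongs to the discrete data. Hence on all sessions with this
  history a new entry coincides with an input or with an old entry, and updating the matrix is
  free.\<close>

lemma knows_next_matrix:
  assumes "full (mat_entry (length h)) \<subseteq> S"
  shows "knows (dom (h @ [x])) (S \<union> inputs (length h) (snd x)) 0 (full (mat_entry (Suc (length h))))"
proof (rule knows_set)
  let ?t = "length h" and ?D = "dom (h @ [x])" and ?V = "S \<union> inputs (length h) (snd x)"
  fix f assume "f \<in> full (mat_entry (Suc ?t))"
  then obtain i k where ik: "i < n" "k < n" "f = mat_entry (Suc ?t) i k" by auto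
  have last: "snd x = map_operation (\<lambda>_. ()) (ops ?t)" if "(A, ops, F) \<in> ?D" for A ops F
    using that by (auto simp: sessions_def)
  have f: "f (A, ops, F) = (case ops ?t of Update c v \<Rightarrow> if k = c then v $ i else mat_entry ?t i k (A, ops, F)
     | Query _ \<Rightarrow> mat_entry ?t i k (A, ops, F))" if "(A, ops, F) \<in> ?D" for A ops F
    using mat_entry_Suc[OF that ik(1,2)] ik(3) by simp
  show "knows ?D ?V 0 {f}"
  proof (cases "\<exists>u. snd x = Update k u")
    case True
    show ?thesis
    proof (rule knows_cong[of "input_entry ?t i"])
      show "input_entry ?t i \<in> ?V" using True ik by (auto simp: inputs_def)
      fix e assume e: "e \<in> ?D"
      obtain A ops F where "e = (A, ops, F)" by (cases e)
      then show "f e = input_entry ?t i e"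
        using f last e True by (cases "ops ?t") (auto simp: input_entry_def)
    qed
  next
    case False
    show ?thesis
    proof (rule knows_cong[of "mat_entry ?t i k"])
      show "mat_entry ?t i k \<in> ?V" using assms ik by auto
      fix e assume e: "e \<in> ?D"
      obtain A ops F where "e = (A, ops, F)" by (cases e)
      then show "f e = mat_entry ?t i k e"
        using f last e False by (cases "ops ?t") auto
    qed
  qed
qed auto

lemma invariant_step:
  assumes inv: "invariant h S" and ne: "dom (h @ [x]) \<noteq> {}"
  obtains S' c where "derives (dom (h @ [x])) (S \<union> inputs (length h) (snd x)) c S'" and "c \<le> round_cost"
    and "invariant (h @ [x]) S'" and "ent (inv_entry n (length h)) {op_index (snd x)} {..<n} \<subseteq> S'"
proof -
  let ?h = "h @ [x]" and ?t = "length h" and ?S = "S \<union> inputs (length h) (snd x)"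
  have mats: "full (mat_entry r) \<subseteq> S" if "r \<le> ?t" for r using inv that by (simp add: invariant_def)
  from knows_next_matrix[OF mats[OF order_refl], of x] obtain S1
    where S1: "derives (dom ?h) ?S 0 S1" "full (mat_entry (Suc ?t)) \<subseteq> S1" by (auto simp: knows_def)
  have SS1: "?S \<subseteq> S1" by (rule derives_subset[OF S1(1)])
  have old: "knows (dom ?h) S1 ((b + period \<pi> - ?t) * rate \<pi>) (target ?h \<pi> b)"
    if "\<pi> \<in> tasks" "b < ?t" "period \<pi> dvd b" for \<pi> b
  proof -
    have "knows (dom h) S ((b + period \<pi> - ?t) * rate \<pi>) (target h \<pi> b)"
      using inv that by (simp add: invariant_def)
    then show ?thesis
      unfolding target_append[OF that(2)]
      by (rule knows_mono[OF _ sessions_append _ order_refl subset_refl]) (use SS1 in auto)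
  qed
  have t: "?t < length ?h" by simp
  have mats1: "full (mat_entry r) \<subseteq> S1" if "r \<le> ?t" for r using mats[OF that] SS1 by auto
  have init1: "full (inv_entry n 0) \<subseteq> S1" using inv SS1 by (auto simp: invariant_def)
  have fin1: "knows (dom ?h) S1 0 (target ?h \<pi> b)"
    if "\<pi> \<in> tasks" "period \<pi> dvd b" "b + period \<pi> \<le> ?t" for \<pi> b
    using old[OF that(1) _ that(2)] that(3) period_ge_1[of \<pi>] by simp
  have cur: "knows (dom ?h) S1 ((b + period \<pi> - ?t) * rate \<pi>) (target ?h \<pi> b)"
    if "\<pi> \<in> tasks" "b \<le> ?t" "period \<pi> dvd b" for \<pi> b
  proof (cases "b = ?t")
    case True
    then show ?thesis using start_task[OF ne t mats1 init1 fin1 that(1)] that(3) by simp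
  next
    case False
    then show ?thesis using old that by simp
  qed
  obtain S2 c2 where S2: "derives (dom ?h) S1 c2 S2" "c2 \<le> (\<Sum>\<pi>\<in>tasks. rate \<pi>)"
    "\<And>\<pi> b. \<pi> \<in> tasks \<Longrightarrow> b \<le> ?t \<Longrightarrow> period \<pi> dvd b \<Longrightarrow>
       knows (dom ?h) S2 ((b + period \<pi> - Suc ?t) * rate \<pi>) (target ?h \<pi> b)"
    using advance_tasks[OF finite_tasks cur] by blast
  have S12: "S1 \<subseteq> S2" by (rule derives_subset[OF S2(1)])
  have "knows (dom ?h) S2 (q * (6 * j + 21) * B) (ent (inv_entry n ?t) {index_at ?h ?t} {..<n})"
    by (rule knows_mono[OF knows_answer[OF ne t mats1 init1 fin1] subset_refl S12 order_refl subset_refl])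
  then obtain S3 c3 where S3: "derives (dom ?h) S2 c3 S3" "c3 \<le> q * (6 * j + 21) * B"
    "ent (inv_entry n ?t) {op_index (snd x)} {..<n} \<subseteq> S3"
    by (auto simp: knows_def index_at_def)
  have S23: "S2 \<subseteq> S3" by (rule derives_subset[OF S3(1)])
  have D: "derives (dom ?h) ?S (0 + (c2 + c3)) S3"
    by (intro derives_trans[OF _ S1(1)] derives_trans[OF S3(1) S2(1)])
  have "finite ?S" using inv by (auto simp: invariant_def inputs_def split: operation.splits)
  then have "finite S3" by (rule derives_finite[OF D])
  moreover have "full (mat_entry r) \<subseteq> S3" if "r \<le> length ?h" for r
    using mats1[of r] S1(2) that S12 S23 by (cases "r = Suc ?t") auto
  moreover have "full (inv_entry n 0) \<subseteq> S3" using init1 S12 S23 by auto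
  moreover have "knows (dom ?h) S3 ((b + period \<pi> - length ?h) * rate \<pi>) (target ?h \<pi> b)"
    if "\<pi> \<in> tasks" "b < length ?h" "period \<pi> dvd b" for \<pi> b
    by (rule knows_mono[OF S2(3)]) (use that S23 in auto)
  ultimately have "invariant ?h S3" by (simp add: invariant_def)
  moreover have "0 + (c2 + c3) \<le> round_cost" using S2(2) S3(2) sum_rates by linarith
  ultimately show ?thesis using that D S3(3) by blast
qed

text \<open>The row of the current index is written to the output registers in rounds with an
  update, too. This is harmless, as stored values lie in registers from \<open>n\<close> on.\<close>

definition round_ok ::
  "history \<Rightarrow> ('a session \<Rightarrow> 'a) set \<Rightarrow> (('a session \<Rightarrow> 'a) \<Rightarrow> nat) \<Rightarrow> (nat \<Rightarrow> nat set) \<times> unit operation \<Rightarrow>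
   'a prog \<times> ('a session \<Rightarrow> 'a) set \<times> (('a session \<Rightarrow> 'a) \<Rightarrow> nat) \<Rightarrow> bool" where
  "round_ok h S ad x = (\<lambda>(p, S', ad'). cost p \<le> round_cost \<and> invariant (h @ [x]) S' \<and>
     (\<forall>mem. stored n (dom (h @ [x])) mem ad S \<and>
        (\<forall>c u. snd x = Update c u \<longrightarrow> (\<forall>i<n. \<forall>e\<in>dom (h @ [x]). mem e i = input_entry (length h) i e)) \<longrightarrow>
        stored n (dom (h @ [x])) (\<lambda>e. run p (mem e)) ad' S' \<and>
        (\<forall>k<n. \<forall>e\<in>dom (h @ [x]). run p (mem e) k = inv_entry n (length h) (op_index (snd x)) k e)))"

lemma round_program:
  assumes "invariant h S" and "dom (h @ [x]) \<noteq> {}"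
  shows "\<exists>r. round_ok h S ad x r"
proof -
  let ?D = "dom (h @ [x])" and ?t = "length h"
  obtain S' c where S': "derives ?D (S \<union> inputs ?t (snd x)) c S'" "c \<le> round_cost"
    "invariant (h @ [x]) S'" "ent (inv_entry n ?t) {op_index (snd x)} {..<n} \<subseteq> S'"
    using invariant_step[OF assms] by metis
  have fin: "finite S" using assms(1) by (simp add: invariant_def)
  obtain p0 ad0 where p0: "cost p0 = 0"
    "\<And>mem. stored n ?D mem ad S \<Longrightarrow>
       (\<forall>c u. snd x = Update c u \<longrightarrow> (\<forall>i<n. \<forall>e\<in>?D. mem e i = input_entry ?t i e)) \<Longrightarrow>
       stored n ?D (\<lambda>e. run p0 (mem e)) ad0 (S \<union> inputs ?t (snd x))"
  proof (cases "snd x")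
    case (Update c u)
    obtain p ad' where "cost p = 0" "\<And>mem. stored n ?D mem ad S \<Longrightarrow> (\<forall>i<n. \<forall>e\<in>?D. mem e i = input_entry ?t i e) \<Longrightarrow>
       stored n ?D (\<lambda>e. run p (mem e)) ad' (S \<union> input_entry ?t ` {..<n})"
      using load_program[OF fin order_refl order_refl, of n ?D ad "input_entry ?t"] by blast
    then show ?thesis using that[of p ad'] Update by (simp add: inputs_def)
  next
    case (Query i)
    then show ?thesis using that[of "[]" ad] by (simp add: inputs_def cost_def run_def)
  qed
  have "finite (S \<union> inputs ?t (snd x))" using fin by (auto simp: inputs_def split: operation.splits)
  from realize_derives[OF S'(1) this, of n ad0] obtain p1 ad1 where p1: "cost p1 = c"
    "\<And>mem. stored n ?D mem ad0 (S \<union> inputs ?t (snd x)) \<Longrightarrow> stored n ?D (\<lambda>e. run p1 (mem e)) ad1 S'" by blast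
  have "inv_entry n ?t (op_index (snd x)) ` {..<n} \<subseteq> S'" using S'(4) by auto
  from output_program[OF this order_refl, of ?D ad1] obtain p2 where p2: "cost p2 = 0"
    "\<And>mem. stored n ?D mem ad1 S' \<Longrightarrow> stored n ?D (\<lambda>e. run p2 (mem e)) ad1 S' \<and>
       (\<forall>k<n. \<forall>e\<in>?D. run p2 (mem e) k = inv_entry n ?t (op_index (snd x)) k e)" by blast
  have "round_ok h S ad x (p0 @ p1 @ p2, S', ad1)"
    unfolding round_ok_def prod.case
  proof (intro conjI allI impI)
    show "cost (p0 @ p1 @ p2) \<le> round_cost" using p0(1) p1(1) p2(1) S'(2) by simp
  next
    fix mem assume "stored n ?D mem ad S \<and>
      (\<forall>c u. snd x = Update c u \<longrightarrow> (\<forall>i<n. \<forall>e\<in>?D. mem e i = input_entry ?t i e))"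
    then have "stored n ?D (\<lambda>e. run p1 (run p0 (mem e))) ad1 S'" using p0(2) p1(2) by blast
    from p2(2)[OF this]
    show "stored n ?D (\<lambda>e. run (p0 @ p1 @ p2) (mem e)) ad1 S'"
      "\<And>k. k < n \<Longrightarrow> \<forall>e\<in>?D. run (p0 @ p1 @ p2) (mem e) k = inv_entry n ?t (op_index (snd x)) k e"
      by (simp_all add: run_append)
  qed (rule S'(3))
  then show ?thesis by blast
qed

section \<open>Pre-processing and assembly of the algorithm\<close>

lemma knows_initial_inverse:
  assumes "1 \<le> n" and good3: "good T n n n B3"
  shows "knows (dom []) (full (mat_entry 0)) (n * (6 * j + 11) * B3) (full (inv_entry n 0))"
proof -
  have inv: "inverse_family (dom []) n (mat_entry 0) (inv_entry n 0)"
    by (rule inverse_family_entries[OF subset_refl])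
  have "knows (dom []) (full (mat_entry 0)) (card {..<n} * (6 * j + 11) * B3) (full (inv_entry n 0))"
    by (rule knows_inverse[where T = T])
      (use assms good_le[OF good3] inv j in \<open>auto simp: good_def inverse_family_def\<close>)
  then show ?thesis by simp
qed

lemma preproc_program:
  assumes "1 \<le> n" and "good T n n n B3"
  shows "\<exists>p S ad. cost p \<le> n * (6 * j + 11) * B3 \<and> invariant [] S \<and>
    stored n (dom []) (\<lambda>(A, ops, F). run p (init_mem n A)) ad S"
proof -
  obtain S c where S: "derives (dom []) (full (mat_entry 0)) c S" "c \<le> n * (6 * j + 11) * B3"
    "full (inv_entry n 0) \<subseteq> S"
    using knows_initial_inverse[OF assms] by (auto simp: knows_def)
  have "finite S" by (rule derives_finite[OF S(1)]) auto
  then have inv: "invariant [] S"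
    using S(3) derives_subset[OF S(1)] by (simp add: invariant_def)
  let ?f = "\<lambda>r. mat_entry 0 (r div n) (r mod n) :: 'a session \<Rightarrow> 'a"
  \<comment> \<open>The copies start at \<open>n * n + n\<close>, beyond the matrix and beyond the
    first \<open>n\<close> registers.\<close>
  obtain p ad where p: "cost p = 0"
    "\<And>mem. stored n (dom []) mem (\<lambda>_. 0) {} \<Longrightarrow> (\<forall>i<n * n. \<forall>e\<in>dom []. mem e i = ?f i e) \<Longrightarrow>
       stored n (dom []) (\<lambda>e. run p (mem e)) ad ({} \<union> ?f ` {..<n * n})"
    using load_program[of "{}" "n * n" "n * n + n" n "dom []" "\<lambda>_. 0" ?f, OF finite.emptyI le_add1 le_add2]
    by blast
  obtain p' ad' where p': "cost p' = c"
    "\<And>mem. stored n (dom []) mem ad (full (mat_entry 0)) \<Longrightarrow> stored n (dom []) (\<lambda>e. run p' (mem e)) ad' S"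
    using realize_derives[OF S(1), of n ad] by auto
  let ?mem = "\<lambda>(A, ops, F). init_mem n A :: nat \<Rightarrow> 'a"
  have sub: "full (mat_entry 0) \<subseteq> ?f ` {..<n * n}"
  proof
    fix g :: "'a session \<Rightarrow> 'a" assume "g \<in> full (mat_entry 0)"
    then obtain i k where ik: "i < n" "k < n" "g = mat_entry 0 i k" by auto
    then have "g = ?f (i * n + k)" "i * n + k < n * n" by (simp_all add: index_less)
    then show "g \<in> ?f ` {..<n * n}" by blast
  qed
  have "stored n (dom []) (\<lambda>e. run p (?mem e)) ad ({} \<union> ?f ` {..<n * n})"
    by (rule p(2)) (auto simp: stored_def init_mem_def mat_entry_def)
  then have "stored n (dom []) (\<lambda>e. run p (?mem e)) ad (full (mat_entry 0))"
    by (rule stored_mono) (use sub in simp)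
  from p'(2)[OF this] have "stored n (dom []) (\<lambda>e. run (p @ p') (?mem e)) ad' S"
    by (simp add: run_append)
  then have "stored n (dom []) (\<lambda>(A, ops, F). run (p @ p') (init_mem n A)) ad' S"
    by (simp add: case_prod_unfold)
  then show ?thesis using inv p(1) p'(1) S(2) by (intro exI[of _ "p @ p'"]) auto
qed

theorem dynamic_inverse:
  assumes "1 \<le> n" and "good T n n n B3"
  shows "\<exists>alg :: 'a dyn_alg. cost (preproc alg) \<le> n * (6 * j + 11) * B3 \<and>
    (\<forall>A ops F. valid_session n s l A ops F \<longrightarrow>
      (\<forall>t. answers_correctly n alg A ops F t \<and> cost (respond alg (history F ops t)) \<le> round_cost))"
proof -
  obtain p0 S0 ad0 where init: "cost p0 \<le> n * (6 * j + 11) * B3" "invariant [] S0"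
    "stored n (dom []) (\<lambda>(A, ops, F). run p0 (init_mem n A)) ad0 S0"
    using preproc_program[OF assms] by blast
  \<comment> \<open>A state consists of the latest program, the known values and their addresses.
    The recursion runs over the reversed history, whose head is the current round. The choice is
    arbitrary for histories without any session.\<close>
  define st where "st = rec_list (p0, S0, ad0)
    (\<lambda>x hr prev. SOME r. round_ok (rev hr) (fst (snd prev)) (snd (snd prev)) x r)"
  define state where "state = (\<lambda>h. st (rev h))"
  have state_Nil: "state [] = (p0, S0, ad0)" by (simp add: state_def st_def)
  have state_snoc: "state (h @ [x]) = (SOME r. round_ok h (fst (snd (state h))) (snd (snd (state h))) x r)" for h x
    by (simp add: state_def st_def)
  define alg :: "'a dyn_alg" where "alg = \<lparr>preproc = p0, respond = (\<lambda>h. fst (state h))\<rparr>"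
  have ne: "dom h \<noteq> {}" if "dom (h @ [x]) \<noteq> {}" for h x
    using that sessions_append[of n s l h x] by auto
  have inv: "invariant h (fst (snd (state h)))" if "dom h \<noteq> {}" for h
    using that
  proof (induction h rule: rev_induct)
    case Nil
    then show ?case using init by (simp add: state_Nil)
  next
    case (snoc x h)
    have "round_ok h (fst (snd (state h))) (snd (snd (state h))) x (state (h @ [x]))"
      unfolding state_snoc by (rule someI_ex, rule round_program) (use snoc ne in blast)+
    then show ?case by (auto simp: round_ok_def)
  qed
  have ok: "round_ok h (fst (snd (state h))) (snd (snd (state h))) x (state (h @ [x]))"
    if "dom (h @ [x]) \<noteq> {}" for h x
    unfolding state_snoc by (rule someI_ex, rule round_program) (use inv ne that in blast)+
  have okD: "stored n (dom (h @ [x])) (\<lambda>e. run (fst (state (h @ [x]))) (mem e))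
        (snd (snd (state (h @ [x])))) (fst (snd (state (h @ [x])))) \<and>
      (\<forall>k<n. \<forall>e\<in>dom (h @ [x]). run (fst (state (h @ [x]))) (mem e) k = inv_entry n (length h) (op_index (snd x)) k e)"
    if "dom (h @ [x]) \<noteq> {}" "stored n (dom (h @ [x])) mem (snd (snd (state h))) (fst (snd (state h)))"
      "\<forall>c u. snd x = Update c u \<longrightarrow> (\<forall>i<n. \<forall>e\<in>dom (h @ [x]). mem e i = input_entry (length h) i e)" for h x mem
    using ok[OF that(1)] that(2,3) unfolding round_ok_def case_prod_unfold by blast
  let ?mem = "\<lambda>t (A, ops, F). mem_at n alg A ops F t"
  let ?mem' = "\<lambda>t (A, ops, F). load_input n (ops t) (mem_at n alg A ops F t)"
  have loaded: "\<forall>c u. snd x = Update c u \<longrightarrow>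
      (\<forall>i<n. \<forall>e\<in>dom (h @ [x]). ?mem' (length h) e i = input_entry (length h) i e)" for h x
  proof (intro allI impI ballI)
    fix c u i e assume x: "snd x = Update c u" and i: "i < n" and e: "e \<in> dom (h @ [x])"
    obtain A ops F where e': "e = (A, ops, F)" by (cases e)
    then have "snd x = map_operation (\<lambda>_. ()) (ops (length h))" using e by (auto simp: sessions_def)
    then show "?mem' (length h) e i = input_entry (length h) i e"
      using x i e' by (cases "ops (length h)") (auto simp: input_entry_def)
  qed
  have step: "?mem (Suc (length h)) e = run (fst (state (h @ [x]))) (?mem' (length h) e)"
    if "e \<in> dom (h @ [x])" for h x e
  proof -
    obtain A ops F where e: "e = (A, ops, F)" by (cases e)
    have "history F ops (length h) = h @ [x]"
      using that e by (intro nth_equalityI) (auto simp: history_def sessions_def simp del: upt_Suc)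
    then show ?thesis by (simp add: e alg_def)
  qed
  have load_stored: "stored n (dom (h @ [x])) (?mem' (length h)) ad S"
    if "stored n (dom h) (?mem (length h)) ad S" for h x ad S
    unfolding stored_def
  proof (intro ballI conjI)
    fix f assume f: "f \<in> S"
    then show "n \<le> ad f" using that by (simp add: stored_def)
    fix e assume "e \<in> dom (h @ [x])"
    then have "?mem (length h) e (ad f) = f e"
      using that f sessions_append[of n s l h x] by (auto simp: stored_def)
    moreover obtain A ops F where "e = (A, ops, F)" by (cases e)
    ultimately show "?mem' (length h) e (ad f) = f e"
      using \<open>n \<le> ad f\<close> by (cases "ops (length h)") auto
  qed
  have mem: "stored n (dom h) (?mem (length h)) (snd (snd (state h))) (fst (snd (state h)))" if "dom h \<noteq> {}" for h
    using that
  proof (induction h rule: rev_induct)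
    case Nil
    show ?case using init(3) by (simp add: state_Nil alg_def case_prod_unfold)
  next
    case (snoc x h)
    then have "stored n (dom (h @ [x])) (?mem' (length h)) (snd (snd (state h))) (fst (snd (state h)))"
      using ne load_stored by blast
    then have "stored n (dom (h @ [x])) (\<lambda>e. run (fst (state (h @ [x]))) (?mem' (length h) e))
        (snd (snd (state (h @ [x])))) (fst (snd (state (h @ [x]))))"
      using okD[OF snoc.prems _ loaded] by blast
    then show ?case using step[of _ h x] by (auto simp: stored_def)
  qed
  have "answers_correctly n alg A ops F t \<and> cost (respond alg (history F ops t)) \<le> round_cost"
    if valid: "valid_session n s l A ops F" for A ops F t
  proof -
    define h where "h = map (\<lambda>r. (F r, map_operation (\<lambda>_. ()) (ops r))) [0..<t]"
    define x where "x = (F t, map_operation (\<lambda>_. ()) (ops t))"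
    have h: "length h = t" "history F ops t = h @ [x]" by (auto simp: h_def x_def history_def)
    have e: "(A, ops, F) \<in> dom (h @ [x])"
      using valid by (auto simp: sessions_def h_def x_def nth_append less_Suc_eq)
    then have D: "dom (h @ [x]) \<noteq> {}" by blast
    have "cost (respond alg (history F ops t)) \<le> round_cost"
      using ok[OF D] by (auto simp: h(2) alg_def round_ok_def)
    moreover have "answers_correctly n alg A ops F t"
      unfolding answers_correctly_def
    proof (intro allI impI, elim conjE)
      fix i B' k assume opt: "ops t = Query i" and B': "B' \<in> carrier_mat n n"
        "inverts_mat (matrix_at A ops t) B'" "inverts_mat B' (matrix_at A ops t)" and k: "k < n"
      have At: "matrix_at A ops t \<in> carrier_mat n n" by (rule matrix_at_carrier[OF valid])
      have "inverse_of n (matrix_at A ops t) = B'"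
        using inverse_of[OF At] valid B' At inverts_mat_unique by (metis valid_session_def)
      moreover have "run (fst (state (h @ [x]))) (?mem' t (A, ops, F)) k = inv_entry n t i k (A, ops, F)"
      proof -
        have "op_index (snd x) = i" using opt by (simp add: x_def)
        with okD[OF D load_stored[OF mem[OF ne[OF D]]] loaded] e k show ?thesis unfolding h(1) by blast
      qed
      moreover have "mem_at n alg A ops F (Suc t) k = run (fst (state (h @ [x]))) (?mem' t (A, ops, F)) k"
        using step[OF e] h(1) by simp
      ultimately show "mem_at n alg A ops F (Suc t) k = B' $$ (i, k)"
        by (simp add: inv_entry_def)
    qed
    ultimately show ?thesis by blast
  qed
  moreover have "cost (preproc alg) \<le> n * (6 * j + 11) * B3" using init(1) by (simp add: alg_def)
  ultimately show ?thesis by blast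
qed

end

subsection \<open>Choice of parameters\<close>

lemma dynamic_inverse_good:
  assumes n: "1 \<le> n" and l: "1 \<le> l" "l \<le> L" "l \<le> n" and j: "n \<le> 2 ^ j"
    and good: "good (T :: ('a::field session \<Rightarrow> 'a) itself) n l L B1" "good T n L n B2" "good T n n n B3"
  shows "\<exists>alg :: 'a dyn_alg. cost (preproc alg) \<le> 6 * (n * (j + 4) * B3) \<and>
    (\<forall>A ops F. valid_session n s l A ops F \<longrightarrow>
      (\<forall>t. answers_correctly n alg A ops F t \<and>
        cost (respond alg (history F ops t)) \<le> 72 * (s + 2) ^ 3 * ((j + 4)\<^sup>2 * B1 + (j + 4) * B2)))"
proof -
  \<comment> \<open>Covers both \<open>s * l \<le> \<kappa> * l\<close> and
    \<open>2 * L + s * l \<le> \<kappa> * L\<close>, the latter by \<open>l \<le> L\<close>.\<close>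
  define \<kappa> where "\<kappa> = s + 2"
  have "\<exists>K. 3 * 2 ^ K \<le> l + 2 \<and> l \<le> 6 * 2 ^ K"
  proof -
    \<comment> \<open>Maximality gives \<open>l \<le> 6 * 2 ^ K\<close>, the origin of the 6 in the
      rate \<open>6 * \<kappa>\<close>.\<close>
    define K where "K = Max {K. 3 * 2 ^ K \<le> l + 2}"
    have fin: "finite {K. 3 * 2 ^ K \<le> l + 2}"
    proof (rule finite_subset)
      show "{K. 3 * 2 ^ K \<le> l + 2} \<subseteq> {..l + 2}"
      proof clarsimp
        fix K assume "3 * 2 ^ K \<le> Suc (Suc l)"
        moreover have "K < 2 ^ K" by simp
        ultimately show "K \<le> Suc (Suc l)" by linarith
      qed
    qed simp
    have "0 \<in> {K. 3 * 2 ^ K \<le> l + 2}" using l by simp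
    then have "K \<in> {K. 3 * 2 ^ K \<le> l + 2}" unfolding K_def by (metis Max_in[OF fin] empty_iff)
    moreover have "Suc K \<notin> {K. 3 * 2 ^ K \<le> l + 2}"
    proof
      assume "Suc K \<in> {K. 3 * 2 ^ K \<le> l + 2}"
      from Max_ge[OF fin this] show False by (simp add: K_def)
    qed
    ultimately have "3 * 2 ^ K \<le> l + 2" "l \<le> 6 * 2 ^ K" by auto
    then show ?thesis by blast
  qed
  then obtain K where K: "3 * 2 ^ K \<le> l + 2" "l \<le> 6 * 2 ^ K" by blast
  have "(2::nat) ^ K \<le> 2 ^ j" using K(1) l j by linarith
  then have Kj: "K \<le> j" by (simp add: power_increasing_iff)
  interpret schedule T n s l L K "\<kappa> * l" "\<kappa> * L" "2 * \<kappa>\<^sup>2 * B1" B2 j "6 * \<kappa>"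
  proof
    show "1 \<le> L" using l by simp
    show "3 * 2 ^ K \<le> l + 2" by (rule K(1))
    show "s * l \<le> \<kappa> * l" by (simp add: \<kappa>_def)
    show "\<kappa> * l \<le> 6 * \<kappa> * 2 ^ K" using mult_le_mono2[OF K(2), of \<kappa>] by simp
    show "6 * s \<le> 6 * \<kappa>" by (simp add: \<kappa>_def)
    show "2 * L + s * l \<le> \<kappa> * L" using mult_le_mono2[OF l(2), of s] by (simp add: \<kappa>_def algebra_simps)
    show "good T n (\<kappa> * l) (\<kappa> * L) (2 * \<kappa>\<^sup>2 * B1)" by (rule good_scale[OF good(1)]) (simp add: \<kappa>_def)
  qed (use j good in auto)
  obtain alg :: "'a dyn_alg" where alg: "cost (preproc alg) \<le> n * (6 * j + 11) * B3"
    "\<And>A ops F t. valid_session n s l A ops F \<Longrightarrow>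
       answers_correctly n alg A ops F t \<and> cost (respond alg (history F ops t)) \<le> round_cost"
    using dynamic_inverse[OF n good(3)] by blast
  have "n * (6 * j + 11) * B3 \<le> n * (6 * (j + 4)) * B3" by (intro mult_le_mono order_refl) simp
  then have pre: "cost (preproc alg) \<le> 6 * (n * (j + 4) * B3)" using alg(1) by (simp add: algebra_simps)
  have "round_cost \<le> 72 * \<kappa> ^ 3 * ((j + 4)\<^sup>2 * B1 + (j + 4) * B2)"
  proof -
    \<comment> \<open>The constant 72 is 6 from the rate, 6 from bounding \<open>6 * j + 21\<close>
      by \<open>6 * (j + 4)\<close>, and 2 from \<open>good_scale\<close>.\<close>
    have "(K + 2) * (6 * \<kappa> * (6 * j + 21) * (2 * \<kappa>\<^sup>2 * B1))
        \<le> (j + 4) * (6 * \<kappa> * (6 * (j + 4)) * (2 * \<kappa>\<^sup>2 * B1))"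
      using Kj by (intro mult_le_mono order_refl) auto
    also have "\<dots> = 72 * \<kappa> ^ 3 * ((j + 4)\<^sup>2 * B1)" by (simp add: power2_eq_square power3_eq_cube)
    finally have 1: "(K + 2) * (6 * \<kappa> * (6 * j + 21) * (2 * \<kappa>\<^sup>2 * B1)) \<le> 72 * \<kappa> ^ 3 * ((j + 4)\<^sup>2 * B1)" .
    have "(1::nat) \<le> \<kappa> ^ 3" by (simp add: \<kappa>_def)
    then have "6 * 1 \<le> 72 * \<kappa> ^ 3" by linarith
    have "(6 * j + 17) * B2 \<le> 6 * ((j + 4) * B2)" by (simp add: algebra_simps)
    also have "\<dots> \<le> 72 * \<kappa> ^ 3 * ((j + 4) * B2)" using \<open>6 * 1 \<le> _\<close> by (intro mult_le_mono1) simp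
    finally show ?thesis using 1 unfolding round_cost_def distrib_left by linarith
  qed
  then show ?thesis using alg(2) pre unfolding \<kappa>_def by (intro exI[of _ alg]) (meson le_trans)
qed

text \<open>Here \<open>j\<close> is the binary logarithm rounded up; it bounds the recursion depth
  of inversion and the number of levels. Any positive power of \<open>n\<close> dominates
  it.\<close>

lemma log_bound:
  assumes "0 < \<eta>"
  obtains C :: real where "1 \<le> C" and
    "\<And>n::nat. 1 \<le> n \<Longrightarrow> \<exists>j. n \<le> 2 ^ j \<and> real (j + 4) \<le> C * real n powr \<eta>"
proof
  let ?C = "5 + 1 / (\<eta> * ln 2)"
  show "1 \<le> ?C" using assms by simp
  fix n :: nat assume n: "1 \<le> n"
  define j where "j = nat \<lceil>log 2 (real n)\<rceil>"
  have pos: "0 \<le> log 2 (real n)" using n by simp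
  have j: "log 2 (real n) \<le> real j" "real j \<le> log 2 (real n) + 1"
    unfolding j_def using pos by linarith+
  have "real n = 2 powr log 2 (real n)" using n by simp
  also have "\<dots> \<le> 2 powr real j" using j(1) by (intro powr_mono) auto
  also have "\<dots> = real (2 ^ j)" by (simp add: powr_realpow)
  finally have "n \<le> 2 ^ j" by (simp only: of_nat_le_iff)
  moreover have "real (j + 4) \<le> ?C * real n powr \<eta>"
  proof -
    have "ln (real n) \<le> real n powr \<eta> / \<eta>" using ln_powr_bound[of "real n" \<eta>] n assms by simp
    then have "log 2 (real n) \<le> real n powr \<eta> / \<eta> / ln 2"
      unfolding log_def by (intro divide_right_mono) auto
    moreover have "1 \<le> real n powr \<eta>" using n assms by (intro ge_one_powr_ge_zero) auto
    ultimately have "real (j + 4) \<le> real n powr \<eta> / \<eta> / ln 2 + 5 * real n powr \<eta>"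
      using j(2) by simp
    also have "\<dots> = ?C * real n powr \<eta>" by (simp add: field_simps)
    finally show ?thesis .
  qed
  ultimately show "\<exists>j. n \<le> 2 ^ j \<and> real (j + 4) \<le> ?C * real n powr \<eta>" by blast
qed

theorem theorem6p8:
  fixes \<epsilon>\<^sub>0 \<epsilon>\<^sub>1 \<delta> :: real and s :: nat
  assumes "0 \<le> \<epsilon>\<^sub>0" and "\<epsilon>\<^sub>0 \<le> \<epsilon>\<^sub>1" and "\<epsilon>\<^sub>1 \<le> 1" and "0 < \<delta>"
  shows "\<exists>(alg :: nat \<Rightarrow> 'a::field dyn_alg) (C :: real). \<forall>n\<ge>1.
    real (cost (preproc (alg n))) \<le> C * real n powr (omega TYPE('a) 1 1 1 + \<delta>) \<and>
    (\<forall>A ops F. valid_session n s (npow n \<epsilon>\<^sub>0) A ops F \<longrightarrow>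
      (\<forall>t. answers_correctly n (alg n) A ops F t \<and>
           real (cost (respond (alg n) (history F ops t)))
             \<le> C * (real n powr (omega TYPE('a) 1 \<epsilon>\<^sub>1 \<epsilon>\<^sub>0 - \<epsilon>\<^sub>0 + \<delta>) +
                    real n powr (omega TYPE('a) 1 1 \<epsilon>\<^sub>1 - \<epsilon>\<^sub>1 + \<delta>))))"
proof -
  \<comment> \<open>One quarter of \<open>\<delta>\<close> is the gap between the chosen exponent
    and the infimum; up to two more pay for factors \<open>j + 4\<close>.\<close>
  define \<eta> where "\<eta> = \<delta> / 4"
  have \<eta>: "0 < \<eta>" using assms by (simp add: \<eta>_def)
  have e1: "0 \<le> \<epsilon>\<^sub>1" using assms by simp
  obtain C1 \<tau>1 where 1: "0 \<le> C1" "1 + \<epsilon>\<^sub>1 \<le> \<tau>1" "\<tau>1 < omega TYPE('a) 1 \<epsilon>\<^sub>1 \<epsilon>\<^sub>0 + \<eta>"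
    "\<And>n. 1 \<le> n \<Longrightarrow> \<exists>p :: 'a prog. multiplies (npow n 1) (npow n \<epsilon>\<^sub>1) (npow n \<epsilon>\<^sub>0) p \<and>
      real (cost p) \<le> C1 * real n powr \<tau>1"
    using omega_program[of 1 \<epsilon>\<^sub>1 \<epsilon>\<^sub>0 \<eta>, where 'a = 'a] \<eta> e1 assms(1) by (metis zero_le_one)
  obtain C2 \<tau>2 where 2: "0 \<le> C2" "1 + 1 \<le> \<tau>2" "\<tau>2 < omega TYPE('a) 1 1 \<epsilon>\<^sub>1 + \<eta>"
    "\<And>n. 1 \<le> n \<Longrightarrow> \<exists>p :: 'a prog. multiplies (npow n 1) (npow n 1) (npow n \<epsilon>\<^sub>1) p \<and>
      real (cost p) \<le> C2 * real n powr \<tau>2"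
    using omega_program[of 1 1 \<epsilon>\<^sub>1 \<eta>, where 'a = 'a] \<eta> e1 by (metis zero_le_one)
  obtain C3 \<tau>3 where 3: "0 \<le> C3" "1 + 1 \<le> \<tau>3" "\<tau>3 < omega TYPE('a) 1 1 1 + \<eta>"
    "\<And>n. 1 \<le> n \<Longrightarrow> \<exists>p :: 'a prog. multiplies (npow n 1) (npow n 1) (npow n 1) p \<and>
      real (cost p) \<le> C3 * real n powr \<tau>3"
    using omega_program[of 1 1 1 \<eta>, where 'a = 'a] \<eta> by (metis zero_le_one)
  obtain Cj where Cj: "1 \<le> Cj"
    "\<And>n::nat. 1 \<le> n \<Longrightarrow> \<exists>j. n \<le> 2 ^ j \<and> real (j + 4) \<le> Cj * real n powr \<eta>"
    using log_bound[OF \<eta>] by metis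
  define D1 D2 D3 \<kappa> where "D1 = 20 * C1 + 5" and "D2 = 20 * C2 + 5" and "D3 = 20 * C3 + 5"
    and "\<kappa> = 72 * (real s + 2) ^ 3"
  have D: "0 \<le> D1" "0 \<le> D2" "0 \<le> D3" "0 \<le> \<kappa>" using 1 2 3 by (auto simp: D1_def D2_def D3_def \<kappa>_def)
  define C where "C = 6 * Cj * D3 + \<kappa> * (Cj\<^sup>2 * D1) + \<kappa> * (Cj * D2)"
  have C: "6 * Cj * D3 \<le> C" "\<kappa> * (Cj\<^sup>2 * D1) \<le> C" "\<kappa> * (Cj * D2) \<le> C"
    unfolding C_def using D Cj(1) by auto
  have C0: "0 \<le> C" unfolding C_def using D Cj(1) by simp
  let ?P = "\<lambda>n (alg :: 'a dyn_alg). real (cost (preproc alg)) \<le> C * real n powr (omega TYPE('a) 1 1 1 + \<delta>) \<and>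
    (\<forall>A ops F. valid_session n s (npow n \<epsilon>\<^sub>0) A ops F \<longrightarrow>
      (\<forall>t. answers_correctly n alg A ops F t \<and>
           real (cost (respond alg (history F ops t)))
             \<le> C * (real n powr (omega TYPE('a) 1 \<epsilon>\<^sub>1 \<epsilon>\<^sub>0 - \<epsilon>\<^sub>0 + \<delta>) +
                    real n powr (omega TYPE('a) 1 1 \<epsilon>\<^sub>1 - \<epsilon>\<^sub>1 + \<delta>))))"
  have "\<exists>alg. ?P n alg" if n: "1 \<le> n" for n
  proof -
    let ?T = "TYPE('a session \<Rightarrow> 'a)"
    obtain B1 where B1: "good ?T n (npow n \<epsilon>\<^sub>0) (npow n \<epsilon>\<^sub>1) B1" "real B1 \<le> D1 * real n powr (\<tau>1 - \<epsilon>\<^sub>0)"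
      using good_programs[OF assms(1,2,3) 1(1,2,4) n] unfolding D1_def by blast
    obtain B2 where B2: "good ?T n (npow n \<epsilon>\<^sub>1) n B2" "real B2 \<le> D2 * real n powr (\<tau>2 - \<epsilon>\<^sub>1)"
      using good_programs[OF e1 assms(3) order_refl 2(1,2,4) n] unfolding D2_def npow_1 by blast
    obtain B3 where B3: "good ?T n n n B3" "real B3 \<le> D3 * real n powr (\<tau>3 - 1)"
      using good_programs[OF zero_le_one order_refl order_refl 3(1,2,4) n] unfolding D3_def npow_1 by blast
    obtain j where j: "n \<le> 2 ^ j" "real (j + 4) \<le> Cj * real n powr \<eta>" using Cj(2)[OF n] by blast
    have l: "1 \<le> npow n \<epsilon>\<^sub>0" "npow n \<epsilon>\<^sub>0 \<le> npow n \<epsilon>\<^sub>1" "npow n \<epsilon>\<^sub>0 \<le> n"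
      using npow_ge_1[OF n assms(1)] npow_mono[OF n assms(2)] npow_mono[OF n, of \<epsilon>\<^sub>0 1] assms by auto
    obtain alg :: "'a dyn_alg" where pre: "cost (preproc alg) \<le> 6 * (n * (j + 4) * B3)"
      and alg: "\<And>A ops F t. valid_session n s (npow n \<epsilon>\<^sub>0) A ops F \<Longrightarrow>
        answers_correctly n alg A ops F t \<and>
        cost (respond alg (history F ops t)) \<le> 72 * (s + 2) ^ 3 * ((j + 4)\<^sup>2 * B1 + (j + 4) * B2)"
      using dynamic_inverse_good[OF n l j(1) B1(1) B2(1) B3(1), of s] by blast
    have mono: "real n powr a \<le> real n powr b" if "a \<le> b" for a b
      using that n by (intro powr_mono) auto
    have jB: "real (j + 4) * real B \<le> (Cj * D) * real n powr (\<eta> + a)"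
      if "real B \<le> D * real n powr a" for B D a
    proof -
      have "real (j + 4) * real B \<le> (Cj * real n powr \<eta>) * (D * real n powr a)"
        using j(2) that Cj(1) by (intro mult_mono) auto
      then show ?thesis by (simp add: powr_add ac_simps)
    qed
    have "real (cost (preproc alg)) \<le> real (6 * (n * (j + 4) * B3))" using pre by (simp only: of_nat_le_iff)
    also have "\<dots> = 6 * (real n powr 1 * (real (j + 4) * real B3))" using n by simp
    also have "\<dots> \<le> 6 * (real n powr 1 * ((Cj * D3) * real n powr (\<eta> + (\<tau>3 - 1))))"
      by (intro mult_left_mono jB B3(2)) auto
    also have "\<dots> = (6 * Cj * D3) * (real n powr 1 * real n powr (\<eta> + (\<tau>3 - 1)))" by simp
    also have "\<dots> = (6 * Cj * D3) * real n powr (\<eta> + \<tau>3)" by (simp only: powr_add[symmetric]) simp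
    also have "\<dots> \<le> C * real n powr (omega TYPE('a) 1 1 1 + \<delta>)"
      using C(1) 3(3) C0 \<eta> by (intro mult_mono mono) (auto simp: \<eta>_def)
    finally have pre': "real (cost (preproc alg)) \<le> C * real n powr (omega TYPE('a) 1 1 1 + \<delta>)" .
    have "real (72 * (s + 2) ^ 3 * ((j + 4)\<^sup>2 * B1 + (j + 4) * B2))
        = \<kappa> * (real (j + 4) * (real (j + 4) * real B1)) + \<kappa> * (real (j + 4) * real B2)"
      by (simp add: \<kappa>_def power2_eq_square algebra_simps)
    also have "\<dots> \<le> \<kappa> * ((Cj * real n powr \<eta>) * ((Cj * D1) * real n powr (\<eta> + (\<tau>1 - \<epsilon>\<^sub>0)))) +
        \<kappa> * ((Cj * D2) * real n powr (\<eta> + (\<tau>2 - \<epsilon>\<^sub>1)))"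
      by (intro add_mono mult_left_mono mult_mono jB B1(2) B2(2) j(2) D) (use Cj(1) in auto)
    also have "\<kappa> * ((Cj * real n powr \<eta>) * ((Cj * D1) * real n powr (\<eta> + (\<tau>1 - \<epsilon>\<^sub>0))))
        = (\<kappa> * (Cj\<^sup>2 * D1)) * real n powr (\<eta> + (\<eta> + (\<tau>1 - \<epsilon>\<^sub>0)))"
      unfolding powr_add power2_eq_square by (simp only: ac_simps)
    also have "\<dots> \<le> C * real n powr (omega TYPE('a) 1 \<epsilon>\<^sub>1 \<epsilon>\<^sub>0 - \<epsilon>\<^sub>0 + \<delta>)"
      using C(2) 1(3) C0 \<eta> by (intro mult_mono mono) (auto simp: \<eta>_def intro: order_trans)
    also have "\<kappa> * ((Cj * D2) * real n powr (\<eta> + (\<tau>2 - \<epsilon>\<^sub>1))) = (\<kappa> * (Cj * D2)) * real n powr (\<eta> + (\<tau>2 - \<epsilon>\<^sub>1))"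
      by simp
    also have "\<dots> \<le> C * real n powr (omega TYPE('a) 1 1 \<epsilon>\<^sub>1 - \<epsilon>\<^sub>1 + \<delta>)"
      using C(3) 2(3) C0 \<eta> by (intro mult_mono mono) (auto simp: \<eta>_def intro: order_trans)
    finally have round: "real (72 * (s + 2) ^ 3 * ((j + 4)\<^sup>2 * B1 + (j + 4) * B2))
        \<le> C * (real n powr (omega TYPE('a) 1 \<epsilon>\<^sub>1 \<epsilon>\<^sub>0 - \<epsilon>\<^sub>0 + \<delta>) +
               real n powr (omega TYPE('a) 1 1 \<epsilon>\<^sub>1 - \<epsilon>\<^sub>1 + \<delta>))"
      by (simp add: distrib_left)
    have "real (cost (respond alg (history F ops t)))
        \<le> C * (real n powr (omega TYPE('a) 1 \<epsilon>\<^sub>1 \<epsilon>\<^sub>0 - \<epsilon>\<^sub>0 + \<delta>) +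
               real n powr (omega TYPE('a) 1 1 \<epsilon>\<^sub>1 - \<epsilon>\<^sub>1 + \<delta>))"
      if "valid_session n s (npow n \<epsilon>\<^sub>0) A ops F" for A :: "'a mat" and ops F t
    proof -
      have "real (cost (respond alg (history F ops t)))
          \<le> real (72 * (s + 2) ^ 3 * ((j + 4)\<^sup>2 * B1 + (j + 4) * B2))"
        using alg[OF that, of t] by (simp only: of_nat_le_iff)
      with round show ?thesis by (rule order_trans[rotated])
    qed
    with pre' alg show ?thesis by blast
  qed
  then have "\<exists>alg. \<forall>n\<ge>1. ?P n (alg n)" by metis
  then show ?thesis by blast
qed

end
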